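(* There is an algorithm which, given a graph $G$ with $n$ vertices that contains no odd hole, decides whether $G$ contains an odd prism, and which runs in time $O(n^{20})$.
   Context: Graphs are finite, simple, undirected. "Contains" refers to induced subgraphs. A path is a chordless path; its length is its number of edges. A hole is a chordless cycle with at least 4 vertices. A prism is a graph whose vertex set is partitioned into three sets inducing paths $P_1,P_2,P_3$, each of length at least 1, $P_i$ having ends $a_i,b_i$, such that $\{a_1,a_2,a_3\}$ and $\{b_1,b_2,b_3\}$ are triangles and there are no edges between different $P_i$'s other than those of these two triangles. It is odd if the three paths all have odd length. Time is worst-case number of elementary operations, up to a multiplicative constant. *)

theory Defs
  imports Complex_Main "HOL-Library.Landau_Symbols"
begin

section \<open>Graphs, holes and prisms\<close>

record 'a ugraph =
  verts :: "'a set"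
  adj :: "'a \<Rightarrow> 'a \<Rightarrow> bool"

definition simple_graph :: "'a ugraph \<Rightarrow> bool" where
  "simple_graph G \<longleftrightarrow>
     finite (verts G) \<and>
     (\<forall>u v. adj G u v \<longrightarrow> u \<in> verts G \<and> v \<in> verts G) \<and>
     (\<forall>u. \<not> adj G u u) \<and>
     (\<forall>u v. adj G u v \<longrightarrow> adj G v u)"

definition induced :: "'a ugraph \<Rightarrow> 'a set \<Rightarrow> 'a ugraph" where
  "induced G X =
     \<lparr>verts = verts G \<inter> X, adj = (\<lambda>u v. u \<in> X \<and> v \<in> X \<and> adj G u v)\<rparr>"

definition contains :: "('a ugraph \<Rightarrow> bool) \<Rightarrow> 'a ugraph \<Rightarrow> bool" where
  "contains H G \<longleftrightarrow> (\<exists>X \<subseteq> verts G. H (induced G X))"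

text \<open>The graph is a chordless path whose vertices, listed from end to end, are those
  of the list; the ends are \<open>hd p\<close> and \<open>last p\<close>.\<close>

definition is_path :: "'a ugraph \<Rightarrow> 'a list \<Rightarrow> bool" where
  "is_path G p \<longleftrightarrow>
     p \<noteq> [] \<and> distinct p \<and> set p = verts G \<and>
     (\<forall>i < length p. \<forall>j < length p.
        adj G (p ! i) (p ! j) \<longleftrightarrow> j = Suc i \<or> i = Suc j)"

definition path_length :: "'a list \<Rightarrow> nat" where
  "path_length p = length p - 1"

definition is_hole :: "'a ugraph \<Rightarrow> 'a list \<Rightarrow> bool" where
  "is_hole G c \<longleftrightarrow>
     4 \<le> length c \<and> distinct c \<and> set c = verts G \<and>
     (\<forall>i < length c. \<forall>j < length c.
        adj G (c ! i) (c ! j) \<longleftrightarrow>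
          j = Suc i mod length c \<or> i = Suc j mod length c)"

definition is_odd_hole :: "'a ugraph \<Rightarrow> bool" where
  "is_odd_hole G \<longleftrightarrow> (\<exists>c. is_hole G c \<and> odd (length c))"

text \<open>The last clause says both that the three first vertices and the three last
  vertices form triangles and that there are no other edges between different paths.\<close>

definition is_prism :: "'a ugraph \<Rightarrow> (nat \<Rightarrow> 'a list) \<Rightarrow> bool" where
  "is_prism G P \<longleftrightarrow>
     verts G = (\<Union>i<3. set (P i)) \<and>
     (\<forall>i<3. is_path (induced G (set (P i))) (P i) \<and> 1 \<le> path_length (P i)) \<and>
     (\<forall>i<3. \<forall>j<3. i \<noteq> j \<longrightarrow>
        set (P i) \<inter> set (P j) = {} \<and>
        (\<forall>u \<in> set (P i). \<forall>v \<in> set (P j).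
           adj G u v \<longleftrightarrow>
             u = hd (P i) \<and> v = hd (P j) \<or> u = last (P i) \<and> v = last (P j)))"

definition is_odd_prism :: "'a ugraph \<Rightarrow> bool" where
  "is_odd_prism G \<longleftrightarrow> (\<exists>P. is_prism G P \<and> (\<forall>i<3. odd (path_length (P i))))"


section \<open>A word RAM\<close>

text \<open>Algorithms are programs of a while language over registers and arrays of natural
  numbers, both addressed by constants in the program text. Time is the number of
  elementary operations: each node of an expression and each execution of a command
  costs one unit.

  Every number that is stored, and every index at which an array is written, has to be
  at most the word bound \<open>W\<close>; otherwise the execution is stuck and has no result. This
  is what makes unit cost for multiplication and division legitimate: if \<open>W\<close> is polynomial
  in the input size, then words have \<open>O(log n)\<close> bits, and since expressions have a size
  fixed by the program, intermediate values have \<open>O(log n)\<close> bits too.\<close>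

datatype aexp =
    Const nat
  | Reg nat
  | Read nat aexp
  | Plus aexp aexp
  | Minus aexp aexp
  | Times aexp aexp
  | Div aexp aexp
  | Mod aexp aexp

datatype bexp =
    Less aexp aexp
  | Equal aexp aexp
  | Neg bexp
  | Conj bexp bexp

datatype com =
    Skip
  | Assign nat aexp
  | Store nat aexp aexp
  | Seq com com
  | If bexp com com
  | While bexp com

record state =
  regs :: "nat \<Rightarrow> nat"
  arrs :: "nat \<Rightarrow> nat \<Rightarrow> nat"

fun aval :: "state \<Rightarrow> aexp \<Rightarrow> nat" where
  "aval s (Const c) = c"
| "aval s (Reg x) = regs s x"
| "aval s (Read a e) = arrs s a (aval s e)"
| "aval s (Plus e f) = aval s e + aval s f"
| "aval s (Minus e f) = aval s e - aval s f"
| "aval s (Times e f) = aval s e * aval s f"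
| "aval s (Div e f) = aval s e div aval s f"
| "aval s (Mod e f) = aval s e mod aval s f"

fun bval :: "state \<Rightarrow> bexp \<Rightarrow> bool" where
  "bval s (Less e f) = (aval s e < aval s f)"
| "bval s (Equal e f) = (aval s e = aval s f)"
| "bval s (Neg b) = (\<not> bval s b)"
| "bval s (Conj b c) = (bval s b \<and> bval s c)"

fun acost :: "aexp \<Rightarrow> nat" where
  "acost (Const c) = 1"
| "acost (Reg x) = 1"
| "acost (Read a e) = 1 + acost e"
| "acost (Plus e f) = 1 + acost e + acost f"
| "acost (Minus e f) = 1 + acost e + acost f"
| "acost (Times e f) = 1 + acost e + acost f"
| "acost (Div e f) = 1 + acost e + acost f"
| "acost (Mod e f) = 1 + acost e + acost f"

fun bcost :: "bexp \<Rightarrow> nat" where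
  "bcost (Less e f) = 1 + acost e + acost f"
| "bcost (Equal e f) = 1 + acost e + acost f"
| "bcost (Neg b) = 1 + bcost b"
| "bcost (Conj b c) = 1 + bcost b + bcost c"

text \<open>\<open>exec W c s t s'\<close>: with word bound \<open>W\<close>, the program \<open>c\<close> started in state \<open>s\<close>
  terminates in state \<open>s'\<close> after \<open>t\<close> elementary operations.\<close>

inductive exec :: "nat \<Rightarrow> com \<Rightarrow> state \<Rightarrow> nat \<Rightarrow> state \<Rightarrow> bool" for W :: nat where
  Skip: "exec W Skip s 1 s"
| Assign: "aval s e \<le> W \<Longrightarrow>
    exec W (Assign x e) s (1 + acost e) (s\<lparr>regs := (regs s)(x := aval s e)\<rparr>)"
| Store: "aval s e \<le> W \<Longrightarrow> aval s f \<le> W \<Longrightarrow>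
    exec W (Store a e f) s (1 + acost e + acost f)
      (s\<lparr>arrs := (arrs s)(a := (arrs s a)(aval s e := aval s f))\<rparr>)"
| Seq: "exec W c s t s' \<Longrightarrow> exec W d s' t' s'' \<Longrightarrow> exec W (Seq c d) s (1 + t + t') s''"
| IfTrue: "bval s b \<Longrightarrow> exec W c s t s' \<Longrightarrow> exec W (If b c d) s (1 + bcost b + t) s'"
| IfFalse: "\<not> bval s b \<Longrightarrow> exec W d s t s' \<Longrightarrow> exec W (If b c d) s (1 + bcost b + t) s'"
| WhileFalse: "\<not> bval s b \<Longrightarrow> exec W (While b c) s (1 + bcost b) s"
| WhileTrue: "bval s b \<Longrightarrow> exec W c s t s' \<Longrightarrow> exec W (While b c) s' t' s'' \<Longrightarrow>
    exec W (While b c) s (1 + bcost b + t + t') s''"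

lemma exec_deterministic:
  "exec W c s t s' \<Longrightarrow> exec W c s u r \<Longrightarrow> u = t \<and> r = s'"
proof (induction arbitrary: u r rule: exec.induct)
  case (Skip s)
  from Skip.prems show ?case by cases auto
next
  case (Assign s e x)
  from Assign.prems show ?case by cases auto
next
  case (Store s e f a)
  from Store.prems show ?case by cases auto
next
  case (Seq c s t s' d t' s'')
  from Seq.prems show ?case by cases (use Seq.IH in fast)
next
  case (IfTrue s b c t s' d)
  from IfTrue.prems show ?case by cases (use IfTrue.hyps(1) IfTrue.IH in fast)+
next
  case (IfFalse s b d t s' c)
  from IfFalse.prems show ?case by cases (use IfFalse.hyps(1) IfFalse.IH in fast)+
next
  case (WhileFalse s b c)
  from WhileFalse.prems show ?case by cases (use WhileFalse.hyps in auto)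
next
  case (WhileTrue s b c t s' t' s'')
  from WhileTrue.prems show ?case by cases (use WhileTrue.hyps(1) WhileTrue.IH in fast)+
qed

text \<open>The input is a graph on \<open>{..<n}\<close>: register 0 holds \<open>n\<close> and array 0 holds the
  adjacency matrix row by row, the entry for \<open>(u, v)\<close> being at index \<open>u * n + v\<close>.
  Everything else is 0.\<close>

definition input_state :: "nat \<Rightarrow> nat ugraph \<Rightarrow> state" where
  "input_state n G =
     \<lparr>regs = (\<lambda>x. if x = 0 then n else 0),
      arrs = (\<lambda>a i. if a = 0 \<and> i < n * n \<and> adj G (i div n) (i mod n) then 1 else 0)\<rparr>"

definition answer :: "state \<Rightarrow> nat" where
  "answer s = regs s 1"

end

theory Submission
  imports Defs "HOL-Real_Asymp.Real_Asymp"
begin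

text \<open>In a graph without odd holes there are no pyramids, and the three paths of a prism have the
  same parity. Take an odd prism with the fewest vertices, and let \<open>p\<close>, \<open>q\<close>, \<open>r\<close> be its paths in order
  of length. Replace one half of \<open>p\<close> by a shortest path \<open>R\<close> with the same ends that avoids the other
  four corners and their neighbours. If \<open>R\<close> had a neighbour in \<open>q\<close> or \<open>r\<close>, then a part \<open>Q\<close> of \<open>R\<close> would be a
  rung, and the prism and \<open>Q\<close> together would be the line graph of a subdivision of \<open>K\<^sub>4\<close>. Each pair
  of its four triangles belongs to a prism, one of these other prisms is odd, and since \<open>Q\<close> is
  shorter than half of \<open>p\<close> it is smaller than the first one. So \<open>p\<close> can be replaced by two shortest
  paths through its midpoint.

  The same works for \<open>q\<close> and shortest paths that avoid the new \<open>p\<close> and its neighbours, except that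
  there may now be a rung from \<open>q\<close> to \<open>r\<close> that is at least as long as \<open>p\<close>. In that case the shortest path
  has to return to \<open>q\<close> along a second rung. If the rungs meet \<open>q\<close> at different edges, the
  part of the path between them is a path of a smaller odd prism that contains \<open>p\<close> and no
  vertex inside \<open>r\<close>; if they meet the same edge, there is a shortcut for \<open>q\<close>. Finally \<open>r\<close> can be replaced by any
  shortest path that avoids \<open>p\<close>, \<open>q\<close> and their neighbours. So it suffices to guess the
  six corners and the midpoints of \<open>p\<close> and \<open>q\<close>, to run five breadth-first searches for each
  guess, and to check the result.\<close>

section \<open>Chordless paths, holes and pyramids\<close>

text \<open>Paths are lists of vertices, so an odd path is a list of even length, and minimality
  counts vertices. The obstacle is that a search returns some shortest path and not the path of the
  prism, at a time when the other paths may be unknown except for their ends. Hence the first two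
  replacements have to yield a minimal odd prism with the same corners and lengths again, whichever
  shortest path is found; only then does the rest of the guess fit the new prism. What decides is a
  comparison of the rung \<open>Q\<close> with all three paths: half a path has too few inner
  vertices for \<open>|p| <= 2|Q|\<close>, and the order of the lengths excludes the other
  alternatives as far as it can. Wrong guesses are harmless because the final check accepts genuine
  odd prisms only. So soundness comes from the check, and completeness concerns a single guess.
  There are \<open>n^8\<close> guesses, each of cost \<open>O(n^3)\<close>, which gives
  \<open>O(n^11)\<close>.\<close>

fun chordless :: "('a \<Rightarrow> 'a \<Rightarrow> bool) \<Rightarrow> 'a list \<Rightarrow> bool" where
  "chordless E [] = True"
| "chordless E [x] = True"
| "chordless E (x # y # p) =
     (E x y \<and> x \<notin> set (y # p) \<and> (\<forall>z \<in> set p. \<not> E x z) \<and> chordless E (y # p))"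

text \<open>For chordless \<open>p\<close> and \<open>q\<close> this makes \<open>p @ rev q\<close>
  a chordless cycle as soon as it has four vertices. A list may have a single vertex, which is then
  joined to both ends of the other list; rungs with one vertex need this.\<close>

definition ladder :: "('a \<Rightarrow> 'a \<Rightarrow> bool) \<Rightarrow> 'a list \<Rightarrow> 'a list \<Rightarrow> bool" where
  "ladder E p q \<longleftrightarrow>
     (\<forall>u \<in> set p. \<forall>v \<in> set q. u \<noteq> v \<and>
        (E u v \<longleftrightarrow> u = hd p \<and> v = hd q \<or> u = last p \<and> v = last q))"

text \<open>The heads form one triangle and the last vertices the other, so the three lists are
  oriented alike. An odd prism is one whose lists have even length.\<close>

definition prism :: "('a \<Rightarrow> 'a \<Rightarrow> bool) \<Rightarrow> 'a list \<Rightarrow> 'a list \<Rightarrow> 'a list \<Rightarrow> bool" where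
  "prism E p q r \<longleftrightarrow>
     chordless E p \<and> chordless E q \<and> chordless E r \<and>
     2 \<le> length p \<and> 2 \<le> length q \<and> 2 \<le> length r \<and>
     ladder E p q \<and> ladder E p r \<and> ladder E q r"

lemma chordless_distinct: "chordless E p \<Longrightarrow> distinct p"
  by (induction E p rule: chordless.induct) auto

lemma chordless_successively: "chordless E p \<Longrightarrow> successively E p"
  by (induction E p rule: chordless.induct) auto

text \<open>The tool for assembling and cutting paths. Both pieces are nonempty so that
  \<open>last p\<close> and \<open>hd q\<close> are the vertices at the cut.\<close>

lemma chordless_append:
  assumes "p \<noteq> []" "q \<noteq> []"
  shows "chordless E (p @ q) \<longleftrightarrow>
    chordless E p \<and> chordless E q \<and>
    (\<forall>u \<in> set p. \<forall>v \<in> set q. u \<noteq> v \<and> (E u v \<longleftrightarrow> u = last p \<and> v = hd q))"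
  using assms
proof (induction E p rule: chordless.induct)
  case (2 E x)
  then show ?case by (cases q; cases "tl q") auto
next
  case (3 E x y p)
  then have q: "q \<noteq> []" by simp
  have "E u v \<longleftrightarrow> u = last (y # p) \<and> v = hd q" if "chordless E (x # y # p)" "u = x"
     "v \<in> set q" "\<not> E x v" for u v
    using that by (metis chordless_distinct distinct.simps(2) last_in_set list.distinct(1))
  have l: "last (y # p) \<in> set (y # p)" by simp
  from 3 q l show ?case
    by (auto simp del: last.simps simp: last_ConsR)
qed auto

text \<open>A repeated vertex or a chord would give a shorter walk with the same ends. Competitors
  stay inside \<open>set p\<close>, so the lemma applies both to walks that avoid some set and to
  walks chosen inside a given one.\<close>

lemma shortest_walk_chordless:
  assumes "successively E p" "p \<noteq> []"
    and "\<And>q. successively E q \<Longrightarrow> q \<noteq> [] \<Longrightarrow> hd q = hd p \<Longrightarrow> last q = last p \<Longrightarrow>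
      set q \<subseteq> set p \<Longrightarrow> length p \<le> length q"
  shows "chordless E p"
  using assms
proof (induction E p rule: chordless.induct)
  case (3 E x y p)
  have tl: "chordless E (y # p)"
  proof (rule "3.IH")
    show "successively E (y # p)" using 3 by simp
    fix q assume q: "successively E q" "q \<noteq> []" "hd q = hd (y # p)" "last q = last (y # p)"
      "set q \<subseteq> set (y # p)"
    show "length (y # p) \<le> length q"
      using "3.prems"(3)[of "x # q"] q "3.prems"(1) by (auto simp: successively_Cons)
  qed simp
  have "x \<notin> set (y # p)"
  proof
    assume "x \<in> set (y # p)"
    then obtain a b where ab: "y # p = a @ x # b" by (meson split_list)
    have s: "successively E (y # p)" using 3 by simp
    have "length (x # y # p) \<le> length (x # b)"
    proof (rule "3.prems"(3))
      show "successively E (x # b)" using s unfolding ab successively_append_iff by simp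
      show "last (x # b) = last (x # y # p)" using ab by simp
      show "set (x # b) \<subseteq> set (x # y # p)" unfolding ab by auto
    qed auto
    then show False unfolding ab by simp
  qed
  moreover have "\<not> E x z" if "z \<in> set p" for z
  proof
    assume e: "E x z"
    obtain a b where ab: "p = a @ z # b" using split_list[OF \<open>z \<in> set p\<close>] by blast
    have s: "successively E (z # b)" using 3
      unfolding ab by (auto simp: successively_append_iff successively_Cons)
    have "length (x # y # p) \<le> length (x # z # b)"
    proof (rule "3.prems"(3))
      show "successively E (x # z # b)" using s e by simp
      show "last (x # z # b) = last (x # y # p)" using ab by simp
      show "set (x # z # b) \<subseteq> set (x # y # p)" unfolding ab by auto
    qed auto
    then show False unfolding ab by simp
  qed
  ultimately show ?case using tl "3.prems"(1) by auto
qed auto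

lemma all_pairs_Suc:
  fixes P :: "nat \<Rightarrow> nat \<Rightarrow> bool"
  shows "(\<forall>j < Suc n. \<forall>i < j. P i j) \<longleftrightarrow>
    (\<forall>j < n. P 0 (Suc j)) \<and> (\<forall>j < n. \<forall>i < j. P (Suc i) (Suc j))"
  by (force simp: less_Suc_eq_0_disj)

lemma chordless_nth:
  "chordless E p \<longleftrightarrow>
    (\<forall>j < length p. \<forall>i < j. p ! i \<noteq> p ! j \<and> (E (p ! i) (p ! j) \<longleftrightarrow> j = Suc i))"
proof (induction E p rule: chordless.induct)
  case (3 E x y p)
  have "(\<forall>j < length (y # p). x \<noteq> (y # p) ! j \<and> (E x ((y # p) ! j) \<longleftrightarrow> j = 0)) \<longleftrightarrow>
      x \<notin> set (y # p) \<and> E x y \<and> (\<forall>z \<in> set p. \<not> E x z)"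
    by (auto simp: all_set_conv_all_nth less_Suc_eq_0_disj in_set_conv_nth)
  then show ?case using "3.IH"
    by (simp only: chordless.simps length_Cons[of x] all_pairs_Suc) auto
qed auto

locale graph =
  fixes E :: "'a \<Rightarrow> 'a \<Rightarrow> bool"
  assumes E_sym: "E u v \<Longrightarrow> E v u" and E_irrefl: "\<not> E u u"
begin

lemma E_commute: "E u v \<longleftrightarrow> E v u"
  using E_sym by blast

lemma chordless_rev [simp]: "chordless E (rev p) \<longleftrightarrow> chordless E p"
proof (induction p)
  case (Cons x p)
  show ?case
  proof (cases "p = []")
    case False
    then have "chordless E (rev (x # p)) \<longleftrightarrow> chordless E (rev p) \<and>
        (\<forall>u \<in> set p. u \<noteq> x \<and> (E u x \<longleftrightarrow> u = hd p))"
      by (simp add: chordless_append last_rev)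
    moreover have "chordless E (x # p) \<longleftrightarrow> chordless E p \<and>
        (\<forall>u \<in> set p. u \<noteq> x \<and> (E x u \<longleftrightarrow> u = hd p))"
      using False chordless_append[of "[x]" p E] by auto
    ultimately show ?thesis using Cons E_commute by simp
  qed simp
qed simp

lemma ladder_sym: "ladder E p q \<Longrightarrow> ladder E q p"
  unfolding ladder_def using E_commute by metis

lemma ladder_rev: "p \<noteq> [] \<Longrightarrow> q \<noteq> [] \<Longrightarrow> ladder E p q \<Longrightarrow> ladder E (rev p) (rev q)"
  unfolding ladder_def by (auto simp: hd_rev last_rev)

lemma prism_perm:
  assumes "prism E p q r"
  shows "prism E q p r" "prism E p r q" "prism E q r p" "prism E r p q" "prism E r q p"
  using assms ladder_sym unfolding prism_def by auto

lemma prism_rev: "prism E p q r \<Longrightarrow> prism E (rev p) (rev q) (rev r)"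
  unfolding prism_def by (auto intro!: ladder_rev)

text \<open>Turns missing edges into disjointness: a vertex without neighbours on a path of at least
  two vertices does not lie on it.\<close>

lemma neighbour_in_path:
  assumes "chordless E p" "2 \<le> length p" "x \<in> set p"
  shows "\<exists>z \<in> set p. E x z"
proof -
  obtain a b where p: "p = a @ x # b" using assms(3) by (meson split_list)
  have s: "successively E (a @ x # b)" using chordless_successively[OF assms(1)] p by simp
  show ?thesis
  proof (cases b)
    case (Cons y b')
    then have "E x y" using s by (simp add: successively_append_iff)
    then show ?thesis using p Cons by auto
  next
    case Nil
    then have "a \<noteq> []" using assms(2) p by (cases a) auto
    then have "E (last a) x" using s by (simp add: successively_append_iff)
    then have "E x (last a)" by (rule E_sym)
    moreover have "last a \<in> set p" using p \<open>a \<noteq> []\<close> by simp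
    ultimately show ?thesis by blast
  qed
qed

end

locale no_odd_hole = graph +
  assumes hole_even: "4 \<le> length c \<Longrightarrow> distinct c \<Longrightarrow>
    (\<And>i j. i < length c \<Longrightarrow> j < length c \<Longrightarrow>
      E (c ! i) (c ! j) \<longleftrightarrow> j = Suc i mod length c \<or> i = Suc j mod length c) \<Longrightarrow>
    even (length c)"
begin

text \<open>The list \<open>p @ rev q\<close> runs around a hole. With three vertices it would be a
  triangle, hence the bound four.\<close>

lemma ladder_even:
  assumes p: "chordless E p" "p \<noteq> []" and q: "chordless E q" "q \<noteq> []"
    and l: "ladder E p q" and len: "4 \<le> length p + length q"
  shows "even (length p + length q)"
proof -
  define c where "c = p @ rev q"
  define N where "N = length c"
  have N: "N = length p + length q" by (simp add: N_def c_def)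
  have dp: "distinct p" "distinct q" using p q chordless_distinct by auto
  have dis: "distinct c" using dp l unfolding c_def ladder_def by auto
  have cp: "c ! i = p ! i" if "i < length p" for i using that by (simp add: c_def nth_append)
  have cq: "c ! i = q ! (N - Suc i)" if "length p \<le> i" "i < N" for i
    using that N by (simp add: c_def nth_append rev_nth add.commute)
  \<comment> \<open>For \<open>i < j\<close> cyclic succession means the next position or the
    closing pair \<open>0\<close>, \<open>N - 1\<close>. The cases are: both positions in
    \<open>p\<close>, one in each list, both in \<open>q\<close>, where reversal turns position
    \<open>i\<close> of \<open>c\<close> into position \<open>N - Suc i\<close> of
    \<open>q\<close>.\<close>
  have *: "E (c ! i) (c ! j) \<longleftrightarrow> j = Suc i \<or> (i = 0 \<and> Suc j = N)"
    if ij: "i < j" "j < N" for i j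
  proof -
    consider "j < length p" | "i < length p" "length p \<le> j" | "length p \<le> i" using ij by linarith
    then show ?thesis
    proof cases
      case 1
      have "Suc j \<noteq> N" using 1 N q(2) by (cases q) auto
      moreover have "E (p ! i) (p ! j) \<longleftrightarrow> j = Suc i"
        using p(1) 1 ij unfolding chordless_nth by blast
      ultimately show ?thesis using cp 1 ij by simp
    next
      case 2
      have u: "p ! i \<in> set p" and v: "q ! (N - Suc j) \<in> set q" using 2 ij N by auto
      have "p ! i = hd p \<longleftrightarrow> i = 0"
        using p(2) dp(1) 2 by (simp add: hd_conv_nth nth_eq_iff_index_eq)
      moreover have "p ! i = last p \<longleftrightarrow> i = length p - 1"
        using p(2) dp(1) 2 by (simp add: last_conv_nth nth_eq_iff_index_eq)
      moreover have "q ! (N - Suc j) = hd q \<longleftrightarrow> N - Suc j = 0"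
        using q(2) dp(2) 2 ij N by (simp add: hd_conv_nth nth_eq_iff_index_eq)
      moreover have "q ! (N - Suc j) = last q \<longleftrightarrow> N - Suc j = length q - 1"
        using q(2) dp(2) 2 ij N by (subst last_conv_nth) (auto simp: nth_eq_iff_index_eq)
      ultimately have "E (p ! i) (q ! (N - Suc j)) \<longleftrightarrow>
          i = 0 \<and> N - Suc j = 0 \<or> i = length p - 1 \<and> N - Suc j = length q - 1"
        using l u v unfolding ladder_def by auto
      then have "E (c ! i) (c ! j) \<longleftrightarrow>
          i = 0 \<and> N - Suc j = 0 \<or> i = length p - 1 \<and> N - Suc j = length q - 1"
        using cp[of i] cq[of j] 2 ij by simp
      moreover have "0 < length p" "0 < length q" using p q by auto
      ultimately show ?thesis using 2 ij N by linarith
    next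
      case 3
      have "E (q ! (N - Suc j)) (q ! (N - Suc i)) \<longleftrightarrow> N - Suc i = Suc (N - Suc j)"
        using q(1) 3 ij N unfolding chordless_nth by auto
      moreover have "E (c ! i) (c ! j) \<longleftrightarrow> E (q ! (N - Suc j)) (q ! (N - Suc i))"
        using 3 ij cq E_commute by simp
      moreover have "i \<noteq> 0" using 3 p(2) by (cases p) auto
      ultimately show ?thesis using 3 ij by auto
    qed
  qed
  have "E (c ! i) (c ! j) \<longleftrightarrow> j = Suc i mod N \<or> i = Suc j mod N" if "i < N" "j < N" for i j
  proof -
    have m: "Suc k mod N = (if Suc k = N then 0 else Suc k)" if "k < N" for k
      using that by (auto simp: mod_Suc)
    consider "i < j" | "i = j" | "j < i" by linarith
    then show ?thesis
    proof cases
      case 1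
      then show ?thesis using * that len N m by auto
    next
      case 2
      then show ?thesis using E_irrefl that len N m by auto
    next
      case 3
      then show ?thesis using *[of j i] that len N m E_commute[of "c ! i" "c ! j"] by auto
    qed
  qed
  then have "even N" using hole_even[of c] dis len N N_def by auto
  then show ?thesis using N by simp
qed

text \<open>Each two paths of a prism bound a hole, so the parity of one path decides that of all
  three.\<close>

lemma prism_parity:
  assumes "prism E p q r"
  shows "even (length p) \<longleftrightarrow> even (length q)" "even (length p) \<longleftrightarrow> even (length r)"
proof -
  have "p \<noteq> []" "q \<noteq> []" "r \<noteq> []" using assms unfolding prism_def by auto
  then have "even (length p + length q)" "even (length p + length r)"
    using assms ladder_even[of p q] ladder_even[of p r] unfolding prism_def by linarith+
  then show "even (length p) \<longleftrightarrow> even (length q)" "even (length p) \<longleftrightarrow> even (length r)" by auto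
qed

text \<open>A pyramid with apex \<open>last p\<close>: of the three cycles through two of its paths, one is odd.\<close>

lemma no_pyramid:
  assumes "chordless E p" "chordless E q" "chordless E r" "2 \<le> length p" "q \<noteq> []" "r \<noteq> []"
    and pq: "ladder E p q" and "ladder E p r"
    and qr: "\<And>u v. u \<in> set q \<Longrightarrow> v \<in> set r \<Longrightarrow> u \<noteq> v \<and> (E u v \<longleftrightarrow> u = hd q \<and> v = hd r)"
    and "4 \<le> length p + length q" "4 \<le> length p + length r" "3 \<le> length q + length r"
  shows False
proof -
  have hl: "hd p \<noteq> last p" "p \<noteq> []" using assms(1,4) chordless_distinct[of E p]
    by (cases p; auto)+
  have lp: "last p \<in> set p" "hd p \<in> set p" using hl by auto
  have lq: "u \<noteq> last p \<and> (E u (last p) \<longleftrightarrow> u = last q)" if "u \<in> set q" for u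
    using pq lp hl that E_commute[of u "last p"] unfolding ladder_def by auto
  have "chordless E (q @ [last p])"
    using assms(2,5) lq by (subst chordless_append) auto
  moreover have "ladder E (q @ [last p]) r"
  proof -
    have "last p \<noteq> v \<and> (E (last p) v \<longleftrightarrow> v = last r)" if "v \<in> set r" for v
      using assms(8) lp hl that unfolding ladder_def by auto
    moreover have "last p \<notin> set q" using pq lp unfolding ladder_def by auto
    moreover have "hd q \<in> set q" using assms(5) by auto
    ultimately show ?thesis using qr assms(5) unfolding ladder_def by auto
  qed
  \<comment> \<open>The three cycles have \<open>|p| + |q|\<close>, \<open>|p| + |r|\<close> and
    \<open>|q| + 1 + |r|\<close> vertices, the \<open>1\<close> being the apex. The sum is odd, so
    they cannot all be even.\<close>
  ultimately have "even (length (q @ [last p]) + length r)"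
    using assms by (intro ladder_even) auto
  moreover have "even (length p + length q)" "even (length p + length r)"
    using ladder_even[of p q] ladder_even[of p r] assms hl by blast+
  ultimately show False by auto
qed

lemma chordless_ends_neq: "chordless E p \<Longrightarrow> 2 \<le> length p \<Longrightarrow> hd p \<noteq> last p"
  using chordless_distinct[of E p] by (cases p) auto

lemma ladder_appendD:
  assumes "ladder E (s @ t) q" "distinct (s @ t)" "s \<noteq> []" "t \<noteq> []" "u \<in> set s" "v \<in> set q"
  shows "E u v \<longleftrightarrow> u = hd s \<and> v = hd q"
proof -
  have "u \<noteq> last t" using assms last_in_set[of t] by auto
  then show ?thesis using assms unfolding ladder_def by auto
qed

lemma ladder_appendD2:
  assumes "ladder E (s @ t) q" "distinct (s @ t)" "s \<noteq> []" "t \<noteq> []" "u \<in> set t" "v \<in> set q"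
  shows "E u v \<longleftrightarrow> u = last t \<and> v = last q"
proof -
  have "u \<noteq> hd s" using assms(2,5) hd_in_set[OF assms(3)] unfolding distinct_append by blast
  then show ?thesis using assms unfolding ladder_def by auto
qed

section \<open>Rungs\<close>

text \<open>\<open>hd T\<close>, \<open>hd p\<close> and \<open>hd r\<close> form a triangle, and
  \<open>T\<close> leads from it to a vertex \<open>x = last T\<close> that sees \<open>p\<close>.
  If \<open>x\<close> had only one neighbour on \<open>p\<close>, or if its first and last
  neighbours there were more than one edge apart, the triangle would belong to a pyramid. The
  premise \<open>len\<close> excludes that \<open>hd T\<close>, \<open>x\<close>,
  \<open>hd p\<close> are a triangle with \<open>T\<close> of two vertices, where the cycle through
  \<open>T\<close> would be too short.\<close>

lemma two_neighbours:
  assumes p: "chordless E p" "2 \<le> length p" and r: "chordless E r" "r \<noteq> []" "2 \<le> length r" and pr: "ladder E p r"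
    and T: "chordless E T" "2 \<le> length T"
    and Tr: "\<And>x z. x \<in> set T \<Longrightarrow> z \<in> set r \<Longrightarrow> x \<noteq> z \<and> (E x z \<longleftrightarrow> x = hd T \<and> z = hd r)"
    and Tp: "\<And>x z. x \<in> set T \<Longrightarrow> z \<in> set p \<Longrightarrow> x \<noteq> z"
      "\<And>x z. x \<in> set T \<Longrightarrow> z \<in> set p \<Longrightarrow> x \<noteq> last T \<Longrightarrow> E x z \<longleftrightarrow> x = hd T \<and> z = hd p"
    and y0: "y0 \<in> set p" "y0 \<noteq> hd p" "E (last T) y0"
    and len: "3 \<le> length T \<or> \<not> E (last T) (hd p)"
  shows "\<exists>u v. p = u @ v \<and> u \<noteq> [] \<and> v \<noteq> [] \<and>
    (\<forall>z \<in> set p. E (last T) z \<longleftrightarrow> z = last u \<or> z = hd v)"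
proof -
  define x where "x = last T"
  have T0: "T \<noteq> []" "hd T \<noteq> x" "x \<in> set T" "hd T \<in> set T"
    using T chordless_ends_neq[of T] by (cases T; auto simp: x_def)+
  have xr: "\<not> E x z" if "z \<in> set r" for z using Tr T0 that by auto
  have "\<exists>y \<in> set p. E x y" using y0 x_def by auto
  from split_list_first_propE[OF this] obtain u y w
    where uyw: "p = u @ y # w" and y: "E x y" and u: "\<forall>z \<in> set u. \<not> E x z" by metis
  have dp: "distinct p" using p chordless_distinct by auto
  show ?thesis
  proof (cases "\<exists>z \<in> set w. E x z")
    \<comment> \<open>Only one neighbour \<open>y\<close>: a pyramid with apex \<open>y\<close> and
      the legs \<open>u @ [y]\<close>, \<open>T\<close> and \<open>r @ rev w\<close>.\<close>
    case False
    have u0: "u \<noteq> []" using y0 u False uyw x_def by (cases u) auto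
    have puy: "p = (u @ [y]) @ w" using uyw by simp
    have c1: "chordless E (u @ [y])"
      using p chordless_append[of "u @ [y]" w E] uyw by (cases "w = []") auto
    have c2: "chordless E (r @ rev w)"
    proof (cases "w = []")
      case w: False
      then have "chordless E w" using p chordless_append[of "u @ [y]" w E] uyw by auto
      moreover have "E a b \<longleftrightarrow> a = last r \<and> b = last w" "a \<noteq> b" if "a \<in> set r" "b \<in> set w" for a b
        using ladder_appendD2[of "u @ [y]" w r b a] pr dp w that E_commute unfolding puy ladder_def
        by auto
      ultimately show ?thesis using r w by (subst chordless_append) (auto simp: hd_rev)
    qed (use r in simp)
    have l1: "ladder E (u @ [y]) T"
    proof -
      have "a \<noteq> b \<and> (E a b \<longleftrightarrow> a = hd u \<and> b = hd T \<or> a = y \<and> b = x)"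
        if "a \<in> set (u @ [y])" "b \<in> set T" for a b
      proof (cases "b = x")
        case True
        then show ?thesis using that Tp(1)[of b a] T0 u y uyw E_commute[of a b] by auto
      next
        case False
        then show ?thesis using that Tp[of b a] T0 u0 uyw E_commute[of a b] by (auto simp: x_def)
      qed
      then show ?thesis using u0 x_def unfolding ladder_def by auto
    qed
    have l2: "ladder E (u @ [y]) (r @ rev w)"
    proof (cases "w = []")
      case True
      then show ?thesis using pr puy by simp
    next
      case w: False
      have F1: "a \<noteq> b \<and> (E a b \<longleftrightarrow> a = hd u \<and> b = hd r)" if "a \<in> set (u @ [y])" "b \<in> set r" for a b
        using ladder_appendD[of "u @ [y]" w r a b] pr dp w that u0 unfolding puy ladder_def by auto
      have F2: "a \<noteq> b \<and> (E a b \<longleftrightarrow> a = y \<and> b = hd w)" if "a \<in> set (u @ [y])" "b \<in> set w" for a b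
        using p chordless_append[of "u @ [y]" w E] that w unfolding puy by auto
      have F3: "r1 \<noteq> w1" if "r1 \<in> set r" "w1 \<in> set w" for r1 w1
        using pr that unfolding puy ladder_def by auto
      have "hd u \<noteq> y" using dp hd_in_set[OF u0] unfolding puy by auto
      have "a \<noteq> b \<and> (E a b \<longleftrightarrow> a = hd u \<and> b = hd r \<or> a = y \<and> b = hd w)"
        if "a \<in> set (u @ [y])" "b \<in> set (r @ rev w)" for a b
      proof (cases "b \<in> set r")
        case True
        then show ?thesis using F1[OF that(1) True] F3[of b "hd w"] w by auto
      next
        case False
        then have "b \<in> set w" using that by auto
        then show ?thesis using F2[of a b] that F3[of "hd r" b] r by auto
      qed
      then show ?thesis using u0 w r unfolding ladder_def by (simp add: last_rev)
    qed
    have l3: "a \<noteq> b \<and> (E a b \<longleftrightarrow> a = hd T \<and> b = hd (r @ rev w))"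
      if "a \<in> set T" "b \<in> set (r @ rev w)" for a b
    proof (cases "b \<in> set r")
      case True
      then show ?thesis using Tr that r by auto
    next
      case n: False
      then have b: "b \<in> set w" using that by auto
      then have "b \<noteq> hd p" "b \<in> set p" using dp uyw by (cases u; auto)+
      moreover have "b \<noteq> hd r" using n r by auto
      ultimately show ?thesis using Tp[of a b] that False b T0 r x_def by auto
    qed
    have "3 \<le> length T + length (r @ rev w)" "4 \<le> length (u @ [y]) + length (r @ rev w)"
      "2 \<le> length (u @ [y])" "4 \<le> length (u @ [y]) + length T"
      using T(2) r(3) p(2) uyw u0 by (cases u; simp)+
    then have False
      using no_pyramid[OF c1 T(1) c2 _ T0(1) _ l1 l2 l3] r(2) by simp
    then show ?thesis ..
  next
    case True
    from split_list_last_propE[OF this] obtain w1 y' w2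
      where w: "w = w1 @ y' # w2" and y': "E x y'" and w2: "\<forall>z \<in> set w2. \<not> E x z" by metis
    show ?thesis
    proof (cases "w1 = []")
      case True
      show ?thesis
        by (rule exI[of _ "u @ [y]"], rule exI[of _ "y' # w2"])
          (use True w uyw u w2 y y' x_def in auto)
    next
      \<comment> \<open>The extreme neighbours \<open>y\<close> and \<open>y'\<close> are not
        consecutive: a pyramid with apex \<open>x\<close> and the legs \<open>T\<close>,
        \<open>u @ [y]\<close> and \<open>r @ rev (y' # w2)\<close>.\<close>
      case False
      have c1: "chordless E (u @ [y])"
        using p chordless_append[of "u @ [y]" w E] uyw w by auto
      have puy: "p = (u @ y # w1) @ (y' # w2)" using uyw w by simp
      have c3: "chordless E (y' # w2)"
        using p chordless_append[of "u @ y # w1" "y' # w2" E] unfolding puy by auto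
      have B: "E a b \<longleftrightarrow> a = last r \<and> b = last (y' # w2)" "a \<noteq> b"
        if "a \<in> set r" "b \<in> set (y' # w2)" for a b
      proof -
        have "E b a \<longleftrightarrow> b = last (y' # w2) \<and> a = last r"
          by (rule ladder_appendD2[OF pr[unfolded puy] dp[unfolded puy]]) (use that in auto)
        then show "E a b \<longleftrightarrow> a = last r \<and> b = last (y' # w2)" using E_commute[of a b] by blast
        have "b \<in> set p" using that(2) unfolding puy by auto
        then show "a \<noteq> b" using pr that(1) unfolding ladder_def by blast
      qed
      have c2: "chordless E (r @ rev (y' # w2))"
        using r c3 B by (subst chordless_append) (auto simp: hd_rev simp del: rev.simps(2))
      have l1: "ladder E T (u @ [y])"
      proof -
        have "a \<noteq> b \<and> (E a b \<longleftrightarrow> b = hd p \<and> a = hd T \<or> b = y \<and> a = x)"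
          if "b \<in> set (u @ [y])" "a \<in> set T" for a b
        proof (cases "a = x")
          case True
          then show ?thesis using that Tp(1)[of a b] T0 u y uyw by auto
        next
          case False
          then show ?thesis using that Tp[of a b] T0 uyw by (auto simp: x_def)
        qed
        moreover have "hd p = hd (u @ [y])" using uyw by (cases u) auto
        ultimately show ?thesis using x_def unfolding ladder_def by auto
      qed
      have hp: "hd p \<notin> set (y' # w2)" using dp uyw w by (cases u) auto
      have D: "a \<noteq> b \<and> (E a b \<longleftrightarrow> a = x \<and> b = y')" if "a \<in> set T" "b \<in> set (y' # w2)" for a b
      proof -
        have "b \<in> set p" "b \<noteq> hd p" using that hp uyw w by auto
        then show ?thesis using that Tp[of a b] w2 y' T0 by (cases "a = x") (auto simp: x_def)
      qed
      have l2: "ladder E T (r @ rev (y' # w2))"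
      proof -
        have "hd r \<notin> set (y' # w2)" using B(2)[OF hd_in_set[OF r(2)]] by blast
        moreover have "y' \<notin> set r" using B(2) by auto
        ultimately show ?thesis using Tr D T0 r unfolding ladder_def x_def[symmetric] by auto
      qed
      have l3: "a \<noteq> b \<and> (E a b \<longleftrightarrow> a = hd (u @ [y]) \<and> b = hd (r @ rev (y' # w2)))"
        if ab: "a \<in> set (u @ [y])" "b \<in> set (r @ rev (y' # w2))" for a b
      proof -
        have hu: "hd (u @ y # w1) = hd (u @ [y])" by (cases u) auto
        have a: "a \<in> set (u @ y # w1)" "a \<noteq> last (u @ y # w1)" using ab False dp uyw w by auto
        show ?thesis
        proof (cases "b \<in> set r")
          case True
          have "E a b \<longleftrightarrow> a = hd (u @ y # w1) \<and> b = hd r"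
            by (rule ladder_appendD[OF pr[unfolded puy] dp[unfolded puy]]) (use a True in auto)
          moreover have "a \<in> set p" using a(1) unfolding puy by auto
          then have "a \<noteq> b" using pr True unfolding ladder_def by blast
          ultimately show ?thesis using hu r(2) by simp
        next
          case n: False
          then have b: "b \<in> set (y' # w2)" using ab by auto
          then have "a \<noteq> b \<and> \<not> E a b"
            using p chordless_append[of "u @ y # w1" "y' # w2" E] a unfolding puy by auto
          then show ?thesis using n r by auto
        qed
      qed
      have "4 \<le> length T + length (u @ [y])"
        using len T y uyw by (cases u) (auto simp: x_def)
      then have False
        using no_pyramid[OF T(1) c1 c2 T(2) _ _ l1 l2 l3] r T by simp
      then show ?thesis ..
    qed
  qed
qed

lemma ladder_disjoint: "ladder E p q \<Longrightarrow> x \<in> set p \<Longrightarrow> y \<in> set q \<Longrightarrow> x \<noteq> y"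
  unfolding ladder_def by blast

text \<open>Following \<open>p\<close> from \<open>hd p\<close> to the first neighbour of
  \<open>hd Q\<close> and then \<open>Q\<close> gives a path \<open>T\<close> that replaces
  \<open>p\<close> as far as \<open>last Q\<close>; it misses \<open>last p\<close> because
  \<open>z0\<close> comes earlier. If \<open>last Q\<close> had neighbours on both \<open>q\<close>
  and \<open>r\<close>, it would be the apex of a pyramid with leg \<open>T\<close>. Otherwise
  \<open>two_neighbours\<close> applies to the path that it sees.\<close>

lemma rung_far_end:
  assumes P: "prism E p q r" and Q: "chordless E Q" "Q \<noteq> []"
    and dis: "\<And>x z. x \<in> set Q \<Longrightarrow> z \<in> set p \<union> set q \<union> set r \<Longrightarrow> x \<noteq> z"
    and Qp: "\<And>x z. x \<in> set Q \<Longrightarrow> z \<in> set p \<Longrightarrow> E x z \<Longrightarrow> x = hd Q"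
    and near: "z0 \<in> set p" "z0 \<noteq> last p" "E (hd Q) z0"
    and Qqr: "\<And>x z. x \<in> set Q \<Longrightarrow> z \<in> set q \<union> set r \<Longrightarrow> E x z \<Longrightarrow> x = last Q"
    and far: "\<exists>z \<in> set q \<union> set r. E (last Q) z"
    and corners: "\<And>z. z \<in> {hd q, hd r, last q, last r} \<Longrightarrow> \<not> E (last Q) z"
  shows "(\<exists>u v. u \<noteq> [] \<and> v \<noteq> [] \<and>
    (q = u @ v \<and> (\<forall>z \<in> set q. E (last Q) z \<longleftrightarrow> z = last u \<or> z = hd v) \<and> (\<forall>z \<in> set r. \<not> E (last Q) z)
    \<or> r = u @ v \<and> (\<forall>z \<in> set r. E (last Q) z \<longleftrightarrow> z = last u \<or> z = hd v) \<and> (\<forall>z \<in> set q. \<not> E (last Q) z)))"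
proof -
  define x where "x = last Q"
  have P': "chordless E p" "chordless E q" "chordless E r" "2 \<le> length p" "2 \<le> length q" "2 \<le> length r"
    "ladder E p q" "ladder E p r" "ladder E q r"
    using P unfolding prism_def by auto
  have ne: "p \<noteq> []" "q \<noteq> []" "r \<noteq> []" using P' by auto
  have dp: "distinct p" "distinct q" "distinct r" using P' chordless_distinct by auto
  have "\<exists>y \<in> set p. E (hd Q) y" using near by auto
  from split_list_first_propE[OF this] obtain s y w
    where p: "p = s @ y # w" and y: "E (hd Q) y" and s: "\<forall>z \<in> set s. \<not> E (hd Q) z" by metis
  have w: "w \<noteq> []" using near s y p by auto
  have p': "p = (s @ [y]) @ w" using p by simp
  define T where "T = (s @ [y]) @ Q"
  have "chordless E (s @ [y])" using P'(1) w chordless_append[of "s @ [y]" w E] unfolding p' by blast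
  moreover have "a \<noteq> b \<and> (E a b \<longleftrightarrow> a = last (s @ [y]) \<and> b = hd Q)"
    if "a \<in> set (s @ [y])" "b \<in> set Q" for a b
  proof -
    have "a \<in> set p" using that p by auto
    then show ?thesis using Qp[of b a] dis[of b a] that s y E_commute[of a b] by auto
  qed
  ultimately have T: "chordless E T" unfolding T_def using Q by (subst chordless_append) auto
  have T2: "2 \<le> length T" "T \<noteq> []" "hd T = hd (s @ [y])" "last T = x"
    using Q by (cases Q; auto simp: T_def x_def hd_append)+
  have xT: "x \<in> set T" "x \<in> set Q" using Q by (auto simp: T_def x_def)
  have hT: "hd T \<in> set (s @ [y])" "hd T \<noteq> x"
    using T2 chordless_ends_neq[OF T] by (auto simp: hd_append)
  have TT: "a \<noteq> b \<and> (a \<noteq> x \<longrightarrow> (E a b \<longleftrightarrow> a = hd T \<and> b = hd k))"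
    if "a \<in> set T" "b \<in> set k" and k: "k = q \<or> k = r" for a b k
  proof (cases "a \<in> set Q")
    case True
    then have "a \<noteq> hd T" using dis[of a "hd T"] hT p by auto
    then show ?thesis using True dis[of a b] Qqr[of a b] that x_def by auto
  next
    case False
    then have a: "a \<in> set (s @ [y])" using that unfolding T_def by auto
    have l: "ladder E p k" using P' k by auto
    then have "E a b \<longleftrightarrow> a = hd (s @ [y]) \<and> b = hd k"
      by (intro ladder_appendD[OF _ _ _ w]) (use p' a that dp in auto)
    moreover have "a \<noteq> b" using ladder_disjoint[OF l, of a b] a that p by auto
    ultimately show ?thesis using T2 by auto
  qed
  have both: False if "\<exists>z \<in> set q. E x z" "\<exists>z \<in> set r. E x z"
  proof -
    from split_list_first_propE[OF that(1)] obtain u1 y1 w1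
      where q: "q = u1 @ y1 # w1" and y1: "E x y1" and u1: "\<forall>z \<in> set u1. \<not> E x z" by metis
    from split_list_first_propE[OF that(2)] obtain u2 y2 w2
      where r: "r = u2 @ y2 # w2" and y2: "E x y2" and u2: "\<forall>z \<in> set u2. \<not> E x z" by metis
    have "y1 \<noteq> hd q" "y1 \<noteq> last q" "y2 \<noteq> hd r" "y2 \<noteq> last r"
      using corners y1 y2 unfolding x_def by blast+
    then have w12: "w1 \<noteq> []" "w2 \<noteq> []" and u12: "u1 \<noteq> []" "u2 \<noteq> []"
      unfolding q r by auto
    have q': "q = (u1 @ [y1]) @ w1" and r': "r = (u2 @ [y2]) @ w2" using q r by auto
    have c: "chordless E (u1 @ [y1])" "chordless E (u2 @ [y2])"
      using P'(2,3) w12 chordless_append[of "u1 @ [y1]" w1 E] chordless_append[of "u2 @ [y2]" w2 E]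
      unfolding q' r' by blast+
    have L: "ladder E T (k1 @ [y])" if k: "k = q \<or> k = r" "k = (k1 @ [y]) @ k2" "k1 \<noteq> []"
        "E x y" "\<forall>z \<in> set k1. \<not> E x z" for k k1 y k2
    proof -
      have "a \<noteq> b \<and> (E a b \<longleftrightarrow> a = hd T \<and> b = hd k \<or> a = x \<and> b = y)"
        if "a \<in> set T" "b \<in> set (k1 @ [y])" for a b
      proof (cases "a = x")
        case True
        then show ?thesis using TT[of a b k] k that hT by auto
      next
        case False
        then show ?thesis using TT[of a b k] k that by auto
      qed
      moreover have "hd k = hd (k1 @ [y])" using k by auto
      ultimately show ?thesis unfolding ladder_def T2(4) by auto
    qed
    have "a \<noteq> b \<and> (E a b \<longleftrightarrow> a = hd (u1 @ [y1]) \<and> b = hd (u2 @ [y2]))"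
      if "a \<in> set (u1 @ [y1])" "b \<in> set (u2 @ [y2])" for a b
    proof -
      have ab: "a \<in> set q" "b \<in> set r" using that q r by auto
      have "E a b \<longleftrightarrow> a = hd (u1 @ [y1]) \<and> b = hd r"
        by (intro ladder_appendD[OF _ _ _ w12(1)]) (use q' P' dp ab that in auto)
      moreover have "hd r = hd (u2 @ [y2])" using r u12 by auto
      ultimately show ?thesis using ladder_disjoint[OF P'(9) ab] by auto
    qed
    moreover have "2 \<le> length (u1 @ [y1])" "2 \<le> length (u2 @ [y2])"
      using u12 by (cases u1; cases u2; simp)+
    ultimately show False
      using no_pyramid[OF T c T2(1) _ _ L[OF _ q' u12(1) y1 u1] L[OF _ r' u12(2) y2 u2]] T2(1) by simp
  qed
  have one: "\<exists>u v. k = u @ v \<and> u \<noteq> [] \<and> v \<noteq> [] \<and> (\<forall>z \<in> set k. E x z \<longleftrightarrow> z = last u \<or> z = hd v)"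
    if k: "k = q \<and> k' = r \<or> k = r \<and> k' = q" "\<forall>z \<in> set k'. \<not> E x z" for k k'
  proof -
    obtain z where z: "z \<in> set k" "E x z" using far k x_def by auto
    have nc: "\<not> E x (hd k)" using corners[of "hd k"] k x_def by auto
    have "ladder E k k'" using k P' ladder_sym by auto
    moreover have "a \<noteq> b \<and> (E a b \<longleftrightarrow> a = hd T \<and> b = hd k')" if "a \<in> set T" "b \<in> set k'" for a b
      using TT[of a b k'] k that hT by auto
    moreover have "a \<noteq> b" if "a \<in> set T" "b \<in> set k" for a b
      using TT[of a b k] k that by auto
    moreover have "E a b \<longleftrightarrow> a = hd T \<and> b = hd k" if "a \<in> set T" "b \<in> set k" "a \<noteq> x" for a b
      using TT[of a b k] k that by auto
    ultimately show ?thesis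
      using two_neighbours[of k k' T z, unfolded T2(4)] P' T T2(1) z nc k ne by blast
  qed
  show ?thesis
  proof (cases "\<exists>z \<in> set q. E x z")
    case True
    then have r0: "\<forall>z \<in> set r. \<not> E x z" using both by auto
    then show ?thesis using one[of q r] unfolding x_def[symmetric] by blast
  next
    case False
    then show ?thesis using one[of r q] unfolding x_def[symmetric] by blast
  qed
qed

text \<open>The argument from the other side: \<open>T = u @ rev Q\<close> starts at the corner
  \<open>hd q\<close> and runs backwards through \<open>Q\<close> to \<open>hd Q\<close>. As
  \<open>last Q\<close> does not see \<open>hd q\<close>, the piece \<open>u\<close> has at least
  two vertices, so \<open>T\<close> has the three vertices that \<open>two_neighbours\<close> asks
  for in case \<open>hd Q\<close> sees \<open>hd p\<close>.\<close>

lemma rung_near_end: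
  assumes P: "prism E p q r" and Q: "chordless E Q" "Q \<noteq> []"
    and dis: "\<And>x z. x \<in> set Q \<Longrightarrow> z \<in> set p \<union> set q \<union> set r \<Longrightarrow> x \<noteq> z"
    and Qp: "\<And>x z. x \<in> set Q \<Longrightarrow> z \<in> set p \<Longrightarrow> E x z \<Longrightarrow> x = hd Q"
    and near: "z0 \<in> set p" "z0 \<noteq> hd p" "E (hd Q) z0"
    and Qqr: "\<And>x z. x \<in> set Q \<Longrightarrow> z \<in> set q \<union> set r \<Longrightarrow> E x z \<Longrightarrow> x = last Q"
    and corner: "\<not> E (last Q) (hd q)"
    and uv: "q = u @ v" "u \<noteq> []" "v \<noteq> []" "\<And>z. z \<in> set q \<Longrightarrow> E (last Q) z \<longleftrightarrow> z = last u \<or> z = hd v"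
    and r0: "\<And>z. z \<in> set r \<Longrightarrow> \<not> E (last Q) z"
  shows "\<exists>s t. p = s @ t \<and> s \<noteq> [] \<and> t \<noteq> [] \<and> (\<forall>z \<in> set p. E (hd Q) z \<longleftrightarrow> z = last s \<or> z = hd t)"
proof -
  have P': "chordless E p" "chordless E q" "chordless E r" "2 \<le> length p" "2 \<le> length q" "2 \<le> length r"
    "ladder E p q" "ladder E p r" "ladder E q r"
    using P unfolding prism_def by auto
  have ne: "p \<noteq> []" "q \<noteq> []" "r \<noteq> []" using P' by auto
  have dp: "distinct p" "distinct q" "distinct r" using P' chordless_distinct by auto
  define T where "T = u @ rev Q"
  have cu: "chordless E u" using P'(2) uv chordless_append[of u v E] by auto
  have "a \<noteq> b \<and> (E a b \<longleftrightarrow> a = last u \<and> b = last Q)" if "a \<in> set u" "b \<in> set Q" for a b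
  proof -
    have a: "a \<in> set q" "a \<noteq> hd v" using that uv dp hd_in_set[of v] by auto
    show ?thesis
    proof (cases "b = last Q")
      case True
      then show ?thesis using uv(4)[of a] a dis[of b a] E_commute[of a b] that by auto
    next
      case False
      then show ?thesis using Qqr[of b a] a dis[of b a] E_commute[of a b] that by auto
    qed
  qed
  then have T: "chordless E T" unfolding T_def using Q uv cu by (subst chordless_append) (auto simp: hd_rev)
  have "hd u \<noteq> last u" using corner uv by auto
  then have "2 \<le> length u" using uv(2) by (cases u; cases "tl u") auto
  moreover have "0 < length Q" using Q(2) by simp
  ultimately have T2: "3 \<le> length T" "T \<noteq> []" "hd T = hd u" "last T = hd Q"
    using Q(2) uv(2) unfolding T_def length_append length_rev by (linarith, simp_all add: last_rev)
  have hT: "hd T \<in> set u" "hd T \<noteq> hd Q"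
    using T2 chordless_ends_neq[OF T] uv by auto
  have Tr: "a \<noteq> b \<and> (E a b \<longleftrightarrow> a = hd T \<and> b = hd r)" if "a \<in> set T" "b \<in> set r" for a b
  proof (cases "a \<in> set Q")
    case True
    then have "a \<noteq> hd T" using dis[of a "hd T"] hT uv by auto
    then show ?thesis using True dis[of a b] Qqr[of a b] r0[of b] that by auto
  next
    case False
    then have a: "a \<in> set u" using that unfolding T_def by auto
    then have "E a b \<longleftrightarrow> a = hd u \<and> b = hd r"
      by (intro ladder_appendD[OF _ _ _ uv(3)]) (use uv P' dp that in auto)
    moreover have "a \<noteq> b" using ladder_disjoint[OF P'(9), of a b] a that uv by auto
    ultimately show ?thesis using T2 by auto
  qed
  have Tp: "a \<noteq> b \<and> (a \<noteq> hd Q \<longrightarrow> (E a b \<longleftrightarrow> a = hd T \<and> b = hd p))" if "a \<in> set T" "b \<in> set p" for a b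
  proof (cases "a \<in> set Q")
    case True
    then have "a \<noteq> hd T" using dis[of a "hd T"] hT uv by auto
    then show ?thesis using True dis[of a b] Qp[of a b] that by auto
  next
    case False
    then have a: "a \<in> set u" using that unfolding T_def by auto
    have l: "ladder E q p" using P' ladder_sym by auto
    then have "E a b \<longleftrightarrow> a = hd u \<and> b = hd p"
      by (intro ladder_appendD[OF _ _ _ uv(3)]) (use uv a dp that in auto)
    moreover have "a \<noteq> b" using ladder_disjoint[OF l, of a b] a that uv by auto
    ultimately show ?thesis using T2 by auto
  qed
  show ?thesis
    by (rule two_neighbours[where T = T, unfolded T2(4),
          OF P'(1) P'(4) P'(3) ne(3) P'(6) P'(8) T _ Tr _ _ near]) (use T2(1) Tp in auto)
qed

text \<open>The prism and \<open>Q\<close> form the line graph of a subdivision of \<open>K\<^sub>4\<close>, whose branch vertices are the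
  two triangles of the prism, \<open>{hd Q, last s, hd t}\<close> and \<open>{last Q, last u, hd v}\<close>.\<close>

definition rung_of :: "'a list \<Rightarrow> 'a list \<Rightarrow> 'a list \<Rightarrow> 'a list \<Rightarrow>
    'a list \<Rightarrow> 'a list \<Rightarrow> 'a list \<Rightarrow> 'a list \<Rightarrow> bool" where
  "rung_of p q r Q s t u v \<longleftrightarrow>
     chordless E Q \<and> Q \<noteq> [] \<and> p = s @ t \<and> q = u @ v \<and> s \<noteq> [] \<and> t \<noteq> [] \<and> u \<noteq> [] \<and> v \<noteq> [] \<and>
     (\<forall>x \<in> set Q. \<forall>z \<in> set p. x \<noteq> z \<and> (E x z \<longleftrightarrow> x = hd Q \<and> (z = last s \<or> z = hd t))) \<and>
     (\<forall>x \<in> set Q. \<forall>z \<in> set q. x \<noteq> z \<and> (E x z \<longleftrightarrow> x = last Q \<and> (z = last u \<or> z = hd v))) \<and>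
     (\<forall>x \<in> set Q. \<forall>z \<in> set r. x \<noteq> z \<and> \<not> E x z)"

text \<open>\<open>rung_far_end\<close> wants a neighbour of \<open>hd Q\<close> other than
  \<open>last p\<close>, and \<open>rung_near_end\<close> one other than \<open>hd p\<close>. If the
  known neighbour is the wrong corner, the prism is reversed while \<open>Q\<close> keeps its
  direction. The pieces \<open>u\<close> and \<open>v\<close> have two vertices each because
  \<open>last Q\<close> sees no corner.\<close>

lemma rung_of_exists:
  assumes P: "prism E p q r" and Q: "chordless E Q" "Q \<noteq> []"
    and dis: "\<And>x z. x \<in> set Q \<Longrightarrow> z \<in> set p \<union> set q \<union> set r \<Longrightarrow> x \<noteq> z"
    and Qp: "\<And>x z. x \<in> set Q \<Longrightarrow> z \<in> set p \<Longrightarrow> E x z \<Longrightarrow> x = hd Q"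
    and near: "\<exists>z \<in> set p. E (hd Q) z"
    and Qqr: "\<And>x z. x \<in> set Q \<Longrightarrow> z \<in> set q \<union> set r \<Longrightarrow> E x z \<Longrightarrow> x = last Q"
    and far: "\<exists>z \<in> set q \<union> set r. E (last Q) z"
    and corners: "\<And>z. z \<in> {hd q, hd r, last q, last r} \<Longrightarrow> \<not> E (last Q) z"
  obtains k k' s t u v where "rung_of p k k' Q s t u v"
    "k = q \<and> k' = r \<or> k = r \<and> k' = q" "2 \<le> length u" "2 \<le> length v"
proof -
  have ne: "p \<noteq> []" "q \<noteq> []" "r \<noteq> []" and hl: "hd p \<noteq> last p"
    using P chordless_ends_neq unfolding prism_def by auto
  have hr: "hd (rev k) = last k" "last (rev k) = hd k" if "k \<noteq> []" for k :: "'a list"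
    using that by (auto simp: hd_rev last_rev)
  obtain z0 where z0: "z0 \<in> set p" "E (hd Q) z0" using near by auto
  have "\<exists>u v. u \<noteq> [] \<and> v \<noteq> [] \<and>
    (q = u @ v \<and> (\<forall>z \<in> set q. E (last Q) z \<longleftrightarrow> z = last u \<or> z = hd v) \<and> (\<forall>z \<in> set r. \<not> E (last Q) z)
    \<or> r = u @ v \<and> (\<forall>z \<in> set r. E (last Q) z \<longleftrightarrow> z = last u \<or> z = hd v) \<and> (\<forall>z \<in> set q. \<not> E (last Q) z))"
    (is "\<exists>u v. ?F u v")
  proof (cases "z0 = last p")
    case False
    show ?thesis
      by (rule rung_far_end[OF P Q dis Qp z0(1) False z0(2) Qqr far corners])
  next
    case True
    then have n: "z0 \<noteq> last (rev p)" using hl ne hr by auto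
    have "\<exists>u v. u \<noteq> [] \<and> v \<noteq> [] \<and>
      (rev q = u @ v \<and> (\<forall>z \<in> set (rev q). E (last Q) z \<longleftrightarrow> z = last u \<or> z = hd v) \<and> (\<forall>z \<in> set (rev r). \<not> E (last Q) z)
      \<or> rev r = u @ v \<and> (\<forall>z \<in> set (rev r). E (last Q) z \<longleftrightarrow> z = last u \<or> z = hd v) \<and> (\<forall>z \<in> set (rev q). \<not> E (last Q) z))"
      by (rule rung_far_end[OF prism_rev[OF P] Q _ _ _ n z0(2)])
        (use dis Qp z0 Qqr far corners ne hr in auto)
    then obtain u v where uv: "u \<noteq> []" "v \<noteq> []"
      "rev q = u @ v \<and> (\<forall>z \<in> set q. E (last Q) z \<longleftrightarrow> z = last u \<or> z = hd v) \<and> (\<forall>z \<in> set r. \<not> E (last Q) z)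
      \<or> rev r = u @ v \<and> (\<forall>z \<in> set r. E (last Q) z \<longleftrightarrow> z = last u \<or> z = hd v) \<and> (\<forall>z \<in> set q. \<not> E (last Q) z)"
      by auto
    have "k = rev v @ rev u" if "rev k = u @ v" for k using that by (metis rev_append rev_rev_ident)
    then have "?F (rev v) (rev u)" using uv by (auto simp: hr)
    then show ?thesis by blast
  qed
  then obtain u v where uv: "?F u v" by blast
  obtain k k' where k: "k = q \<and> k' = r \<or> k = r \<and> k' = q" and k2: "k = u @ v"
    "\<And>z. z \<in> set k \<Longrightarrow> E (last Q) z \<longleftrightarrow> z = last u \<or> z = hd v" "\<And>z. z \<in> set k' \<Longrightarrow> \<not> E (last Q) z"
  proof (cases "q = u @ v \<and> (\<forall>z \<in> set q. E (last Q) z \<longleftrightarrow> z = last u \<or> z = hd v) \<and>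
      (\<forall>z \<in> set r. \<not> E (last Q) z)")
    case True
    show ?thesis by (rule that[of q r]) (use True in simp_all)
  next
    case False
    with uv have F: "r = u @ v \<and> (\<forall>z \<in> set r. E (last Q) z \<longleftrightarrow> z = last u \<or> z = hd v) \<and>
      (\<forall>z \<in> set q. \<not> E (last Q) z)" by argo
    show ?thesis by (rule that[of r q]) (use F in simp_all)
  qed
  have Pk: "prism E p k k'" using k P prism_perm(2)[OF P] by auto
  have dk: "\<And>x z. x \<in> set Q \<Longrightarrow> z \<in> set p \<union> set k \<union> set k' \<Longrightarrow> x \<noteq> z"
    and Qk: "\<And>x z. x \<in> set Q \<Longrightarrow> z \<in> set k \<union> set k' \<Longrightarrow> E x z \<Longrightarrow> x = last Q"
    and ck: "\<not> E (last Q) (hd k)" "\<not> E (last Q) (last k)" "k \<noteq> []"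
  proof -
    have kk: "set q \<union> set r = set k \<union> set k'" using k by auto
    have un: "set p \<union> set k \<union> set k' = set p \<union> set q \<union> set r" using kk by blast
    have hl: "hd k \<in> {hd q, hd r, last q, last r}" "last k \<in> {hd q, hd r, last q, last r}"
      using k by auto
    show "\<And>x z. x \<in> set Q \<Longrightarrow> z \<in> set p \<union> set k \<union> set k' \<Longrightarrow> x \<noteq> z" using dis unfolding un .
    show "\<And>x z. x \<in> set Q \<Longrightarrow> z \<in> set k \<union> set k' \<Longrightarrow> E x z \<Longrightarrow> x = last Q" using Qqr unfolding kk .
    show "\<not> E (last Q) (hd k)" "\<not> E (last Q) (last k)" using corners hl by blast+
    show "k \<noteq> []" using k ne by auto
  qed
  have "\<exists>s t. p = s @ t \<and> s \<noteq> [] \<and> t \<noteq> [] \<and> (\<forall>z \<in> set p. E (hd Q) z \<longleftrightarrow> z = last s \<or> z = hd t)"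
  proof (cases "z0 = hd p")
    case False
    show ?thesis
      by (rule rung_near_end[OF Pk Q dk Qp z0(1) False z0(2) Qk ck(1) k2(1) _ _ k2(2,3)]) (use uv in auto)
  next
    case True
    then have n: "z0 \<noteq> hd (rev p)" using hl ne hr by auto
    have rk: "rev k = rev v @ rev u" using k2 by simp
    have "\<exists>s t. rev p = s @ t \<and> s \<noteq> [] \<and> t \<noteq> [] \<and> (\<forall>z \<in> set (rev p). E (hd Q) z \<longleftrightarrow> z = last s \<or> z = hd t)"
    proof (rule rung_near_end[OF prism_rev[OF Pk] Q _ _ _ n z0(2) _ _ rk])
      show "\<And>x z. x \<in> set Q \<Longrightarrow> z \<in> set (rev p) \<union> set (rev k) \<union> set (rev k') \<Longrightarrow> x \<noteq> z"
        using dk unfolding set_rev .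
      show "\<And>x z. x \<in> set Q \<Longrightarrow> z \<in> set (rev p) \<Longrightarrow> E x z \<Longrightarrow> x = hd Q"
        using Qp unfolding set_rev .
      show "\<And>x z. x \<in> set Q \<Longrightarrow> z \<in> set (rev k) \<union> set (rev k') \<Longrightarrow> E x z \<Longrightarrow> x = last Q"
        using Qk unfolding set_rev .
      show "z0 \<in> set (rev p)" using z0 by simp
      show "\<not> E (last Q) (hd (rev k))" using ck hr by simp
      show "rev v \<noteq> []" "rev u \<noteq> []" using uv by auto
      show "\<And>z. z \<in> set (rev k) \<Longrightarrow> E (last Q) z \<longleftrightarrow> z = last (rev v) \<or> z = hd (rev u)"
        using k2(2) uv hr by (simp add: disj_commute)
      show "\<And>z. z \<in> set (rev k') \<Longrightarrow> \<not> E (last Q) z" using k2(3) unfolding set_rev .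
    qed
    then obtain s t where st: "rev p = s @ t" "s \<noteq> []" "t \<noteq> []"
      "\<forall>z \<in> set p. E (hd Q) z \<longleftrightarrow> z = last s \<or> z = hd t" by auto
    have "p = rev t @ rev s" using st(1) by (metis rev_append rev_rev_ident)
    then show ?thesis using st hr by (intro exI[of _ "rev t"] exI[of _ "rev s"]) auto
  qed
  then obtain s t where st: "p = s @ t" "s \<noteq> []" "t \<noteq> []"
    "\<And>z. z \<in> set p \<Longrightarrow> E (hd Q) z \<longleftrightarrow> z = last s \<or> z = hd t" by blast
  have R: "rung_of p k k' Q s t u v"
    unfolding rung_of_def
  proof (intro conjI ballI)
    fix w z assume w: "w \<in> set Q"
    show "w \<noteq> z" if "z \<in> set p" using dk[of w z] w that by simp
    show "w \<noteq> z" if "z \<in> set k" using dk[of w z] w that by simp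
    show "w \<noteq> z" if "z \<in> set k'" using dk[of w z] w that by simp
    show "E w z \<longleftrightarrow> w = hd Q \<and> (z = last s \<or> z = hd t)" if "z \<in> set p"
      using Qp[OF w that] st(4)[OF that] by blast
    show "E w z \<longleftrightarrow> w = last Q \<and> (z = last u \<or> z = hd v)" if "z \<in> set k"
      using Qk[OF w, of z] k2(2)[OF that] that by blast
    show "\<not> E w z" if "z \<in> set k'"
      using Qk[OF w, of z] k2(3)[OF that] that by blast
  qed (use Q st k2 uv in auto)
  have "hd k = hd u" "last k = last v" "last u \<in> set k" "hd v \<in> set k" using k2(1) uv by auto
  then have "hd u \<noteq> last u" "hd v \<noteq> last v" using k2(2) ck by auto
  moreover have "2 \<le> length l" if "l \<noteq> []" "hd l \<noteq> last l" for l :: "'a list"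
    using that by (cases l; cases "tl l") auto
  ultimately have "2 \<le> length u" "2 \<le> length v" using uv by blast+
  then show ?thesis by (rule that[OF R k])
qed

section \<open>The other prisms in the line graph of a subdivided \<open>K4\<close>\<close>

lemma chordless_appendD:
  assumes "chordless E (s @ t)" "s \<noteq> []" "t \<noteq> []"
  shows "chordless E s" "chordless E t"
    "a \<in> set s \<Longrightarrow> b \<in> set t \<Longrightarrow> a \<noteq> b \<and> (E a b \<longleftrightarrow> a = last s \<and> b = hd t)"
  using assms chordless_append[of s t E] by blast+

lemma ladder_split:
  assumes l: "ladder E (s @ t) (u @ v)" and d: "distinct (s @ t)" "distinct (u @ v)"
    and ne: "s \<noteq> []" "t \<noteq> []" "u \<noteq> []" "v \<noteq> []"
  shows "a \<in> set s \<Longrightarrow> b \<in> set u \<Longrightarrow> a \<noteq> b \<and> (E a b \<longleftrightarrow> a = hd s \<and> b = hd u)"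
    and "a \<in> set s \<Longrightarrow> b \<in> set v \<Longrightarrow> a \<noteq> b \<and> \<not> E a b"
    and "a \<in> set t \<Longrightarrow> b \<in> set u \<Longrightarrow> a \<noteq> b \<and> \<not> E a b"
    and "a \<in> set t \<Longrightarrow> b \<in> set v \<Longrightarrow> a \<noteq> b \<and> (E a b \<longleftrightarrow> a = last t \<and> b = last v)"
proof -
  have h: "hd s \<in> set s" "hd u \<in> set u" "last t \<in> set t" "last v \<in> set v" using ne by auto
  have n: "hd s \<notin> set t" "hd u \<notin> set v" "last t \<notin> set s" "last v \<notin> set u"
    using h d unfolding distinct_append by blast+
  have *: "a \<noteq> b \<and> (E a b \<longleftrightarrow> a = hd s \<and> b = hd u \<or> a = last t \<and> b = last v)"
    if "a \<in> set s \<union> set t" "b \<in> set u \<union> set v" for a b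
    using l ne that unfolding ladder_def by simp
  show "a \<in> set s \<Longrightarrow> b \<in> set u \<Longrightarrow> a \<noteq> b \<and> (E a b \<longleftrightarrow> a = hd s \<and> b = hd u)"
    and "a \<in> set s \<Longrightarrow> b \<in> set v \<Longrightarrow> a \<noteq> b \<and> \<not> E a b"
    and "a \<in> set t \<Longrightarrow> b \<in> set u \<Longrightarrow> a \<noteq> b \<and> \<not> E a b"
    and "a \<in> set t \<Longrightarrow> b \<in> set v \<Longrightarrow> a \<noteq> b \<and> (E a b \<longleftrightarrow> a = last t \<and> b = last v)"
    using *[of a b] n by auto
qed

text \<open>Reversing the prism exchanges its triangles and leaves \<open>Q\<close> alone, while
  exchanging \<open>p\<close> and \<open>q\<close> in \<open>rung_of_swap\<close> reverses
  \<open>Q\<close>. These symmetries produce, from one prism between a triangle at an end of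
  \<open>Q\<close> and a triangle of the given prism, the other three of this kind.\<close>

lemma rung_of_rev:
  "rung_of p q r Q s t u v \<Longrightarrow> rung_of (rev p) (rev q) (rev r) Q (rev t) (rev s) (rev v) (rev u)"
  unfolding rung_of_def by (simp add: hd_rev last_rev disj_commute)

lemma rung_of_swap: "rung_of p q r Q s t u v \<Longrightarrow> rung_of q p r (rev Q) u v s t"
  unfolding rung_of_def by (simp add: hd_rev last_rev)

lemma ladderI:
  assumes "hd p = h" "hd q = h'" "last p = l" "last q = l'"
    "\<And>a b. a \<in> set p \<Longrightarrow> b \<in> set q \<Longrightarrow> a \<noteq> b \<and> (E a b \<longleftrightarrow> a = h \<and> b = h' \<or> a = l \<and> b = l')"
  shows "ladder E p q"
  using assms unfolding ladder_def by auto

lemma chordless_appendI: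
  assumes "chordless E p" "chordless E q" "p \<noteq> []" "q \<noteq> []" "last p = l" "hd q = h"
    "\<And>a b. a \<in> set p \<Longrightarrow> b \<in> set q \<Longrightarrow> a \<noteq> b \<and> (E a b \<longleftrightarrow> a = l \<and> b = h)"
  shows "chordless E (p @ q)"
  using assms by (subst chordless_append) auto

text \<open>The edges of \<open>K4\<close> are the six paths \<open>s\<close>, \<open>t\<close>,
  \<open>u\<close>, \<open>v\<close>, \<open>r\<close>, \<open>Q\<close>, and its vertices are the
  triangles \<open>hd s, hd u, hd r\<close> and \<open>last t, last v, last r\<close> and
  \<open>last s, hd t, hd Q\<close> and \<open>last u, hd v, last Q\<close>. Two paths that share a
  triangle are joined by one edge there; the opposite pairs \<open>s, v\<close> and
  \<open>t, u\<close> and \<open>Q, r\<close> are not joined.\<close>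

lemma rung_facts:
  assumes P: "prism E p q r" and R: "rung_of p q r Q s t u v"
  shows rung_path: "chordless E Q" "Q \<noteq> []" "p = s @ t" "q = u @ v"
      "s \<noteq> []" "t \<noteq> []" "u \<noteq> []" "v \<noteq> []"
    and rung_chordless: "chordless E s" "chordless E t" "chordless E u" "chordless E v" "chordless E r"
    and rung_st: "\<And>a b. a \<in> set s \<Longrightarrow> b \<in> set t \<Longrightarrow> a \<noteq> b \<and> (E a b \<longleftrightarrow> a = last s \<and> b = hd t)"
    and rung_uv: "\<And>a b. a \<in> set u \<Longrightarrow> b \<in> set v \<Longrightarrow> a \<noteq> b \<and> (E a b \<longleftrightarrow> a = last u \<and> b = hd v)"
    and rung_su: "\<And>a b. a \<in> set s \<Longrightarrow> b \<in> set u \<Longrightarrow> a \<noteq> b \<and> (E a b \<longleftrightarrow> a = hd s \<and> b = hd u)"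
    and rung_sv: "\<And>a b. a \<in> set s \<Longrightarrow> b \<in> set v \<Longrightarrow> a \<noteq> b \<and> \<not> E a b"
    and rung_ut: "\<And>a b. a \<in> set u \<Longrightarrow> b \<in> set t \<Longrightarrow> a \<noteq> b \<and> \<not> E a b"
    and rung_tv: "\<And>a b. a \<in> set t \<Longrightarrow> b \<in> set v \<Longrightarrow> a \<noteq> b \<and> (E a b \<longleftrightarrow> a = last t \<and> b = last v)"
    and rung_sr: "\<And>a b. a \<in> set s \<Longrightarrow> b \<in> set r \<Longrightarrow> a \<noteq> b \<and> (E a b \<longleftrightarrow> a = hd s \<and> b = hd r)"
    and rung_ur: "\<And>a b. a \<in> set u \<Longrightarrow> b \<in> set r \<Longrightarrow> a \<noteq> b \<and> (E a b \<longleftrightarrow> a = hd u \<and> b = hd r)"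
    and rung_rv: "\<And>a b. a \<in> set r \<Longrightarrow> b \<in> set v \<Longrightarrow> a \<noteq> b \<and> (E a b \<longleftrightarrow> a = last r \<and> b = last v)"
    and rung_Qs: "\<And>a b. a \<in> set Q \<Longrightarrow> b \<in> set s \<Longrightarrow> a \<noteq> b \<and> (E a b \<longleftrightarrow> a = hd Q \<and> b = last s)"
    and rung_Qt: "\<And>a b. a \<in> set Q \<Longrightarrow> b \<in> set t \<Longrightarrow> a \<noteq> b \<and> (E a b \<longleftrightarrow> a = hd Q \<and> b = hd t)"
    and rung_Qu: "\<And>a b. a \<in> set Q \<Longrightarrow> b \<in> set u \<Longrightarrow> a \<noteq> b \<and> (E a b \<longleftrightarrow> a = last Q \<and> b = last u)"
    and rung_Qv: "\<And>a b. a \<in> set Q \<Longrightarrow> b \<in> set v \<Longrightarrow> a \<noteq> b \<and> (E a b \<longleftrightarrow> a = last Q \<and> b = hd v)"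
    and rung_Qr: "\<And>a b. a \<in> set Q \<Longrightarrow> b \<in> set r \<Longrightarrow> a \<noteq> b \<and> \<not> E a b"
    and rung_ends: "hd s \<in> set s" "last s \<in> set s" "hd t \<in> set t" "last t \<in> set t"
      "hd u \<in> set u" "last u \<in> set u" "hd v \<in> set v" "last v \<in> set v"
      "hd r \<in> set r" "last r \<in> set r" "hd Q \<in> set Q" "last Q \<in> set Q"
proof -
  have st: "p = s @ t" "q = u @ v" "s \<noteq> []" "t \<noteq> []" "u \<noteq> []" "v \<noteq> []"
    and Q: "chordless E Q" "Q \<noteq> []"
    and q1: "\<And>x z. x \<in> set Q \<Longrightarrow> z \<in> set s \<union> set t \<Longrightarrow> x \<noteq> z \<and> (E x z \<longleftrightarrow> x = hd Q \<and> (z = last s \<or> z = hd t))"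
    and q2: "\<And>x z. x \<in> set Q \<Longrightarrow> z \<in> set u \<union> set v \<Longrightarrow> x \<noteq> z \<and> (E x z \<longleftrightarrow> x = last Q \<and> (z = last u \<or> z = hd v))"
    and q3: "\<And>x z. x \<in> set Q \<Longrightarrow> z \<in> set r \<Longrightarrow> x \<noteq> z \<and> \<not> E x z"
    using R unfolding rung_of_def by auto
  have P': "chordless E (s @ t)" "chordless E (u @ v)" "chordless E r" "2 \<le> length r"
    "ladder E (s @ t) (u @ v)" "ladder E (s @ t) r" "ladder E (u @ v) r"
    using P st unfolding prism_def by auto
  have r0: "r \<noteq> []" using P'(4) by auto
  have d: "distinct (s @ t)" "distinct (u @ v)"
    using chordless_distinct[OF P'(1)] chordless_distinct[OF P'(2)] by blast+
  show "chordless E Q" "Q \<noteq> []" "p = s @ t" "q = u @ v"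
      "s \<noteq> []" "t \<noteq> []" "u \<noteq> []" "v \<noteq> []" using st Q by auto
  show "chordless E s" "chordless E t" "chordless E u" "chordless E v" "chordless E r"
    using chordless_appendD(1,2) P' st by blast+
  show E: "hd s \<in> set s" "last s \<in> set s" "hd t \<in> set t" "last t \<in> set t"
      "hd u \<in> set u" "last u \<in> set u" "hd v \<in> set v" "last v \<in> set v"
      "hd r \<in> set r" "last r \<in> set r" "hd Q \<in> set Q" "last Q \<in> set Q"
    using st(3-6) Q(2) r0 by simp_all
  have n: "hd t \<notin> set s" "last s \<notin> set t" "hd v \<notin> set u" "last u \<notin> set v"
    using d E unfolding distinct_append by blast+
  fix a b
  show "a \<in> set s \<Longrightarrow> b \<in> set t \<Longrightarrow> a \<noteq> b \<and> (E a b \<longleftrightarrow> a = last s \<and> b = hd t)"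
    by (rule chordless_appendD(3)[OF P'(1) st(3,4)])
  show "a \<in> set u \<Longrightarrow> b \<in> set v \<Longrightarrow> a \<noteq> b \<and> (E a b \<longleftrightarrow> a = last u \<and> b = hd v)"
    by (rule chordless_appendD(3)[OF P'(2) st(5,6)])
  show "a \<in> set s \<Longrightarrow> b \<in> set u \<Longrightarrow> a \<noteq> b \<and> (E a b \<longleftrightarrow> a = hd s \<and> b = hd u)"
    by (rule ladder_split(1)[OF P'(5) d st(3-6)])
  show "a \<in> set s \<Longrightarrow> b \<in> set v \<Longrightarrow> a \<noteq> b \<and> \<not> E a b"
    by (rule ladder_split(2)[OF P'(5) d st(3-6)])
  show "a \<in> set u \<Longrightarrow> b \<in> set t \<Longrightarrow> a \<noteq> b \<and> \<not> E a b"
    using ladder_split(3)[OF P'(5) d st(3-6), of b a] E_commute[of a b] by auto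
  show "a \<in> set t \<Longrightarrow> b \<in> set v \<Longrightarrow> a \<noteq> b \<and> (E a b \<longleftrightarrow> a = last t \<and> b = last v)"
    by (rule ladder_split(4)[OF P'(5) d st(3-6)])
  show "a \<in> set s \<Longrightarrow> b \<in> set r \<Longrightarrow> a \<noteq> b \<and> (E a b \<longleftrightarrow> a = hd s \<and> b = hd r)"
    using ladder_appendD[OF P'(6) d(1) st(3,4), of a b] ladder_disjoint[OF P'(6), of a b] by auto
  show "a \<in> set u \<Longrightarrow> b \<in> set r \<Longrightarrow> a \<noteq> b \<and> (E a b \<longleftrightarrow> a = hd u \<and> b = hd r)"
    using ladder_appendD[OF P'(7) d(2) st(5,6), of a b] ladder_disjoint[OF P'(7), of a b] by auto
  show "a \<in> set r \<Longrightarrow> b \<in> set v \<Longrightarrow> a \<noteq> b \<and> (E a b \<longleftrightarrow> a = last r \<and> b = last v)"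
    using ladder_appendD2[OF P'(7) d(2) st(5,6), of b a] ladder_disjoint[OF P'(7), of b a]
      E_commute[of a b] by auto
  show "a \<in> set Q \<Longrightarrow> b \<in> set s \<Longrightarrow> a \<noteq> b \<and> (E a b \<longleftrightarrow> a = hd Q \<and> b = last s)"
    using q1[of a b] n by auto
  show "a \<in> set Q \<Longrightarrow> b \<in> set t \<Longrightarrow> a \<noteq> b \<and> (E a b \<longleftrightarrow> a = hd Q \<and> b = hd t)"
    using q1[of a b] n by auto
  show "a \<in> set Q \<Longrightarrow> b \<in> set u \<Longrightarrow> a \<noteq> b \<and> (E a b \<longleftrightarrow> a = last Q \<and> b = last u)"
    using q2[of a b] n by auto
  show "a \<in> set Q \<Longrightarrow> b \<in> set v \<Longrightarrow> a \<noteq> b \<and> (E a b \<longleftrightarrow> a = last Q \<and> b = hd v)"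
    using q2[of a b] n by auto
  show "a \<in> set Q \<Longrightarrow> b \<in> set r \<Longrightarrow> a \<noteq> b \<and> \<not> E a b"
    by (rule q3)
qed

text \<open>The prism between the triangle of the heads and the triangle at \<open>last Q\<close>.
  Its routes use all of the six paths except \<open>t\<close>. One route is \<open>u\<close> alone,
  which must therefore have two vertices.\<close>

lemma rung_prism_corner:
  assumes P: "prism E p q r" and R: "rung_of p q r Q s t u v" and u2: "2 \<le> length u"
  shows "prism E (s @ Q) u (r @ rev v)"
proof -
  note C = rung_path[OF P R] rung_chordless[OF P R] and e = rung_ends[OF P R]
  have r2: "2 \<le> length r" using P unfolding prism_def by simp
  then have r0: "r \<noteq> []" by auto
  have "chordless E (s @ Q)"
  proof (rule chordless_appendI[of _ _ "last s" "hd Q"])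
    fix a b assume "a \<in> set s" "b \<in> set Q"
    then show "a \<noteq> b \<and> (E a b \<longleftrightarrow> a = last s \<and> b = hd Q)"
      using rung_Qs[OF P R, of b a] E_commute[of a b] by auto
  qed (use C in simp_all)
  moreover have "chordless E (r @ rev v)"
  proof (rule chordless_appendI[of _ _ "last r" "last v"])
    fix a b assume "a \<in> set r" "b \<in> set (rev v)"
    then show "a \<noteq> b \<and> (E a b \<longleftrightarrow> a = last r \<and> b = last v)"
      using rung_rv[OF P R, of a b] by auto
  qed (use C r0 in \<open>simp_all add: hd_rev\<close>)
  moreover have "ladder E (s @ Q) u"
  proof (rule ladderI[of _ "hd s" _ "hd u" "last Q" "last u"])
    fix a b assume ab: "a \<in> set (s @ Q)" "b \<in> set u"
    show "a \<noteq> b \<and> (E a b \<longleftrightarrow> a = hd s \<and> b = hd u \<or> a = last Q \<and> b = last u)"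
    proof (cases "a \<in> set s")
      case True
      then show ?thesis using ab rung_su[OF P R, of a b] rung_Qs[OF P R e(12), of a] by auto
    next
      case False
      then show ?thesis using ab rung_Qu[OF P R, of a b] rung_Qs[OF P R _ e(1), of a] by auto
    qed
  qed (use C in simp_all)
  moreover have "ladder E (s @ Q) (r @ rev v)"
  proof (rule ladderI[of _ "hd s" _ "hd r" "last Q" "hd v"])
    fix a b assume ab: "a \<in> set (s @ Q)" "b \<in> set (r @ rev v)"
    show "a \<noteq> b \<and> (E a b \<longleftrightarrow> a = hd s \<and> b = hd r \<or> a = last Q \<and> b = hd v)"
    proof (cases "a \<in> set s")
      case True
      then show ?thesis
        using ab rung_sr[OF P R, of a b] rung_sv[OF P R, of a b] rung_Qs[OF P R e(12), of a]
          rung_rv[OF P R e(9), of b] by auto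
    next
      case False
      then show ?thesis
        using ab rung_Qr[OF P R, of a b] rung_Qv[OF P R, of a b] rung_Qs[OF P R _ e(1), of a]
          rung_rv[OF P R _ e(7), of b] by auto
    qed
  qed (use C r0 in \<open>simp_all add: last_rev\<close>)
  moreover have "ladder E u (r @ rev v)"
  proof (rule ladderI[of _ "hd u" _ "hd r" "last u" "hd v"])
    fix a b assume ab: "a \<in> set u" "b \<in> set (r @ rev v)"
    then show "a \<noteq> b \<and> (E a b \<longleftrightarrow> a = hd u \<and> b = hd r \<or> a = last u \<and> b = hd v)"
      using rung_ur[OF P R, of a b] rung_uv[OF P R, of a b]
          rung_rv[OF P R _ e(7), of b] rung_rv[OF P R e(9), of b] by auto
  qed (use C r0 in \<open>simp_all add: last_rev\<close>)
  moreover have "2 \<le> length (s @ Q)" using C(2,5) by (cases s; cases Q; simp)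
  ultimately show ?thesis using C u2 r2 unfolding prism_def by simp
qed

text \<open>The three routes between the triangles at the two ends of \<open>Q\<close>; they avoid
  \<open>r\<close>. They are stated as ladders because a \<open>Q\<close> with one vertex gives no
  prism, although it can still bound a hole with another route.\<close>

lemma rung_ladders:
  assumes P: "prism E p q r" and R: "rung_of p q r Q s t u v"
  shows "chordless E (rev s @ u)" "chordless E (t @ rev v)"
    "ladder E Q (rev s @ u)" "ladder E Q (t @ rev v)" "ladder E (rev s @ u) (t @ rev v)"
proof -
  note C = rung_path[OF P R] rung_chordless[OF P R] and e = rung_ends[OF P R]
  show "chordless E (rev s @ u)"
  proof (rule chordless_appendI[of _ _ "hd s" "hd u"])
    fix a b assume "a \<in> set (rev s)" "b \<in> set u"
    then show "a \<noteq> b \<and> (E a b \<longleftrightarrow> a = hd s \<and> b = hd u)"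
      using rung_su[OF P R, of a b] by auto
  qed (use C in \<open>simp_all add: last_rev\<close>)
  show "chordless E (t @ rev v)"
  proof (rule chordless_appendI[of _ _ "last t" "last v"])
    fix a b assume "a \<in> set t" "b \<in> set (rev v)"
    then show "a \<noteq> b \<and> (E a b \<longleftrightarrow> a = last t \<and> b = last v)"
      using rung_tv[OF P R, of a b] by auto
  qed (use C in \<open>simp_all add: hd_rev\<close>)
  show "ladder E Q (rev s @ u)"
  proof (rule ladderI[of _ "hd Q" _ "last s" "last Q" "last u"])
    fix a b assume ab: "a \<in> set Q" "b \<in> set (rev s @ u)"
    then show "a \<noteq> b \<and> (E a b \<longleftrightarrow> a = hd Q \<and> b = last s \<or> a = last Q \<and> b = last u)"
      using rung_Qs[OF P R, of a b] rung_Qu[OF P R, of a b]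
        rung_su[OF P R e(2), of b] rung_su[OF P R _ e(6), of b] by auto
  qed (use C in \<open>simp_all add: hd_rev\<close>)
  show "ladder E Q (t @ rev v)"
  proof (rule ladderI[of _ "hd Q" _ "hd t" "last Q" "hd v"])
    fix a b assume ab: "a \<in> set Q" "b \<in> set (t @ rev v)"
    then show "a \<noteq> b \<and> (E a b \<longleftrightarrow> a = hd Q \<and> b = hd t \<or> a = last Q \<and> b = hd v)"
      using rung_Qt[OF P R, of a b] rung_Qv[OF P R, of a b]
        rung_tv[OF P R e(3), of b] rung_tv[OF P R _ e(7), of b] by auto
  qed (use C in \<open>simp_all add: last_rev\<close>)
  show "ladder E (rev s @ u) (t @ rev v)"
  proof (rule ladderI[of _ "last s" _ "hd t" "last u" "hd v"])
    fix a b assume ab: "a \<in> set (rev s @ u)" "b \<in> set (t @ rev v)"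
    show "a \<noteq> b \<and> (E a b \<longleftrightarrow> a = last s \<and> b = hd t \<or> a = last u \<and> b = hd v)"
    proof (cases "a \<in> set s")
      case True
      then show ?thesis using ab rung_st[OF P R, of a b] rung_sv[OF P R, of a b]
          rung_su[OF P R _ e(6), of a] rung_tv[OF P R e(3), of b] by auto
    next
      case False
      then show ?thesis using ab rung_ut[OF P R, of a b] rung_uv[OF P R, of a b]
          rung_su[OF P R e(2), of a] rung_tv[OF P R _ e(7), of b] by auto
    qed
  qed (use C in \<open>simp_all add: hd_rev last_rev\<close>)
qed

section \<open>Minimal odd prisms\<close>

text \<open>Size is the total number of vertices. The parity of \<open>p\<close> stands for all
  three by \<open>prism_parity\<close>, and the lengths are left unordered so that the paths can be
  permuted.\<close>

definition minimal_odd :: "'a list \<Rightarrow> 'a list \<Rightarrow> 'a list \<Rightarrow> bool" where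
  "minimal_odd p q r \<longleftrightarrow> prism E p q r \<and> even (length p) \<and>
     (\<forall>p' q' r'. prism E p' q' r' \<longrightarrow> even (length p') \<longrightarrow>
        length p + length q + length r \<le> length p' + length q' + length r')"

lemma minimal_oddD:
  assumes "minimal_odd p q r"
  shows "prism E p q r" "even (length p)" "even (length q)" "even (length r)"
    "prism E p' q' r' \<Longrightarrow> even (length p') \<or> even (length q') \<or> even (length r') \<Longrightarrow>
      length p + length q + length r \<le> length p' + length q' + length r'"
  using assms prism_parity unfolding minimal_odd_def by blast+

lemma minimal_odd_sym:
  assumes "minimal_odd p q r"
  shows "minimal_odd q p r" "minimal_odd p r q" "minimal_odd (rev p) (rev q) (rev r)"
proof -
  note m = minimal_oddD[OF assms]
  have le: "length p + length q + length r \<le> length p' + length q' + length r'"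
    if "prism E p' q' r'" "even (length p')" for p' q' r'
    using m(5)[OF that(1)] that(2) by blast
  show "minimal_odd q p r" unfolding minimal_odd_def
    using m(3) prism_perm(1)[OF m(1)] le by (simp add: add.commute)
  show "minimal_odd p r q" unfolding minimal_odd_def
    using m(2) prism_perm(2)[OF m(1)] le by (simp add: add.assoc add.commute[of "length r"])
  show "minimal_odd (rev p) (rev q) (rev r)" unfolding minimal_odd_def
    using m(2) prism_rev[OF m(1)] le by simp
qed

text \<open>The corner prism gains \<open>Q\<close> and loses \<open>t\<close>, and it is odd
  because \<open>u\<close>, one of its paths, has evenly many vertices. By minimality the gain is at
  least the loss.\<close>

lemma minimal_rung_corner:
  assumes M: "minimal_odd p q r" and R: "rung_of p q r Q s t u v" and u: "2 \<le> length u" "even (length u)"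
  shows "length t \<le> length Q"
proof -
  note m = minimal_oddD[OF M]
  have "length p + length q + length r \<le> length (s @ Q) + length u + length (r @ rev v)"
    using m(5) rung_prism_corner[OF m(1) R u(1)] u(2) by blast
  then show ?thesis using rung_path[OF m(1) R] by simp
qed

text \<open>The subdivision of \<open>K\<^sub>4\<close> is bipartite, and two branch vertices of the same colour are the end
  triangles of an odd prism. The triangles of the given prism have the same colour; the parities of
  \<open>s\<close> and \<open>u\<close> tell whether the triangles at \<open>p\<close> and at \<open>q\<close> share it. If neither does, these two have
  the same colour, which is the third case.\<close>

lemma minimal_rung_bound:
  assumes M: "minimal_odd p q r" and R: "rung_of p q r Q s t u v"
    and uv: "2 \<le> length u" "2 \<le> length v"
  shows "length p \<le> 2 * length Q \<or> length q \<le> 2 * length Q \<or>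
    length r \<le> length Q \<and> 2 \<le> length Q \<and> odd (length s) \<and> odd (length u)"
proof -
  note m = minimal_oddD[OF M]
  note C = rung_path[OF m(1) R] rung_chordless[OF m(1) R]
  have ev: "even (length s) \<longleftrightarrow> even (length t)" "even (length u) \<longleftrightarrow> even (length v)"
    using m(2,3) C by auto
  have pos: "0 < length s" "0 < length t" using C by auto
  show ?thesis
  proof (cases "even (length u)")
    case True
    \<comment> \<open>\<open>v\<close> is even together with \<open>u\<close>. One corner prism
      saves \<open>t\<close> and the reversed one saves \<open>s\<close>, so together they give
      \<open>|p| <= 2|Q|\<close>.\<close>
    have "length t \<le> length Q" by (rule minimal_rung_corner[OF M R uv(1) True])
    moreover have "length (rev s) \<le> length Q"
      by (rule minimal_rung_corner[OF minimal_odd_sym(3)[OF M] rung_of_rev[OF R]]) (use uv True ev in auto)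
    ultimately show ?thesis using C by simp
  next
    case ou: False
    show ?thesis
    proof (cases "even (length s)")
      case True
      then have st: "2 \<le> length s" "2 \<le> length t" using pos ev(1) by presburger+
      note M' = minimal_odd_sym(1)[OF M] and R' = rung_of_swap[OF R]
      have "length v \<le> length (rev Q)" by (rule minimal_rung_corner[OF M' R' st(1) True])
      moreover have "length (rev u) \<le> length (rev Q)"
        by (rule minimal_rung_corner[OF minimal_odd_sym(3)[OF M'] rung_of_rev[OF R']]) (use st True ev in auto)
      ultimately show ?thesis using C by simp
    next
      case os: False
      note L = rung_ladders[OF m(1) R]
      \<comment> \<open>A single vertex \<open>Q\<close> would form a hole of odd length with
        \<open>rev s @ u\<close>; being odd and at least two, \<open>u\<close> has three vertices,
        so the cycle is long enough.\<close>
      have Q2: "2 \<le> length Q"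
      proof (rule ccontr)
        assume "\<not> 2 \<le> length Q"
        moreover have "0 < length Q" using C by simp
        ultimately have Q1: "length Q = 1" by linarith
        have "3 \<le> length u" using uv(1) ou by presburger
        then have "4 \<le> length Q + length (rev s @ u)" using Q1 pos(1) by simp
        moreover have "rev s @ u \<noteq> []" using C by simp
        ultimately have "even (length Q + length (rev s @ u))"
          using ladder_even[OF C(1,2) L(1) _ L(3)] by blast
        then show False using os ou Q1 by simp
      qed
      \<comment> \<open>This prism uses all six paths except \<open>r\<close>, so minimality yields
        \<open>|r| <= |Q|\<close>.\<close>
      have "prism E Q (rev s @ u) (t @ rev v)"
        using L C Q2 uv unfolding prism_def by simp
      then have "length p + length q + length r \<le> length Q + length (rev s @ u) + length (t @ rev v)"
        by (rule m(5)) (use os ou in simp)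
      then show ?thesis using C os ou Q2 by simp
    qed
  qed
qed

text \<open>\<open>W\<close> is attached to \<open>p\<close> at the edge \<open>last a, hd b\<close>
  and at the edge \<open>last b, hd c\<close>, which makes two triangles. They are joined by
  \<open>b\<close>, by \<open>W\<close>, and by the outer route along \<open>a\<close>,
  \<open>q\<close> and \<open>c\<close>. All of \<open>r\<close> is dropped and replaced by
  \<open>W\<close>.\<close>

lemma two_rungs_prism:
  assumes P: "prism E p q r" and p: "p = a @ b @ c" "a \<noteq> []" "c \<noteq> []" "2 \<le> length b"
    and W: "chordless E W" "2 \<le> length W"
    and Wp: "\<And>x z. x \<in> set W \<Longrightarrow> z \<in> set p \<Longrightarrow> x \<noteq> z \<and>
      (E x z \<longleftrightarrow> x = hd W \<and> (z = last a \<or> z = hd b) \<or> x = last W \<and> (z = last b \<or> z = hd c))"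
    and Wq: "\<And>x z. x \<in> set W \<Longrightarrow> z \<in> set q \<Longrightarrow> x \<noteq> z \<and> \<not> E x z"
  shows "prism E b W (rev a @ q @ rev c)"
proof -
  have P': "chordless E (a @ b @ c)" "chordless E q" "2 \<le> length q" "ladder E (a @ b @ c) q"
    using P p unfolding prism_def by auto
  have b0: "b \<noteq> []" "W \<noteq> []" "q \<noteq> []" using p(4) W P' by auto
  have d: "distinct (a @ b @ c)" using chordless_distinct[OF P'(1)] .
  have e: "last a \<in> set a" "hd b \<in> set b" "last b \<in> set b" "hd c \<in> set c" "hd a \<in> set a" "last c \<in> set c"
    "hd W \<in> set W" "last W \<in> set W" "hd q \<in> set q" "last q \<in> set q"
    using p b0 by auto
  have c1: "chordless E a" "chordless E (b @ c)" "chordless E b" "chordless E c"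
    using chordless_appendD(1,2)[of a "b @ c"] chordless_appendD(1,2)[of b c] P' p b0 by auto
  have abc: "x \<noteq> z \<and> (E x z \<longleftrightarrow> x = last a \<and> z = hd b)" if "x \<in> set a" "z \<in> set b \<union> set c" for x z
    using chordless_appendD(3)[of a "b @ c" x z] P' p b0 that by auto
  have bc: "x \<noteq> z \<and> (E x z \<longleftrightarrow> x = last b \<and> z = hd c)" if "x \<in> set b" "z \<in> set c" for x z
    using chordless_appendD(3)[of b c x z] c1 p b0 that by auto
  have l: "x \<noteq> z \<and> (E x z \<longleftrightarrow> x = hd a \<and> z = hd q \<or> x = last c \<and> z = last q)"
    if "x \<in> set a \<union> set b \<union> set c" "z \<in> set q" for x z
    using P'(4) that p b0 unfolding ladder_def by auto
  have Wp': "x \<noteq> z \<and>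
      (E x z \<longleftrightarrow> x = hd W \<and> (z = last a \<or> z = hd b) \<or> x = last W \<and> (z = last b \<or> z = hd c))"
    if "x \<in> set W" "z \<in> set a \<union> set b \<union> set c" for x z
    using Wp[of x z] that p by auto
  have hb: "hd b \<noteq> last b" using chordless_ends_neq[OF c1(3) p(4)] .
  have qc: "chordless E (q @ rev c)"
  proof (rule chordless_appendI[of _ _ "last q" "last c"])
    fix x z assume "x \<in> set q" "z \<in> set (rev c)"
    then show "x \<noteq> z \<and> (E x z \<longleftrightarrow> x = last q \<and> z = last c)"
      using l[of z x] abc[OF e(5), of z] E_commute[of x z] by auto
  qed (use P' p b0 c1 in \<open>simp_all add: hd_rev\<close>)
  have aqc: "chordless E (rev a @ q @ rev c)"
  proof (rule chordless_appendI[of _ _ "hd a" "hd q"])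
    fix x z assume "x \<in> set (rev a)" "z \<in> set (q @ rev c)"
    then show "x \<noteq> z \<and> (E x z \<longleftrightarrow> x = hd a \<and> z = hd q)"
      using l[of x z] abc[of x z] l[of z "hd q"] abc[of x "last c"] abc[of x "hd b"] bc[OF e(2), of z] e by auto
  qed (use qc p b0 c1 in \<open>simp_all add: last_rev\<close>)
  have bW: "ladder E b W"
  proof (rule ladderI[of _ "hd b" _ "hd W" "last b" "last W"])
    fix x z assume xz: "x \<in> set b" "z \<in> set W"
    then show "x \<noteq> z \<and> (E x z \<longleftrightarrow> x = hd b \<and> z = hd W \<or> x = last b \<and> z = last W)"
      using Wp'[of z x] abc[OF e(1), of x] bc[OF xz(1) e(4)] E_commute[of x z] by auto
  qed (use p b0 in simp_all)
  have b3: "ladder E b (rev a @ q @ rev c)"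
  proof (rule ladderI[of _ "hd b" _ "last a" "last b" "hd c"])
    fix x z assume xz: "x \<in> set b" "z \<in> set (rev a @ q @ rev c)"
    have n: "x \<noteq> hd a" "x \<noteq> last c" using abc[OF e(5), of x] bc[OF xz(1) e(6)] xz by auto
    consider "z \<in> set a" | "z \<in> set q" | "z \<in> set c" using xz by auto
    then show "x \<noteq> z \<and> (E x z \<longleftrightarrow> x = hd b \<and> z = last a \<or> x = last b \<and> z = hd c)"
    proof cases
      case 1
      then show ?thesis using abc[of z x] abc[OF 1, of "hd c"] xz e E_commute[of x z] by auto
    next
      case 2
      then show ?thesis using l[of x z] l[OF _ 2, of "last a"] l[OF _ 2, of "hd c"] xz e n by auto
    next
      case 3
      then show ?thesis using bc[of x z] abc[OF e(1), of z] xz by auto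
    qed
  qed (use p b0 in \<open>simp_all add: hd_rev last_rev\<close>)
  have W3: "ladder E W (rev a @ q @ rev c)"
  proof (rule ladderI[of _ "hd W" _ "last a" "last W" "hd c"])
    fix x z assume xz: "x \<in> set W" "z \<in> set (rev a @ q @ rev c)"
    consider "z \<in> set a" | "z \<in> set q" | "z \<in> set c" using xz by auto
    then show "x \<noteq> z \<and> (E x z \<longleftrightarrow> x = hd W \<and> z = last a \<or> x = last W \<and> z = hd c)"
    proof cases
      case 1
      then show ?thesis using Wp'[of x z] abc[OF 1, of "hd b"] abc[OF 1, of "last b"] abc[OF 1, of "hd c"] xz e by auto
    next
      case 2
      then show ?thesis using Wq[of x z] l[OF _ 2, of "last a"] l[OF _ 2, of "hd c"] xz e by auto
    next
      case 3
      then show ?thesis using Wp'[of x z] abc[OF e(1), of z] bc[OF e(2) 3] bc[OF e(3) 3] xz by auto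
    qed
  qed (use p b0 in \<open>simp_all add: hd_rev last_rev\<close>)
  show ?thesis using aqc bW b3 W3 W c1 p(4) P'(3) unfolding prism_def by simp
qed

end

section \<open>Replacing the paths of a minimal odd prism by shortest paths\<close>

definition reachable_walk :: "('a \<Rightarrow> 'a \<Rightarrow> bool) \<Rightarrow> 'a set \<Rightarrow> 'a \<Rightarrow> 'a \<Rightarrow> 'a list \<Rightarrow> bool" where
  "reachable_walk E K g h R \<longleftrightarrow>
     successively E R \<and> R \<noteq> [] \<and> hd R = g \<and> last R = h \<and>
     (\<forall>v \<in> set R. v = g \<or> v = h \<or> (\<forall>k \<in> K. v \<noteq> k \<and> \<not> E k v))"

text \<open>In \<open>reachable_walk\<close> the ends \<open>g\<close> and \<open>h\<close> are
  exempt from the condition on \<open>K\<close>, because the corners of a prism are adjacent to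
  blocked corners. Competing walks may repeat vertices.\<close>

definition shortest :: "('a \<Rightarrow> 'a \<Rightarrow> bool) \<Rightarrow> 'a set \<Rightarrow> 'a \<Rightarrow> 'a \<Rightarrow> 'a list \<Rightarrow> bool" where
  "shortest E K g h R \<longleftrightarrow> reachable_walk E K g h R \<and>
     (\<forall>R'. reachable_walk E K g h R' \<longrightarrow> length R \<le> length R')"

lemma shortest_chordless: 
  assumes "shortest E K g h R"
  shows "chordless E R"
  using assms unfolding shortest_def reachable_walk_def
  by (intro shortest_walk_chordless) blast+

context no_odd_hole begin

text \<open>A shortest walk \<open>w\<close> inside \<open>p'\<close> is chordless and so forms an
  odd prism with \<open>q\<close> and \<open>r\<close>. Minimality gives
  \<open>|p| <= |w| <= |p'| <= |p|\<close>, hence \<open>p'\<close> is itself shortest within its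
  vertex set, and chordless.\<close>

lemma replace_path:
  assumes M: "minimal_odd p q r"
    and W: "successively E p'" "p' \<noteq> []" "hd p' = hd p" "last p' = last p"
    and free: "\<And>x z. x \<in> set p' \<Longrightarrow> x \<noteq> hd p \<Longrightarrow> x \<noteq> last p \<Longrightarrow> z \<in> set q \<union> set r \<Longrightarrow> x \<noteq> z \<and> \<not> E x z"
    and len: "length p' \<le> length p"
  shows "minimal_odd p' q r" "length p' = length p"
proof -
  note m = minimal_oddD[OF M]
  have P': "chordless E p" "chordless E q" "chordless E r" "2 \<le> length p" "2 \<le> length q" "2 \<le> length r"
    "ladder E p q" "ladder E p r" "ladder E q r"
    using m(1) unfolding prism_def by auto
  have hl: "hd p \<noteq> last p" using chordless_ends_neq[OF P'(1,4)] .
  have p0: "hd p \<in> set p" "last p \<in> set p" using P'(4) by (cases p; auto)+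
  let ?W = "\<lambda>w. successively E w \<and> w \<noteq> [] \<and> hd w = hd p \<and> last w = last p \<and> set w \<subseteq> set p'"
  have prism: "prism E w q r" if w: "?W w" "chordless E w" for w
  proof -
    have lad: "ladder E w k" if k: "ladder E p k" "set k \<subseteq> set q \<union> set r" for k
    proof (rule ladderI[of _ "hd p" _ "hd k" "last p" "last k"])
      fix a b assume ab: "a \<in> set w" "b \<in> set k"
      show "a \<noteq> b \<and> (E a b \<longleftrightarrow> a = hd p \<and> b = hd k \<or> a = last p \<and> b = last k)"
      proof (cases "a = hd p \<or> a = last p")
        case True
        then have "a \<in> set p" using p0 by auto
        then show ?thesis using k(1) ab(2) unfolding ladder_def by blast
      next
        case False
        then show ?thesis using free[of a b] ab w k(2) by auto
      qed
    qed (use w in auto)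
    have "2 \<le> length w" using w hl by (cases w; cases "tl w") auto
    then show ?thesis using w P' lad[of q] lad[of r] unfolding prism_def by auto
  qed
  obtain w where w: "?W w" and wm: "\<And>w'. ?W w' \<Longrightarrow> length w \<le> length w'"
    using ex_has_least_nat[of ?W p' length] W by auto
  have "chordless E w"
    by (rule shortest_walk_chordless) (use w in \<open>auto intro!: wm\<close>)
  then have pw: "prism E w q r" using prism w by blast
  then have "length p + length q + length r \<le> length w + length q + length r"
    using m(5) m(3) by blast
  then have lw: "length p \<le> length w" by simp
  have "length w \<le> length p'" using wm[of p'] W by auto
  then show len': "length p' = length p" using lw len by simp
  have "chordless E p'"
  proof (rule shortest_walk_chordless[OF W(1,2)])
    fix q' assume "successively E q'" "q' \<noteq> []" "hd q' = hd p'" "last q' = last p'" "set q' \<subseteq> set p'"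
    then have "length w \<le> length q'" using W by (intro wm) auto
    then show "length p' \<le> length q'" using lw len by simp
  qed
  then have "prism E p' q r" using prism W by auto
  then show "minimal_odd p' q r" using M len' unfolding minimal_odd_def by simp
qed

text \<open>Let \<open>x\<close> be the first vertex of \<open>I\<close> that sees \<open>q\<close>
  or \<open>r\<close>, and \<open>y\<close> the last vertex up to \<open>x\<close> that sees
  \<open>p\<close>; it exists because the walk starts at \<open>g\<close> on \<open>p\<close>. The
  stretch from \<open>y\<close> to \<open>x\<close> is the rung \<open>Q\<close>.\<close>

lemma first_rung:
  assumes P: "prism E p q r" and R: "chordless E (g # I @ [h])" "g \<in> set p" "h \<in> set p"
    and corners: "\<And>x z. x \<in> set I \<Longrightarrow> z \<in> {hd q, hd r, last q, last r} \<Longrightarrow> x \<noteq> z \<and> \<not> E x z"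
    and ex: "\<exists>x \<in> set I. \<exists>z \<in> set q \<union> set r. E x z"
  obtains A Q B k k' s t u v where "I = A @ Q @ B" "rung_of p k k' Q s t u v"
    "k = q \<and> k' = r \<or> k = r \<and> k' = q" "2 \<le> length u" "2 \<le> length v"
    "\<And>x z. x \<in> set A \<Longrightarrow> z \<in> set q \<union> set r \<Longrightarrow> \<not> E x z"
proof -
  have P': "chordless E p" "chordless E q" "chordless E r" "2 \<le> length p" "2 \<le> length q" "2 \<le> length r"
    "ladder E p q" "ladder E p r" "ladder E q r"
    using P unfolding prism_def by auto
  from split_list_first_propE[OF ex] obtain I1 x I2
    where I: "I = I1 @ x # I2" and x: "\<exists>z \<in> set q \<union> set r. E x z"
      and I1: "\<forall>y \<in> set I1. \<not> (\<exists>z \<in> set q \<union> set r. E y z)" by metis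
  have "successively E ([g] @ (I1 @ [x]) @ (I2 @ [h]))" using chordless_successively[OF R(1)] I by simp
  then have S: "successively E ((I1 @ [x]) @ (I2 @ [h]))" "E g (hd ((I1 @ [x]) @ (I2 @ [h])))"
    unfolding successively_append_iff[of _ "[g]"] by auto
  have S1: "successively E (I1 @ [x])"
    using S(1) unfolding successively_append_iff[of _ "I1 @ [x]"] by blast
  have gh: "E g (hd (I1 @ [x]))"
    using S(2) by (cases I1) auto
  have "hd (I1 @ [x]) \<in> set (I1 @ [x])" by (metis hd_in_set snoc_eq_iff_butlast)
  then have "\<exists>y \<in> set (I1 @ [x]). \<exists>z \<in> set p. E y z" using gh R(2) E_sym by blast
  from split_list_last_propE[OF this] obtain A y B
    where AB: "I1 @ [x] = A @ y # B" and y: "\<exists>z \<in> set p. E y z"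
      and B: "\<forall>w \<in> set B. \<not> (\<exists>z \<in> set p. E w z)" by metis
  define Q where "Q = y # B"
  have Q0: "Q \<noteq> []" "hd Q = y" "last Q = x"
    using arg_cong[OF AB, of last] by (auto simp: Q_def)
  have IQ: "I = A @ Q @ I2" using I AB by (simp add: Q_def flip: append_assoc)
  have setQ: "set Q \<subseteq> insert x (set I1)" "set Q \<subseteq> set I" "x \<in> set I"
    using arg_cong[OF AB, of set] I by (auto simp: Q_def)
  have "butlast (I1 @ [x]) = A @ butlast (y # B)" using AB by (simp add: butlast_append)
  then have "I1 = A @ butlast (y # B)" by simp
  then have setA: "set A \<subseteq> set I1" by auto
  have "chordless E ((g # A) @ Q @ I2 @ [h])" using R(1) IQ by simp
  then have "chordless E (Q @ I2 @ [h])" by (rule chordless_appendD(2)) (use Q0 in auto)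
  then have cQ: "chordless E Q" by (rule chordless_appendD(1)) (use Q0 in auto)
  have corner_p: "\<not> E w z" if "w \<in> set I" "w \<in> set p" "z \<in> set q \<union> set r" for w z
  proof
    assume "E w z"
    then have "z \<in> {hd q, hd r, last q, last r}" using P' that unfolding ladder_def by auto
    then show False using corners[of w z] that \<open>E w z\<close> by auto
  qed
  have corner_q: "\<not> E w z" if "w \<in> set I" "w \<in> set q \<union> set r" "z \<in> set p" for w z
  proof
    assume "E w z"
    then have "w \<in> {hd q, hd r, last q, last r}"
      using P' that E_sym[of w z] unfolding ladder_def by auto
    then show False using corners[of w w] that by auto
  qed
  have Qp: "w = hd Q" if "w \<in> set Q" "z \<in> set p" "E w z" for w z
    using that B Q0 by (auto simp: Q_def)
  have Qqr: "w = last Q" if "w \<in> set Q" "z \<in> set q \<union> set r" "E w z" for w z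
    using that I1 Q0 setQ by blast
  \<comment> \<open>A vertex of \<open>Q\<close> on the prism has a neighbour on its own path, so it
    is \<open>y\<close> or \<open>x\<close>. Then its neighbour on the walk contradicts the choice
    of \<open>y\<close> or \<open>x\<close>, or else a corner appears that \<open>I\<close> has to
    avoid.\<close>
  have dis: "w \<noteq> z" if w: "w \<in> set Q" and z: "z \<in> set p \<union> set q \<union> set r" for w z
  proof
    assume [simp]: "w = z"
    have wI: "w \<in> set I" using w setQ by auto
    consider "w \<in> set p" | "w \<in> set q \<union> set r" using z by auto
    then show False
    proof cases
      case 1
      then obtain z' where "z' \<in> set p" "E w z'" using neighbour_in_path P' by blast
      then have wy: "w = y" using Qp w Q0 by auto
      show False
      proof (cases B)
        case Nil
        then have "w = x" using Q0 wy by (simp add: Q_def)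
        then show False using x corner_p[OF wI 1] by auto
      next
        case (Cons b B')
        then have "E y b" using chordless_successively[OF cQ] by (simp add: Q_def)
        then show False using B Cons 1 wy E_sym by auto
      qed
    next
      case 2
      then obtain z' where "z' \<in> set q \<union> set r" "E w z'" using neighbour_in_path P' by blast
      then have wx: "w = x" using Qqr w Q0 by auto
      show False
      proof (cases "I1 = []")
        case True
        then have "E g x" using gh by simp
        then show False using corner_q[OF wI 2 R(2)] wx E_sym by auto
      next
        case False
        then have "E (last I1) x" using S1 by (simp add: successively_append_iff)
        then show False using I1 False 2 wx by auto
      qed
    qed
  qed
  have cor: "\<not> E (last Q) z" if "z \<in> {hd q, hd r, last q, last r}" for z
    using corners[OF setQ(3) that] Q0 by simp
  obtain k k' s t u v where "rung_of p k k' Q s t u v"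
    "k = q \<and> k' = r \<or> k = r \<and> k' = q" "2 \<le> length u" "2 \<le> length v"
    by (rule rung_of_exists[OF P cQ Q0(1) dis Qp _ Qqr _ cor]) (use y x Q0 in auto)
  then show ?thesis
    by (rule that[OF IQ]) (use I1 setA in blast)
qed

lemma chordless_prefix: "chordless E (s @ t) \<Longrightarrow> chordless E s"
  using chordless_appendD(1)[of s t] by (cases "s = []"; cases "t = []") auto

lemma chordless_suffix: "chordless E (s @ t) \<Longrightarrow> chordless E t"
  using chordless_appendD(2)[of s t] by (cases "s = []"; cases "t = []") auto

lemma prism_not_adjacent_inner:
  assumes P: "prism E p q r" and x: "x \<in> set p" "x \<noteq> hd p" "x \<noteq> last p" "z \<in> set q \<union> set r"
  shows "x \<noteq> z \<and> \<not> E x z"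
proof -
  have "ladder E p q" "ladder E p r" using P unfolding prism_def by auto
  then show ?thesis using x unfolding ladder_def by auto
qed

lemma prism_not_adjacent_corner:
  assumes P: "prism E p q r" and x: "x \<in> set q \<union> set r" "x \<notin> {hd q, hd r, last q, last r}" "z \<in> set p"
  shows "x \<noteq> z \<and> \<not> E z x"
proof -
  have "ladder E p q" "ladder E p r" using P unfolding prism_def by auto
  then show ?thesis using x unfolding ladder_def by auto
qed

text \<open>The shortest walk leaves \<open>g\<close>, passes through \<open>R0\<close> and
  \<open>y\<close>, and comes back with \<open>B\<close> to the edge \<open>last s, hd t\<close>
  that \<open>y\<close> is attached to. Staying on \<open>s\<close> from \<open>g\<close> to
  \<open>last s\<close> and then joining \<open>B\<close> is allowed too, so \<open>s\<close> has
  more vertices after \<open>g\<close> than \<open>R0\<close> has. But then leaving \<open>p\<close>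
  at \<open>g\<close> along \<open>R0\<close> and \<open>y\<close> and rejoining it at
  \<open>hd t\<close> makes \<open>p\<close> shorter. The \<open>2\<close> in \<open>short\<close>
  counts \<open>y\<close> and a further vertex of its rung.\<close>

lemma no_second_rung_at_same_edge:
  assumes M: "minimal_odd p q r" and p: "p = s @ t" "s \<noteq> []" "t \<noteq> []" and g: "g \<in> set s"
    and R0: "successively E (R0 @ [y])" "R0 \<noteq> []" "hd R0 = g" "E y (hd t)"
    and free: "\<And>x z. x \<in> set (tl R0 @ [y]) \<Longrightarrow> z \<in> set q \<union> set r \<Longrightarrow> x \<noteq> z \<and> \<not> E x z"
    and B: "successively E B" "B \<noteq> []" "last B = h" "E (last s) (hd B)"
      "\<And>v. v \<in> set B \<Longrightarrow> v = h \<or> (\<forall>k \<in> K. v \<noteq> k \<and> \<not> E k v)"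
    and K: "K = set q \<union> {hd r, last r}"
    and short: "\<And>R'. reachable_walk E K g h R' \<Longrightarrow> length R0 + 2 + length B \<le> length R'"
  shows False
proof -
  note m = minimal_oddD[OF M]
  have P': "chordless E p" "2 \<le> length p"
    using m(1) unfolding prism_def by auto
  have dp: "distinct p" using chordless_distinct[OF P'(1)] .
  obtain s1 s2 where s: "s = s1 @ g # s2" using split_list[OF g] by blast
  have sp: "successively E (s1 @ g # s2 @ t)" using chordless_successively[OF P'(1)] p s by simp
  have "reachable_walk E K g h ((g # s2) @ B)"
    unfolding reachable_walk_def
  proof (intro conjI ballI)
    have "successively E (g # s2)" using sp by (auto simp: successively_append_iff successively_Cons)
    moreover have "last (g # s2) = last s" using s by simp
    ultimately show "successively E ((g # s2) @ B)" using B unfolding successively_append_iff by auto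
    fix v assume v: "v \<in> set ((g # s2) @ B)"
    show "v = g \<or> v = h \<or> (\<forall>k \<in> K. v \<noteq> k \<and> \<not> E k v)"
    proof (cases "v \<in> set s2")
      case True
      have "v \<in> set p" using True p s by simp
      moreover have "v \<noteq> last p" using True dp p s by auto
      moreover have "v \<noteq> hd p" using True dp p s by (cases s1) auto
      ultimately have "v \<noteq> z \<and> \<not> E v z" if "z \<in> set q \<union> set r" for z
        using prism_not_adjacent_inner[OF m(1)] that by blast
      moreover have "r \<noteq> []" using m(1) unfolding prism_def by auto
      then have "K \<subseteq> set q \<union> set r" unfolding K by auto
      ultimately show ?thesis using E_sym by blast
    next
      case False
      then show ?thesis using v B(5) by auto
    qed
  qed (use B in auto)
  from short[OF this] have len: "length R0 + 1 \<le> length s2" by simp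
  define p' where "p' = s1 @ R0 @ [y] @ t"
  have "successively E t" "successively E s1" "s1 \<noteq> [] \<longrightarrow> E (last s1) g"
    using sp by (auto simp: successively_append_iff successively_Cons)
  then have W: "successively E p'"
    using R0 unfolding p'_def successively_append_iff by auto
  have hd: "hd p' = hd p" unfolding p'_def p s using R0 by (cases s1) auto
  have lt: "last p' = last p" unfolding p'_def p using p(3) by simp
  have "length p' = length p"
  proof (rule replace_path(2)[OF M W _ hd lt])
    show "p' \<noteq> []" by (simp add: p'_def)
    fix x z assume x: "x \<in> set p'" "x \<noteq> hd p" "x \<noteq> last p" "z \<in> set q \<union> set r"
    have "set R0 \<subseteq> insert g (set (tl R0))" using R0 by (cases R0) auto
    then consider "x \<in> set p" | "x \<in> set (tl R0 @ [y])" using x(1) unfolding p'_def p s by auto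
    then show "x \<noteq> z \<and> \<not> E x z"
      using prism_not_adjacent_inner[OF m(1) _ x(2-4)] free x(4) by cases blast+
  next
    show "length p' \<le> length p" using len unfolding p'_def p s by simp
  qed
  then show False using len unfolding p'_def p s by simp
qed

text \<open>Here \<open>p\<close> is the path being replaced, \<open>q\<close> the path already
  fixed, and \<open>r\<close> the unknown one of which only the corners are blocked. A rung can only
  go to \<open>r\<close>, and of the alternatives in \<open>minimal_rung_bound\<close> only
  \<open>|q| <= |Q|\<close> survives; it brings that \<open>Q\<close> has two vertices and cuts
  \<open>p\<close> after an odd number of vertices. The walk must use two such rungs: at different
  edges they enclose an even piece of \<open>p\<close>, at the same edge they allow a
  shortcut.\<close>

lemma no_rung_in_second_path:
  assumes M: "minimal_odd p q r" and le: "length p \<le> length r"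
    and K: "K = set q \<union> {hd r, last r}"
    and R: "shortest E K g h R" and R': "R = g # I @ [h]" and gh: "g \<in> set p" "h \<in> set p"
    and small: "2 * length I < length p"
  shows "\<forall>x \<in> set I. \<forall>z \<in> set r. \<not> E x z"
proof (rule ccontr)
  assume "\<not> ?thesis"
  then have ex: "\<exists>x \<in> set I. \<exists>z \<in> set r \<union> set q. E x z" by blast
  note m = minimal_oddD[OF M]
  have P: "prism E p r q" and M': "minimal_odd p r q"
    using prism_perm(2)[OF m(1)] minimal_odd_sym(2)[OF M] by auto
  have P': "chordless E p" "chordless E q" "chordless E r" "2 \<le> length p" "2 \<le> length q" "2 \<le> length r"
    "ladder E p q" "ladder E p r" "ladder E q r"
    using m(1) unfolding prism_def by auto
  have q0: "q \<noteq> []" "r \<noteq> []" using P' by auto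
  have cR: "chordless E (g # I @ [h])" using shortest_chordless[OF R] R' by simp
  have dR: "distinct (g # I @ [h])" using chordless_distinct[OF cR] .
  have IK: "x \<noteq> z \<and> \<not> E x z" if "x \<in> set I" "z \<in> K" for x z
  proof -
    have "x \<noteq> g" "x \<noteq> h" "x \<in> set R" using that dR R' by auto
    then show ?thesis using R that E_sym unfolding shortest_def reachable_walk_def by blast
  qed
  have Iq: "x \<noteq> z \<and> \<not> E x z" if "x \<in> set I" "z \<in> set q" for x z
    using IK[of x z] that K by auto
  have corners: "x \<noteq> z \<and> \<not> E x z" if "x \<in> set I" "z \<in> {hd r, hd q, last r, last q}" for x z
    using IK[of x z] that K q0 by auto
  obtain A Q B k k' s t u v where I: "I = A @ Q @ B" and rung': "rung_of p k k' Q s t u v"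
    and k: "k = r \<and> k' = q \<or> k = q \<and> k' = r" and uv: "2 \<le> length u" "2 \<le> length v"
    and A: "\<And>x z. x \<in> set A \<Longrightarrow> z \<in> set r \<union> set q \<Longrightarrow> \<not> E x z"
    by (rule first_rung[OF P cR gh corners ex]) (assumption | rule that)+
  have kr: "k = r" "k' = q"
  proof -
    have "E (last Q) (last u)" "last u \<in> set k" "last Q \<in> set I"
      using rung' I unfolding rung_of_def by auto
    then show "k = r" "k' = q" using Iq k by blast+
  qed
  have rg: "rung_of p r q Q s t u v" using rung' kr by simp
  note C = rung_path[OF P rg]
  have bd: "2 \<le> length Q \<and> odd (length s)"
    using minimal_rung_bound[OF M' rg uv] small le I by auto
  (* Q is a rung from p to r that ends in x. The shortest path returns to p for the first time in y;
     x' is the last vertex before y with a neighbour in r. *)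
  define x where "x = last Q"
  have xQ: "x \<in> set Q" "x \<in> set I" "x \<noteq> hd Q"
    using C bd chordless_ends_neq[of Q] I by (auto simp: x_def)
  have Qp: "E w z \<longleftrightarrow> w = hd Q \<and> (z = last s \<or> z = hd t)" if "w \<in> set Q" "z \<in> set p" for w z
    using rg that unfolding rung_of_def by blast
  have Qr: "w = x" if "w \<in> set Q" "z \<in> set r" "E w z" for w z
    using rg that unfolding rung_of_def x_def by blast
  have xp: "\<not> E x z" if "z \<in> set p" for z using Qp[of x z] that xQ by auto
  have xr: "\<exists>z \<in> set r. E x z"
  proof -
    have "E x (last u)" "last u \<in> set r" using rg unfolding rung_of_def x_def by auto
    then show ?thesis by blast
  qed
  have sR: "successively E ((g # A) @ Q @ B @ [h])" using chordless_successively[OF cR] I by simp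
  then have sB: "successively E (B @ [h])" "E x (hd (B @ [h]))"
    and sQ: "successively E ((g # A) @ Q)"
    using C unfolding x_def successively_append_iff by auto
  \<comment> \<open>\<open>x\<close> is not the first vertex of its rung, so it does not see
    \<open>p\<close>, and the walk cannot step from it to \<open>h\<close>.\<close>
  have B0: "B \<noteq> []" using sB(2) xp[OF gh(2)] by auto
  have "\<exists>w \<in> set B. \<exists>z \<in> set p. E w z"
    using sB(1) B0 gh(2) last_in_set[OF B0] unfolding successively_append_iff by auto
  from split_list_first_propE[OF this] obtain D y B2
    where B: "B = D @ y # B2" and y: "\<exists>z \<in> set p. E y z"
      and D: "\<forall>w \<in> set D. \<not> (\<exists>z \<in> set p. E w z)" by metis
  have "\<exists>w \<in> set (x # D @ [y]). \<exists>z \<in> set r. E w z" using xr by simp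
  from split_list_last_propE[OF this] obtain F x' G
    where FG: "x # D @ [y] = F @ x' # G" and x': "\<exists>z \<in> set r. E x' z"
      and G: "\<forall>w \<in> set G. \<not> (\<exists>z \<in> set r. E w z)" by metis
  \<comment> \<open>Read from \<open>y\<close> to \<open>x'\<close>, the stretch is oriented like
    \<open>Q\<close>, from \<open>p\<close> to \<open>r\<close>.\<close>
  define Q' where "Q' = rev (x' # G)"
  have lG: "last (x' # G) = y" using arg_cong[OF FG, of last] by simp
  have Q'0: "Q' \<noteq> []" "hd Q' = y" "last Q' = x'"
    using lG hd_rev[of "x' # G"] last_rev[of "x' # G"] by (simp_all add: Q'_def del: last.simps rev.simps)
  have Q'I: "set Q' \<subseteq> insert x (insert y (set D))" "y \<in> set I" "set Q' \<subseteq> set I"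
    using arg_cong[OF FG, of set] I B xQ(2) by (auto simp: Q'_def)
  have "chordless E (butlast Q @ (x # D @ [y]) @ B2)"
  proof -
    have "chordless E ((g # A) @ (Q @ B) @ [h])" using cR I by simp
    then have "chordless E (Q @ B)" using chordless_suffix chordless_prefix by blast
    moreover have "Q = butlast Q @ [x]" using C by (simp add: x_def)
    ultimately show ?thesis using B by (metis append.assoc append_Cons append_Nil)
  qed
  then have "chordless E ((x # D @ [y]) @ B2)" by (rule chordless_suffix)
  then have cxD: "chordless E (x # D @ [y])" by (rule chordless_prefix)
  then have "chordless E (F @ x' # G)" using FG by simp
  then have cG: "chordless E (x' # G)" by (rule chordless_suffix)
  then have cQ': "chordless E Q'" by (simp add: Q'_def del: rev.simps)
  have near: "w = hd Q'" if "w \<in> set Q'" "z \<in> set p" "E w z" for w z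
    using that Q'I D xp Q'0 by blast
  have far: "w = last Q'" if "w \<in> set Q'" "z \<in> set r \<union> set q" "E w z" for w z
  proof -
    have "z \<in> set r" using Iq[of w z] that Q'I by blast
    then show ?thesis using that G Q'0 by (auto simp: Q'_def)
  qed
  have dis: "w \<noteq> z" if w: "w \<in> set Q'" and z: "z \<in> set p \<union> set r \<union> set q" for w z
  proof
    assume [simp]: "w = z"
    have wI: "w \<in> set I" using w Q'I by auto
    consider "w \<in> set p" | "w \<in> set r" | "w \<in> set q" using z by auto
    then show False
    proof cases
      case 1
      then obtain z' where "z' \<in> set p" "E w z'" using neighbour_in_path P' by blast
      then have wy: "w = y" using near w Q'0 by auto
      have "successively E ((x # D) @ [y])" using chordless_successively[OF cxD] by simp
      then have "E (last (x # D)) y" unfolding successively_append_iff by simp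
      moreover have "last (x # D) \<in> set (x # D)" by simp
      ultimately show False using xp D 1 wy by (metis set_ConsD)
    next
      case 2
      then obtain z' where z': "z' \<in> set r" "E w z'" using neighbour_in_path P' by blast
      then have wx: "w = x'" using far w Q'0 by auto
      show False
      proof (cases G)
        case Nil
        then have "x' = y" using lG by simp
        then obtain z where "z \<in> set p" "E z x'" using y E_sym by blast
        moreover have "x' \<in> set r \<union> set q" using 2 wx by simp
        moreover have "x' \<notin> {hd r, hd q, last r, last q}" using corners[OF wI] wx by blast
        ultimately show False using prism_not_adjacent_corner[OF P] by blast
      next
        case (Cons w' G')
        then have "E x' w'" using chordless_successively[OF cG] by simp
        then show False using G Cons 2 wx E_sym by auto
      qed
    next
      case 3
      then show False using Iq[OF wI] by blast
    qed
  qed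
  have cor: "\<not> E (last Q') z" if "z \<in> {hd r, hd q, last r, last q}" for z
    using corners[of "last Q'" z] that Q'I Q'0 last_in_set[of Q'] by blast
  obtain l l' s' t' u' v' where rgl: "rung_of p l l' Q' s' t' u' v'"
    and l: "l = r \<and> l' = q \<or> l = q \<and> l' = r" and uv': "2 \<le> length u'" "2 \<le> length v'"
    by (rule rung_of_exists[OF P cQ' Q'0(1) dis near _ far _ cor]) (use y x' Q'0 in auto)
  have lr: "l = r" "l' = q"
  proof -
    have "E (last Q') (last u')" "last u' \<in> set l" "last Q' \<in> set I"
      using rgl Q'I unfolding rung_of_def by auto
    then show "l = r" "l' = q" using Iq l by blast+
  qed
  have rg': "rung_of p r q Q' s' t' u' v'" using rgl lr by simp
  note C' = rung_path[OF P rg']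
  have "length Q' \<le> length (x # D @ [y])" unfolding FG Q'_def by simp
  also have "\<dots> \<le> length I" using I B bd by simp
  finally have bd': "2 \<le> length Q' \<and> odd (length s')"
    using minimal_rung_bound[OF M' rg' uv'] small le by auto
  \<comment> \<open>The part of the walk from the foot of the first rung to the foot of the second
    one. It lies in \<open>I\<close>, so it has less than half as many vertices as
    \<open>r\<close>.\<close>
  define W where "W = Q @ D @ [y]"
  have IW: "I = A @ W @ B2" using I B by (simp add: W_def)
  have "chordless E ((g # A) @ W @ (B2 @ [h]))" using cR IW by simp
  then have cW: "chordless E W" using chordless_suffix chordless_prefix by blast
  have lW: "2 \<le> length W" "2 * length W < length r" "hd W = hd Q" "last W = y"
    using bd small le IW C by (auto simp: W_def)
  have dW: "distinct (Q @ D @ [y])" using chordless_distinct[OF cW] W_def by simp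
  have hQ: "hd Q \<in> set Q" using C by auto
  have yQ': "y \<in> set Q'" using Q'0 hd_in_set by metis
  have yp: "y \<noteq> z \<and> (E y z \<longleftrightarrow> z = last s' \<or> z = hd t')" if "z \<in> set p" for z
    using rg' yQ' that Q'0 unfolding rung_of_def by blast
  have Wp: "w \<noteq> z \<and> (E w z \<longleftrightarrow>
      w = hd Q \<and> (z = last s \<or> z = hd t) \<or> w = y \<and> (z = last s' \<or> z = hd t'))"
    if w: "w \<in> set W" and z: "z \<in> set p" for w z
  proof -
    consider "w \<in> set Q" | "w \<in> set D" | "w = y" using w W_def by auto
    then show ?thesis
    proof cases
      case 1
      then have "w \<noteq> y" using dW by auto
      moreover have "w \<noteq> z" using rg 1 z unfolding rung_of_def by blast
      ultimately show ?thesis using Qp[OF 1 z] by blast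
    next
      case 2
      then have "w \<noteq> y" "w \<noteq> hd Q" using dW hQ by auto
      moreover have "\<not> E w z" using D 2 z by blast
      moreover have "w \<notin> set p" using neighbour_in_path[OF P'(1,4)] D 2 by blast
      ultimately show ?thesis using z by blast
    next
      case 3
      then have "w \<noteq> hd Q" using dW hQ by auto
      then show ?thesis using yp[OF z] 3 by blast
    qed
  qed
  have Wq: "w \<noteq> z \<and> \<not> E w z" if "w \<in> set W" "z \<in> set q" for w z
    using Iq[of w z] that IW by simp
  consider b where "b \<noteq> []" "s' = s @ b" "t = b @ t'"
    | b where "b \<noteq> []" "s = s' @ b" "t' = b @ t" | "s = s'" "t = t'"
  proof -
    have "s @ t = s' @ t'" using C(3) C'(3) by simp
    then obtain b where "s = s' @ b \<and> b @ t = t' \<or> s @ b = s' \<and> t = b @ t'"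
      unfolding append_eq_append_conv2 by blast
    then show ?thesis using that by (cases "b = []") auto
  qed
  then show False
  proof cases
    case (1 b)
    \<comment> \<open>\<open>s\<close> and \<open>s'\<close> are both odd, so the piece
      \<open>b\<close> between the two edges is even and the new prism is odd. It has
      \<open>|p| + |q| + |W|\<close> vertices, too few since \<open>|W| < |r|\<close>.\<close>
    have "even (length b)" using bd bd' 1 by simp
    moreover have "0 < length b" using 1 by simp
    ultimately have b2: "2 \<le> length b" by presburger
    have "prism E b W (rev s @ q @ rev t')"
    proof (rule two_rungs_prism[OF m(1) _ _ _ b2 cW lW(1) _ Wq])
      show "p = s @ b @ t'" using C(3) 1 by simp
      show "w \<noteq> z \<and> (E w z \<longleftrightarrow>
          w = hd W \<and> (z = last s \<or> z = hd b) \<or> w = last W \<and> (z = last b \<or> z = hd t'))"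
        if "w \<in> set W" "z \<in> set p" for w z
        using Wp[OF that] lW 1 by simp
    qed (use C C' in auto)
    then have "length p + length q + length r \<le> length b + length W + length (rev s @ q @ rev t')"
      by (rule m(5)) (use \<open>even (length b)\<close> in simp)
    then show False using lW C 1 by simp
  next
    case (2 b)
    have "even (length b)" using bd bd' 2 by simp
    moreover have "0 < length b" using 2 by simp
    ultimately have b2: "2 \<le> length b" by presburger
    have hW: "hd (rev W) = y" "last (rev W) = hd Q" using lW(1,3,4) by (auto simp: hd_rev last_rev)
    have "prism E b (rev W) (rev s' @ q @ rev t)"
    proof (rule two_rungs_prism[OF m(1) _ _ _ b2])
      show "p = s' @ b @ t" using C(3) 2 by simp
      show "w \<noteq> z \<and> (E w z \<longleftrightarrow>
          w = hd (rev W) \<and> (z = last s' \<or> z = hd b) \<or> w = last (rev W) \<and> (z = last b \<or> z = hd t))"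
        if "w \<in> set (rev W)" "z \<in> set p" for w z
        using Wp[of w z] that 2 unfolding hW by auto
    qed (use C C' cW lW Wq in auto)
    then have "length p + length q + length r \<le> length b + length (rev W) + length (rev s' @ q @ rev t)"
      by (rule m(5)) (use \<open>even (length b)\<close> in simp)
    then show False using lW C 2 by simp
  next
    case 3
    \<comment> \<open>Both rungs are attached at one edge. In
      \<open>no_second_rung_at_same_edge\<close> the part \<open>g # A\<close> becomes
      \<open>R0\<close>, \<open>hd Q\<close> becomes \<open>y\<close>, and the rest of the walk from
      the present \<open>y\<close> becomes \<open>B\<close>. If \<open>g\<close> lies beyond the
      edge, the prism is reversed.\<close>
    have T1: "successively E ((g # A) @ [hd Q])"
      using sQ C unfolding successively_append_iff by simp
    have T2: "x \<noteq> z \<and> \<not> E x z" if xz: "x \<in> set (tl (g # A) @ [hd Q])" "z \<in> set q \<union> set r" for x z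
    proof (cases "x \<in> set A")
      case True
      then have "\<not> E x z" "x \<notin> set r" using A neighbour_in_path[OF P'(3,6)] xz by blast+
      then show ?thesis using Iq[of x z] True xz I by auto
    next
      case False
      then have x: "x = hd Q" using xz by simp
      have "hd Q \<noteq> last Q" using xQ x_def by simp
      then have "hd Q \<noteq> z \<and> \<not> E (hd Q) z" if "z \<in> set r"
        using rg hQ that unfolding rung_of_def by blast
      then show ?thesis using Iq[of x z] x xz hQ I by auto
    qed
    define B' where "B' = y # B2 @ [h]"
    have "successively E ((g # A @ Q @ D) @ B')"
      using chordless_successively[OF cR] IW by (simp add: W_def B'_def)
    then have T3: "successively E B'" unfolding successively_append_iff by blast
    have T4: "v = h \<or> (\<forall>k \<in> K. v \<noteq> k \<and> \<not> E k v)" if "v \<in> set B'" for v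
      using that IK[of v] E_sym IW unfolding B'_def W_def by auto
    have T5: "length (g # A) + 2 + length B' \<le> length R''" if "reachable_walk E K g h R''" for R''
    proof -
      have "length R \<le> length R''" using R that unfolding shortest_def by blast
      then show ?thesis using R' I B bd by (simp add: B'_def)
    qed
    have e: "last s \<in> set p" "hd t \<in> set p" using C by auto
    have T6: "E (last s) (hd B')" "E (hd t) (hd B')"
      using yp[OF e(1)] yp[OF e(2)] 3 E_sym unfolding B'_def by auto
    have T7: "E (hd Q) (hd t)" "E (hd Q) (last s)" using Qp[OF hQ] e by auto
    have B'0: "B' \<noteq> []" "last B' = h" by (auto simp: B'_def)
    show False
    proof (cases "g \<in> set s")
      case True
      show False
        by (rule no_second_rung_at_same_edge[OF M C(3,5,6) True T1 _ _ T7(1) T2 T3 B'0 T6(1) T4 K T5]) auto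
    next
      case False
      then have g: "g \<in> set (rev t)" using gh C by auto
      have pr: "rev p = rev t @ rev s" using C by simp
      have Kr: "K = set (rev q) \<union> {hd (rev r), last (rev r)}"
        unfolding K using q0 by (auto simp: hd_rev last_rev)
      have h: "E (hd Q) (hd (rev s))" "E (last (rev t)) (hd B')"
        using T7 T6 C by (auto simp: hd_rev last_rev)
      show False
        by (rule no_second_rung_at_same_edge[OF minimal_odd_sym(3)[OF M] pr _ _ g T1 _ _ h(1) _ T3 B'0 h(2) T4 Kr T5])
          (use C T2 in auto)
    qed
  qed
qed

text \<open>The first alternative for \<open>K\<close> serves for the first path, when the other two are still unknown
  except for their corners; the second one for the second path, when \<open>q\<close> is known.\<close>

lemma replace_segment:
  assumes M: "minimal_odd p q r" and le: "length p \<le> length r"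
    and K: "K = {hd q, hd r, last q, last r} \<and> length p \<le> length q \<or> K = set q \<union> {hd r, last r}"
    and p: "p = x1 @ S @ x2" "S \<noteq> []" and small: "2 * length S < length p + 4"
  shows "reachable_walk E K (hd S) (last S) S"
    and "shortest E K (hd S) (last S) R \<Longrightarrow> minimal_odd (x1 @ R @ x2) q r \<and> length R = length S"
proof -
  note m = minimal_oddD[OF M]
  have P': "chordless E p" "chordless E q" "chordless E r" "2 \<le> length p" "2 \<le> length q" "2 \<le> length r"
    using m(1) unfolding prism_def by auto
  have ne: "q \<noteq> []" "r \<noteq> []" using P' by auto
  have dp: "distinct p" using chordless_distinct[OF P'(1)] .
  have Kqr: "K \<subseteq> set q \<union> set r" using K ne by auto
  have sp: "successively E (x1 @ S @ x2)" using chordless_successively[OF P'(1)] p by simp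
  have inner: "w \<noteq> hd p \<and> w \<noteq> last p" if "w \<in> set S" "w \<noteq> hd S" "w \<noteq> last S" for w
  proof -
    have "hd p \<in> set x1 \<or> hd p = hd S" using p by (cases x1) auto
    moreover have "last p \<in> set x2 \<or> last p = last S" using p by (cases x2 rule: rev_cases) auto
    ultimately show ?thesis using that dp p by auto
  qed
  show walk: "reachable_walk E K (hd S) (last S) S"
    unfolding reachable_walk_def
  proof (intro conjI ballI)
    show "successively E S" using sp unfolding successively_append_iff by blast
    fix v assume v: "v \<in> set S"
    show "v = hd S \<or> v = last S \<or> (\<forall>k \<in> K. v \<noteq> k \<and> \<not> E k v)"
    proof (cases "v = hd S \<or> v = last S")
      case False
      then have "v \<noteq> z \<and> \<not> E v z" if "z \<in> set q \<union> set r" for z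
        using prism_not_adjacent_inner[OF m(1) _ _ _ that] inner[OF v] v p by auto
      then show ?thesis using Kqr E_sym by blast
    qed blast
  qed (use p in auto)
  assume R: "shortest E K (hd S) (last S) R"
  then have lR: "length R \<le> length S" using walk unfolding shortest_def by blast
  have Rw: "successively E R" "R \<noteq> []" "hd R = hd S" "last R = last S"
    "\<And>v. v \<in> set R \<Longrightarrow> v = hd S \<or> v = last S \<or> (\<forall>k \<in> K. v \<noteq> k \<and> \<not> E k v)"
    using R unfolding shortest_def reachable_walk_def by auto
  have free: "x \<noteq> z \<and> \<not> E x z"
    if x: "x \<in> set R" "x \<noteq> hd S" "x \<noteq> last S" and z: "z \<in> set q \<union> set r" for x z
  proof -
    obtain a R1 where a: "R = a # R1" using Rw by (cases R) auto
    then have "R1 \<noteq> []" using x Rw by auto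
    then obtain I b where "R1 = I @ [b]" by (cases R1 rule: rev_cases) auto
    then have RI: "R = hd S # I @ [last S]" using a Rw by auto
    have xI: "x \<in> set I" using x RI by auto
    \<comment> \<open>Removing the two ends turns the bound \<open>|p| + 4\<close> for
      \<open>S\<close> into \<open>|p|\<close> for the inner vertices.\<close>
    have smI: "2 * length I < length p" using lR small RI by simp
    have gh: "hd S \<in> set p" "last S \<in> set p" using p by auto
    have cR: "chordless E (hd S # I @ [last S])" using shortest_chordless[OF R] RI by simp
    have dR: "distinct (hd S # I @ [last S])" using chordless_distinct[OF cR] .
    have IK: "w \<noteq> k \<and> \<not> E w k" if "w \<in> set I" "k \<in> K" for w k
    proof -
      have "w \<noteq> hd S" "w \<noteq> last S" "w \<in> set R" using that dR RI by auto
      then show ?thesis using Rw(5) that E_sym by blast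
    qed
    have no: "\<not> E w k" if "w \<in> set I" "k \<in> set q \<union> set r" for w k
      using K
    proof
      assume 1: "K = {hd q, hd r, last q, last r} \<and> length p \<le> length q"
      show ?thesis
      proof
        assume "E w k"
        then have ex: "\<exists>x \<in> set I. \<exists>z \<in> set q \<union> set r. E x z" using that by blast
        obtain A Q B k k' s t u v where I: "I = A @ Q @ B" and rg: "rung_of p k k' Q s t u v"
          and k: "k = q \<and> k' = r \<or> k = r \<and> k' = q" and uv: "2 \<le> length u" "2 \<le> length v"
          by (rule first_rung[OF m(1) cR gh _ ex]) (assumption | rule that | use IK 1 in blast)+
        have "minimal_odd p k k'" using k M minimal_odd_sym(2)[OF M] by auto
        \<comment> \<open>Since \<open>2|Q| <= 2|I| < |p|\<close> and \<open>p\<close> is not longer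
          than \<open>q\<close> or \<open>r\<close>, all three alternatives fail.\<close>
        from minimal_rung_bound[OF this rg uv] show False using smI I k 1 le by auto
      qed
    next
      assume 2: "K = set q \<union> {hd r, last r}"
      show ?thesis
        using no_rung_in_second_path[OF M le 2 R RI gh smI] IK[of w k] that 2 by blast
    qed
    moreover have "x \<notin> set q \<union> set r"
      using no[OF xI] neighbour_in_path P' by blast
    ultimately show ?thesis using xI z by blast
  qed
  define p' where "p' = x1 @ R @ x2"
  have "successively E p'"
    using sp p(2) Rw unfolding p'_def successively_append_iff by auto
  moreover have "p' \<noteq> []" "hd p' = hd p" "last p' = last p"
    using Rw(2-4) p(2) unfolding p(1) p'_def by (simp_all add: hd_append last_append)
  moreover have "x \<noteq> z \<and> \<not> E x z"
    if "x \<in> set p'" "x \<noteq> hd p" "x \<noteq> last p" "z \<in> set q \<union> set r" for x z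
  proof (cases "x \<in> set p")
    case True
    then show ?thesis using prism_not_adjacent_inner[OF m(1)] that by blast
  next
    case False
    then have "x \<in> set R" "x \<noteq> hd S" "x \<noteq> last S" using that(1) p by (auto simp: p'_def)
    then show ?thesis using free that by blast
  qed
  moreover have "length p' \<le> length p" using lR p by (simp add: p'_def)
  ultimately have "minimal_odd p' q r" "length p' = length p"
    using replace_path[OF M] by blast+
  then show "minimal_odd (x1 @ R @ x2) q r \<and> length R = length S" using p by (simp add: p'_def)
qed

text \<open>With \<open>c = length p div 2\<close> the halves have \<open>c + 1\<close> and
  \<open>c\<close> vertices, counting the midpoint in both, and satisfy the bound of
  \<open>replace_segment\<close>. The second half is exchanged in the prism that results from the
  first exchange; its length is unchanged, so the hypotheses carry over. Existence of walks is
  recorded because a search guarantees something only if a walk exists.\<close>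

lemma replace_halves:
  assumes M: "minimal_odd p q r" and le: "length p \<le> length r"
    and K: "K = {hd q, hd r, last q, last r} \<and> length p \<le> length q \<or> K = set q \<union> {hd r, last r}"
    and mid: "mid = p ! (length p div 2)"
  shows "\<exists>R. reachable_walk E K (hd p) mid R"
    and "shortest E K (hd p) mid R1 \<Longrightarrow> \<exists>R. reachable_walk E K mid (last p) R"
    and "shortest E K (hd p) mid R1 \<Longrightarrow> shortest E K mid (last p) R2 \<Longrightarrow>
      minimal_odd (butlast R1 @ R2) q r \<and> length (butlast R1 @ R2) = length p"
proof -
  note m = minimal_oddD[OF M]
  define c where "c = length p div 2"
  have c: "length p = 2 * c" "1 \<le> c"
    using m(1,2) unfolding prism_def c_def by auto
  define y x2 where "y = take c p" and "x2 = drop (Suc c) p"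
  have p: "p = y @ mid # x2" 
    unfolding y_def x2_def mid c_def[symmetric] by (rule id_take_nth_drop) (use c in simp)
  have len: "length y = c" "length x2 = c - 1" using c by (auto simp: y_def x2_def)
  have y0: "y \<noteq> []" using len c by auto
  have S1: "p = [] @ (y @ [mid]) @ x2" "y @ [mid] \<noteq> []" "hd (y @ [mid]) = hd p" "last (y @ [mid]) = mid"
    using p y0 by (simp_all add: arg_cong[OF p, of hd])
  have sm1: "2 * length (y @ [mid]) < length p + 4" using len c by simp
  note A = replace_segment[OF M le K S1(1,2) sm1, unfolded S1(3,4)]
  show "\<exists>R. reachable_walk E K (hd p) mid R" using A(1) by blast
  assume R1: "shortest E K (hd p) mid R1"
  then have M1: "minimal_odd (R1 @ x2) q r" and l1: "length R1 = c + 1" using A(2)[OF R1] len by auto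
  have e: "R1 \<noteq> []" "last R1 = mid" "hd R1 = hd p"
    using R1 unfolding shortest_def reachable_walk_def by auto
  then have R1': "R1 = butlast R1 @ [mid]" by (metis append_butlast_last_id)
  have S2: "R1 @ x2 = butlast R1 @ (mid # x2) @ []" "mid # x2 \<noteq> []" "hd (mid # x2) = mid" "last (mid # x2) = last p"
    using arg_cong[OF R1', of "\<lambda>l. l @ x2"] by (simp_all add: arg_cong[OF p, of last])
  have l2: "length (R1 @ x2) = length p" using l1 len c by simp
  have sm2: "2 * length (mid # x2) < length (R1 @ x2) + 4" using l2 len c by simp
  note B = replace_segment[OF M1 _ _ S2(1,2) sm2, unfolded S2(3,4) l2, OF le K]
  show "\<exists>R. reachable_walk E K mid (last p) R" using B(1) by blast
  assume R2: "shortest E K mid (last p) R2"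
  show "minimal_odd (butlast R1 @ R2) q r \<and> length (butlast R1 @ R2) = length p"
    using B(2)[OF R2] l1 l2 len by simp
qed

text \<open>With all of \<open>p\<close> and \<open>q\<close> blocked, a chordless path between the
  corners of \<open>r\<close> has exactly the adjacencies of a third path; nothing unknown is left
  that it could meet.\<close>

lemma replace_third:
  assumes P: "prism E p q r" and K: "K = set p \<union> set q"
  shows "reachable_walk E K (hd r) (last r) r"
    and "shortest E K (hd r) (last r) R \<Longrightarrow> prism E p q R"
proof -
  have P': "chordless E r" "2 \<le> length r" "ladder E p r" "ladder E q r"
    using P unfolding prism_def by auto
  note P2 = prism_perm(4)[OF P]
  have hl: "hd r \<noteq> last r" "hd r \<in> set r" "last r \<in> set r"
    using chordless_ends_neq[OF P'(1,2)] P'(2) by (cases r; auto)+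
  show "reachable_walk E K (hd r) (last r) r"
    unfolding reachable_walk_def
  proof (intro conjI ballI)
    show "successively E r" using chordless_successively[OF P'(1)] .
    fix v assume v: "v \<in> set r"
    show "v = hd r \<or> v = last r \<or> (\<forall>k \<in> K. v \<noteq> k \<and> \<not> E k v)"
      using prism_not_adjacent_inner[OF P2 v] K E_sym by blast
  qed (use hl in auto)
  assume R: "shortest E K (hd r) (last r) R"
  then have cR: "chordless E R" by (rule shortest_chordless)
  have Rw: "R \<noteq> []" "hd R = hd r" "last R = last r"
    "\<And>v. v \<in> set R \<Longrightarrow> v = hd r \<or> v = last r \<or> (\<forall>k \<in> K. v \<noteq> k \<and> \<not> E k v)"
    using R unfolding shortest_def reachable_walk_def by auto
  have lad: "ladder E k R" if k: "ladder E k r" "set k \<subseteq> K" for k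
  proof (rule ladderI[of _ "hd k" _ "hd r" "last k" "last r"])
    fix a b assume ab: "a \<in> set k" "b \<in> set R"
    show "a \<noteq> b \<and> (E a b \<longleftrightarrow> a = hd k \<and> b = hd r \<or> a = last k \<and> b = last r)"
    proof (cases "b = hd r \<or> b = last r")
      case True
      then have "b \<in> set r" using hl by auto
      then show ?thesis using k ab unfolding ladder_def by blast
    next
      case False
      then show ?thesis using Rw(4)[OF ab(2)] ab k by auto
    qed
  qed (use Rw in auto)
  have "2 \<le> length R" using Rw hl by (cases R; cases "tl R") auto
  then show "prism E p q R" using P cR lad P' K unfolding prism_def by auto
qed

text \<open>Minimality is symmetric in the paths, so they can be sorted by length; the first two
  replacements rely on this order.\<close>

lemma minimal_odd_exists:
  assumes "prism E p q r" "even (length p)"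
  obtains p' q' r' where "minimal_odd p' q' r'" "length p' \<le> length q'" "length q' \<le> length r'"
proof -
  let ?P = "\<lambda>(p, q, r). prism E p q r \<and> even (length p)"
  let ?f = "\<lambda>(p :: 'a list, q :: 'a list, r :: 'a list). length p + length q + length r"
  obtain x where x: "?P x" "\<And>y. ?P y \<Longrightarrow> ?f x \<le> ?f y"
    using ex_has_least_nat[of ?P "(p, q, r)" ?f] assms by auto
  obtain a b c where abc: "x = (a, b, c)" by (cases x)
  have M: "minimal_odd a b c"
    unfolding minimal_odd_def using x(1) x(2)[of "(_, _, _)"] abc by auto
  note S = minimal_odd_sym(1,2)
  consider "length a \<le> length b" "length b \<le> length c" | "length a \<le> length c" "length c \<le> length b"
    | "length b \<le> length a" "length a \<le> length c" | "length b \<le> length c" "length c \<le> length a"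
    | "length c \<le> length a" "length a \<le> length b" | "length c \<le> length b" "length b \<le> length a"
    by linarith
  then show ?thesis
    using that M S(2)[OF M] S(1)[OF M] S(2)[OF S(1)[OF M]] S(1)[OF S(2)[OF M]] S(1)[OF S(2)[OF S(1)[OF M]]]
    by cases blast+
qed

end

section \<open>Reasoning about programs\<close>

fun written_regs :: "com \<Rightarrow> nat set" where
  "written_regs Skip = {}"
| "written_regs (Assign x e) = {x}"
| "written_regs (Store a e f) = {}"
| "written_regs (Seq c d) = written_regs c \<union> written_regs d"
| "written_regs (If b c d) = written_regs c \<union> written_regs d"
| "written_regs (While b c) = written_regs c"

fun written_arrs :: "com \<Rightarrow> nat set" where
  "written_arrs Skip = {}"
| "written_arrs (Assign x e) = {}"
| "written_arrs (Store a e f) = {a}"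
| "written_arrs (Seq c d) = written_arrs c \<union> written_arrs d"
| "written_arrs (If b c d) = written_arrs c \<union> written_arrs d"
| "written_arrs (While b c) = written_arrs c"

definition agree_off :: "nat set \<Rightarrow> nat set \<Rightarrow> state \<Rightarrow> state \<Rightarrow> bool" where
  "agree_off X A s s' \<longleftrightarrow>
     (\<forall>x. x \<notin> X \<longrightarrow> regs s' x = regs s x) \<and> (\<forall>a. a \<notin> A \<longrightarrow> arrs s' a = arrs s a)"

lemma agree_off_trans: "agree_off X A s s' \<Longrightarrow> agree_off X A s' s'' \<Longrightarrow> agree_off X A s s''"
  by (simp add: agree_off_def)

lemma exec_agree_off: "exec W c s t s' \<Longrightarrow> agree_off (written_regs c) (written_arrs c) s s'"
proof (induction rule: exec.induct)
  case (WhileTrue s b c t s' t' s'')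
  then show ?case using agree_off_trans by simp
qed (auto simp: agree_off_def)

text \<open>Total correctness with a time bound. Existence of the execution includes that no stored
  number exceeds \<open>W\<close>; an upper bound instead of the exact time allows branches of
  different cost to be treated alike.\<close>

definition run :: "nat \<Rightarrow> com \<Rightarrow> nat \<Rightarrow> state \<Rightarrow> (state \<Rightarrow> bool) \<Rightarrow> bool" where
  "run W c t s Q \<longleftrightarrow> (\<exists>t' s'. exec W c s t' s' \<and> t' \<le> t \<and> Q s')"

lemma run_mono: "run W c t s Q \<Longrightarrow> t \<le> t' \<Longrightarrow> (\<And>s'. Q s' \<Longrightarrow> Q' s') \<Longrightarrow> run W c t' s Q'"
  unfolding run_def by (meson le_trans)

lemma run_frame:
  "run W c t s Q \<Longrightarrow> run W c t s (\<lambda>s'. Q s' \<and> agree_off (written_regs c) (written_arrs c) s s')"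
  unfolding run_def using exec_agree_off by blast

lemma run_Seq:
  assumes "run W c t s Q" "\<And>s'. Q s' \<Longrightarrow> run W d t' s' Q'" "1 + t + t' \<le> t''"
  shows "run W (Seq c d) t'' s Q'"
proof -
  from assms(1) obtain u s' where u: "exec W c s u s'" "u \<le> t" "Q s'" unfolding run_def by blast
  from assms(2)[OF u(3)] obtain u' s'' where u': "exec W d s' u' s''" "u' \<le> t'" "Q' s''"
    unfolding run_def by blast
  show ?thesis unfolding run_def using exec.Seq[OF u(1) u'(1)] u u' assms(3)
    by (intro exI[of _ "1 + u + u'"] exI[of _ s'']) auto
qed

definition set_reg :: "nat \<Rightarrow> nat \<Rightarrow> state \<Rightarrow> state" where
  "set_reg x v s = s\<lparr>regs := (regs s)(x := v)\<rparr>"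

definition set_arr :: "nat \<Rightarrow> nat \<Rightarrow> nat \<Rightarrow> state \<Rightarrow> state" where
  "set_arr a i v s = s\<lparr>arrs := (arrs s)(a := (arrs s a)(i := v))\<rparr>"

lemma state_upd_simps [simp]:
  "regs (set_reg x v s) y = (if y = x then v else regs s y)"
  "arrs (set_reg x v s) = arrs s"
  "regs (set_arr a i v s) = regs s"
  "arrs (set_arr a i v s) b j = (if b = a \<and> j = i then v else arrs s b j)"
  by (auto simp: set_reg_def set_arr_def)

text \<open>\<open>wp\<close> is false on loops, which are left to \<open>run_For\<close>.\<close>

fun wp :: "nat \<Rightarrow> com \<Rightarrow> state \<Rightarrow> (state \<Rightarrow> bool) \<Rightarrow> bool" where
  "wp W Skip s Q = Q s"
| "wp W (Assign x e) s Q = (aval s e \<le> W \<and> Q (set_reg x (aval s e) s))"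
| "wp W (Store a e f) s Q = (aval s e \<le> W \<and> aval s f \<le> W \<and> Q (set_arr a (aval s e) (aval s f) s))"
| "wp W (Seq c d) s Q = wp W c s (\<lambda>s'. wp W d s' Q)"
| "wp W (If b c d) s Q = (if bval s b then wp W c s Q else wp W d s Q)"
| "wp W (While b c) s Q = False"

text \<open>An upper bound that adds up both branches of a conditional. The value at a loop is a
  dummy, as \<open>wp\<close> is false there.\<close>

fun ccost :: "com \<Rightarrow> nat" where
  "ccost Skip = 1"
| "ccost (Assign x e) = 1 + acost e"
| "ccost (Store a e f) = 1 + acost e + acost f"
| "ccost (Seq c d) = 1 + ccost c + ccost d"
| "ccost (If b c d) = 1 + bcost b + ccost c + ccost d"
| "ccost (While b c) = 0"

lemma run_wp: "wp W c s Q \<Longrightarrow> ccost c \<le> t \<Longrightarrow> run W c t s Q"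
proof (induction c arbitrary: s Q t)
  case Skip
  then show ?case unfolding run_def using exec.Skip[of W s]
    by (intro exI[of _ 1] exI[of _ s]) auto
next
  case (Assign x e)
  then show ?case unfolding run_def using exec.Assign[of s e W x]
    by (intro exI[of _ "1 + acost e"] exI[of _ "set_reg x (aval s e) s"]) (auto simp: set_reg_def)
next
  case (Store a e f)
  then show ?case unfolding run_def using exec.Store[of s e W f a]
    by (intro exI[of _ "1 + acost e + acost f"] exI[of _ "set_arr a (aval s e) (aval s f) s"])
      (auto simp: set_arr_def)
next
  case (Seq c d)
  show ?case
    by (rule run_Seq[OF Seq.IH(1)[OF _ order.refl] Seq.IH(2)[OF _ order.refl]]) (use Seq.prems in auto)
next
  case (If b c d)
  show ?case
  proof (cases "bval s b")
    case True
    then have "run W c (ccost c) s Q" using If by auto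
    then obtain u s' where "exec W c s u s'" "u \<le> ccost c" "Q s'" unfolding run_def by blast
    then show ?thesis unfolding run_def using exec.IfTrue[OF True, of W c u s' d] If.prems(2)
      by (intro exI[of _ "1 + bcost b + u"] exI[of _ s']) auto
  next
    case False
    then have "run W d (ccost d) s Q" using If by auto
    then obtain u s' where "exec W d s u s'" "u \<le> ccost d" "Q s'" unfolding run_def by blast
    then show ?thesis unfolding run_def using exec.IfFalse[OF False, of W d u s' c] If.prems(2)
      by (intro exI[of _ "1 + bcost b + u"] exI[of _ s']) auto
  qed
qed simp

definition For :: "nat \<Rightarrow> aexp \<Rightarrow> com \<Rightarrow> com" where
  "For x e c = Seq (Assign x (Const 0))
     (While (Less (Reg x) e) (Seq c (Assign x (Plus (Reg x) (Const 1)))))"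

lemma written_For [simp]:
  "written_regs (For x e c) = insert x (written_regs c)"
  "written_arrs (For x e c) = written_arrs c"
  by (auto simp: For_def)

text \<open>\<open>J i\<close> holds when the counter is \<open>i\<close>. What the body never
  writes is known from \<open>agree_off\<close> and stays out of the invariant. The bound
  \<open>e\<close> is evaluated at every test, so it must keep the value \<open>N\<close>. A round
  costs \<open>8 + acost e\<close> for test, sequencing and increment; \<open>6 + acost e\<close>
  pays for the initialisation and the failing test.\<close>

lemma run_For:
  assumes x: "x \<notin> written_regs c"
    and J0: "J 0 (set_reg x 0 s)"
    and N: "\<And>i s'. i \<le> N \<Longrightarrow> J i s' \<Longrightarrow> regs s' x = i \<Longrightarrow>
      agree_off (insert x (written_regs c)) (written_arrs c) s s' \<Longrightarrow> aval s' e = N"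
    and step: "\<And>i s'. i < N \<Longrightarrow> J i s' \<Longrightarrow> regs s' x = i \<Longrightarrow>
      agree_off (insert x (written_regs c)) (written_arrs c) s s' \<Longrightarrow>
      run W c T s' (\<lambda>s''. J (Suc i) (set_reg x (Suc i) s''))"
    and W: "N \<le> W"
    and t: "6 + acost e + N * (8 + acost e + T) \<le> t"
    and Q: "\<And>s'. J N s' \<Longrightarrow> regs s' x = N \<Longrightarrow>
      agree_off (insert x (written_regs c)) (written_arrs c) s s' \<Longrightarrow> Q s'"
  shows "run W (For x e c) t s Q"
proof -
  let ?A = "agree_off (insert x (written_regs c)) (written_arrs c)"
  let ?w = "While (Less (Reg x) e) (Seq c (Assign x (Plus (Reg x) (Const 1))))"
  have loop: "\<exists>u s''. exec W ?w s' u s'' \<and> u \<le> 3 + acost e + k * (8 + acost e + T) \<and> Q s''"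
    if "k = N - i" "i \<le> N" "J i s'" "regs s' x = i" "?A s s'" for k i s'
    using that
  proof (induction k arbitrary: i s')
    case 0
    then have i: "i = N" by simp
    have "\<not> bval s' (Less (Reg x) e)" using N[OF 0(2-5)] 0 i by simp
    from exec.WhileFalse[OF this] have "exec W ?w s' (3 + acost e) s'"
      by (simp add: numeral_3_eq_3)
    moreover have "Q s'" using Q[of s'] 0 i by simp
    ultimately show ?case by auto
  next
    case (Suc k)
    then have i: "i < N" by simp
    have b: "bval s' (Less (Reg x) e)" using N[OF Suc(3-6)] Suc i by simp
    from step[OF i Suc(4-6)] obtain u s1 where u: "exec W c s' u s1" "u \<le> T"
      "J (Suc i) (set_reg x (Suc i) s1)" unfolding run_def by blast
    have a1: "agree_off (written_regs c) (written_arrs c) s' s1" using exec_agree_off[OF u(1)] .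
    then have x1: "regs s1 x = i" using x Suc by (simp add: agree_off_def)
    have "exec W (Assign x (Plus (Reg x) (Const 1))) s1 4 (set_reg x (Suc i) s1)"
      using exec.Assign[of s1 "Plus (Reg x) (Const 1)" W x] x1 i W by (simp add: set_reg_def eval_nat_numeral)
    from exec.Seq[OF u(1) this]
    have e1: "exec W (Seq c (Assign x (Plus (Reg x) (Const 1)))) s' (1 + u + 4) (set_reg x (Suc i) s1)" .
    have "?A s (set_reg x (Suc i) s1)"
      using Suc(6) a1 by (auto simp: agree_off_def)
    moreover have "k = N - Suc i" "Suc i \<le> N" using Suc(2) i by auto
    ultimately obtain v s2 where
      v: "exec W ?w (set_reg x (Suc i) s1) v s2" "v \<le> 3 + acost e + k * (8 + acost e + T)" "Q s2"
      using Suc.IH[OF _ _ u(3)] by fastforce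
    from exec.WhileTrue[OF b e1 v(1)] show ?case
      using v u(2) by (intro exI[of _ "1 + bcost (Less (Reg x) e) + (1 + u + 4) + v"] exI[of _ s2]) auto
  qed
  have e0: "exec W (Assign x (Const 0)) s 2 (set_reg x 0 s)"
    using exec.Assign[of s "Const 0" W x] by (simp add: set_reg_def eval_nat_numeral)
  from loop[of N 0 "set_reg x 0 s"] J0 obtain u s'' where
    u: "exec W ?w (set_reg x 0 s) u s''" "u \<le> 3 + acost e + N * (8 + acost e + T)" "Q s''"
    by (auto simp: agree_off_def)
  from exec.Seq[OF e0 u(1)] show ?thesis
    unfolding run_def For_def using u t by (intro exI[of _ "1 + 2 + u"] exI[of _ s'']) auto
qed

section \<open>Breadth-first search\<close>

text \<open>There is a walk from \<open>u\<close> to the target \<open>t\<close> with at most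
  \<open>j\<close> vertices, all allowed by \<open>A\<close> except possibly \<open>t\<close>. Level
  \<open>0\<close> is empty because vertices are counted.\<close>

fun reaches :: "('a \<Rightarrow> 'a \<Rightarrow> bool) \<Rightarrow> ('a \<Rightarrow> bool) \<Rightarrow> 'a \<Rightarrow> nat \<Rightarrow> 'a \<Rightarrow> bool" where
  "reaches E A t 0 u = False"
| "reaches E A t (Suc j) u \<longleftrightarrow> u = t \<or> reaches E A t j u \<or> A u \<and> (\<exists>v. E u v \<and> reaches E A t j v)"

text \<open>Labels are numbers of vertices, not of edges, so that 0 is free to mean unreached.\<close>

definition bfs_label :: "('a \<Rightarrow> 'a \<Rightarrow> bool) \<Rightarrow> ('a \<Rightarrow> bool) \<Rightarrow> 'a \<Rightarrow> nat \<Rightarrow> 'a \<Rightarrow> nat" where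
  "bfs_label E A t j u = (if reaches E A t j u then LEAST i. reaches E A t i u else 0)"

lemma reaches_mono: "reaches E A t i u \<Longrightarrow> i \<le> j \<Longrightarrow> reaches E A t j u"
proof (induction j)
  case 0
  then show ?case by simp
next
  case (Suc j)
  then show ?case by (cases "i = Suc j") auto
qed

lemma label_eq_Suc_iff:
  "bfs_label E A t j u = Suc i \<longleftrightarrow> reaches E A t j u \<and> reaches E A t (Suc i) u \<and> \<not> reaches E A t i u"
proof
  assume l: "bfs_label E A t j u = Suc i"
  then have w: "reaches E A t j u" unfolding bfs_label_def by (auto split: if_splits)
  then have L: "(LEAST i. reaches E A t i u) = Suc i" using l unfolding bfs_label_def by simp
  have "reaches E A t (Suc i) u" using LeastI[of "\<lambda>i. reaches E A t i u", OF w] unfolding L .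
  moreover have "\<not> reaches E A t i u" using not_less_Least[of i "\<lambda>i. reaches E A t i u"] unfolding L by simp
  ultimately show "reaches E A t j u \<and> reaches E A t (Suc i) u \<and> \<not> reaches E A t i u" using w by simp
next
  assume w: "reaches E A t j u \<and> reaches E A t (Suc i) u \<and> \<not> reaches E A t i u"
  have "(LEAST i. reaches E A t i u) = Suc i"
  proof (rule Least_equality)
    fix y assume "reaches E A t y u"
    then have "\<not> y \<le> i" using reaches_mono[of E A t y u i] w by blast
    then show "Suc i \<le> y" by simp
  qed (use w in blast)
  then show "bfs_label E A t j u = Suc i" using w unfolding bfs_label_def by simp
qed

lemma label_pos_iff: "0 < bfs_label E A t j u \<longleftrightarrow> reaches E A t j u"
proof
  assume w: "reaches E A t j u"
  have "reaches E A t (LEAST i. reaches E A t i u) u" using LeastI[of "\<lambda>i. reaches E A t i u", OF w] .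
  then have "(LEAST i. reaches E A t i u) \<noteq> 0" by (metis reaches.simps(1))
  then show "0 < bfs_label E A t j u" using w unfolding bfs_label_def by simp
qed (auto simp: bfs_label_def split: if_splits)

lemma label_le: "bfs_label E A t j u \<le> j"
  using Least_le[of "\<lambda>i. reaches E A t i u" j] by (auto simp: bfs_label_def)

lemma label_le_walk: "reaches E A t i u \<Longrightarrow> bfs_label E A t j u \<le> i"
  using Least_le[of "\<lambda>i. reaches E A t i u" i] by (auto simp: bfs_label_def)

lemma label_stable: "reaches E A t i u \<Longrightarrow> i \<le> j \<Longrightarrow> bfs_label E A t j u = bfs_label E A t i u"
  using reaches_mono[of E A t i u j] by (simp add: bfs_label_def)

lemma label_1: "bfs_label E A t (Suc 0) u = (if u = t then 1 else 0)"
proof (cases "u = t")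
  case True
  then show ?thesis using label_eq_Suc_iff[of E A t "Suc 0" u 0] by simp
next
  case False
  then show ?thesis using label_pos_iff[of E A t "Suc 0" u] by simp
qed

text \<open>One round of the search as an update of labels. An unlabelled allowed vertex can only
  have neighbours in the newest layer, since an older one would have labelled it in an earlier
  round.\<close>

lemma label_step:
  "bfs_label E A t (Suc (Suc r)) u =
     (if bfs_label E A t (Suc r) u \<noteq> 0 then bfs_label E A t (Suc r) u
      else if A u \<and> (\<exists>v. E u v \<and> bfs_label E A t (Suc r) v = Suc r) then Suc (Suc r) else 0)"
proof (cases "reaches E A t (Suc r) u")
  case True
  then show ?thesis
    using label_stable[OF True, of "Suc (Suc r)"] label_pos_iff[of E A t "Suc r" u] by simp
next
  case False
  then have l0: "bfs_label E A t (Suc r) u = 0" by (simp add: bfs_label_def del: reaches.simps(2))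
  have nt: "u \<noteq> t" "\<not> reaches E A t r u" and na: "\<not> (A u \<and> (\<exists>v. E u v \<and> reaches E A t r v))"
    using False by auto
  have "reaches E A t (Suc (Suc r)) u \<longleftrightarrow> A u \<and> (\<exists>v. E u v \<and> reaches E A t (Suc r) v)"
    using False nt by (subst reaches.simps) blast
  also have "\<dots> \<longleftrightarrow> A u \<and> (\<exists>v. E u v \<and> bfs_label E A t (Suc r) v = Suc r)"
    unfolding label_eq_Suc_iff using na by blast
  finally have w: "reaches E A t (Suc (Suc r)) u \<longleftrightarrow>
    A u \<and> (\<exists>v. E u v \<and> bfs_label E A t (Suc r) v = Suc r)" .
  show ?thesis
  proof (cases "reaches E A t (Suc (Suc r)) u")
    case True
    then have "bfs_label E A t (Suc (Suc r)) u = Suc (Suc r)" using False label_eq_Suc_iff by metis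
    then show ?thesis using l0 w True by (simp del: reaches.simps(2))
  next
    case F: False
    then have "bfs_label E A t (Suc (Suc r)) u = 0"
      using label_pos_iff[of E A t "Suc (Suc r)" u] by (metis neq0_conv)
    then show ?thesis using l0 w F by (simp del: reaches.simps(2))
  qed
qed

lemma label_eq_1: "bfs_label E A t j u = Suc 0 \<Longrightarrow> u = t"
  unfolding label_eq_Suc_iff by simp

text \<open>A shortest walk starts with a step that lowers the label by one, so a path can be read
  off without stored predecessors.\<close>

lemma label_descent:
  assumes "1 < bfs_label E A t j u"
  shows "\<exists>v. E u v \<and> 0 < bfs_label E A t j v \<and> bfs_label E A t j v + 1 = bfs_label E A t j u"
proof -
  obtain i where i: "bfs_label E A t j u = Suc (Suc i)" using assms by (metis One_nat_def less_imp_Suc_add add_Suc)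
  then have w: "reaches E A t j u" "reaches E A t (Suc (Suc i)) u" "\<not> reaches E A t (Suc i) u"
    unfolding label_eq_Suc_iff by auto
  then obtain v where v: "E u v" "reaches E A t (Suc i) v" "A u" by (auto simp: reaches.simps(2)[of _ _ _ "Suc i"])
  have "\<not> reaches E A t i v" using v(1,3) w(3) by auto
  moreover have "Suc i \<le> j" using label_le[of E A t j u] i by simp
  ultimately have "bfs_label E A t j v = Suc i"
    unfolding label_eq_Suc_iff using v(2) reaches_mono[OF v(2)] by blast
  then show ?thesis using v(1) i by auto
qed

lemma label_allowed: "0 < bfs_label E A t j u \<Longrightarrow> u = t \<or> A u"
proof (induction j)
  case (Suc j)
  then show ?case unfolding label_pos_iff by auto
qed (simp add: bfs_label_def)

lemma reaches_walk:
  assumes "successively E w" "w \<noteq> []" "last w = t" "\<And>v. v \<in> set w \<Longrightarrow> v = t \<or> A v"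
  shows "reaches E A t (length w) (hd w)"
  using assms
proof (induction w)
  case (Cons x w)
  show ?case
  proof (cases "w = []")
    case False
    then have "reaches E A t (length w) (hd w)" "E x (hd w)"
      using Cons by (auto simp: successively_Cons)
    then show ?thesis using Cons.prems(4)[of x] by auto
  qed (use Cons in simp)
qed simp

text \<open>Array 1 marks the vertices that a search must avoid, array 2 holds the labels of the search, and
  array 3 the list of vertices found so far, of length register 11. Registers 14 and 15 are
  loop counters, and 16 is the current vertex when a path is read off from the labels.\<close>

definition adj_state :: "nat \<Rightarrow> (nat \<Rightarrow> nat \<Rightarrow> bool) \<Rightarrow> state \<Rightarrow> bool" where
  "adj_state n E s \<longleftrightarrow> regs s 0 = n \<and>
     (\<forall>u < n. \<forall>v < n. arrs s 0 (u * n + v) = (if E u v then 1 else 0))"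

lemma adj_state_agree: "adj_state n E s \<Longrightarrow> agree_off X A s s' \<Longrightarrow> 0 \<notin> X \<Longrightarrow> 0 \<notin> A \<Longrightarrow> adj_state n E s'"
  by (auto simp: adj_state_def agree_off_def)

definition holds :: "state \<Rightarrow> nat list \<Rightarrow> bool" where
  "holds s xs \<longleftrightarrow> (\<forall>j < length xs. arrs s 3 j = xs ! j)"

definition Disj :: "bexp \<Rightarrow> bexp \<Rightarrow> bexp" where
  "Disj b c = Neg (Conj (Neg b) (Neg c))"

lemma bval_Disj [simp]: "bval s (Disj b c) \<longleftrightarrow> bval s b \<or> bval s c"
  by (simp add: Disj_def)

lemma bcost_Disj [simp]: "bcost (Disj b c) = 4 + bcost b + bcost c"
  by (simp add: Disj_def)

definition adj_test :: "aexp \<Rightarrow> aexp \<Rightarrow> bexp" where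
  "adj_test e f = Equal (Read 0 (Plus (Times e (Reg 0)) f)) (Const 1)"

lemma bval_adj_test:
  "adj_state n E s \<Longrightarrow> aval s e < n \<Longrightarrow> aval s f < n \<Longrightarrow>
    bval s (adj_test e f) \<longleftrightarrow> E (aval s e) (aval s f)"
  by (simp add: adj_test_def adj_state_def)

lemma bcost_adj_test [simp]: "bcost (adj_test e f) = 6 + acost e + acost f"
  by (simp add: adj_test_def)

text \<open>The set to be blocked is listed in array 3 below position \<open>hi\<close>; its members
  and their neighbours are marked.\<close>

definition mask :: "aexp \<Rightarrow> com" where
  "mask hi = For 14 (Reg 0) (Seq (Store 1 (Reg 14) (Const 0))
     (For 15 hi (If (Disj (Equal (Read 3 (Reg 15)) (Reg 14)) (adj_test (Read 3 (Reg 15)) (Reg 14)))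
        (Store 1 (Reg 14) (Const 1)) Skip)))"

definition masked :: "nat \<Rightarrow> (nat \<Rightarrow> nat \<Rightarrow> bool) \<Rightarrow> nat set \<Rightarrow> state \<Rightarrow> bool" where
  "masked n E K s \<longleftrightarrow> (\<forall>v < n. arrs s 1 v = (if \<exists>k \<in> K. v = k \<or> E k v then 1 else 0))"

lemma written_mask: "written_regs (mask hi) = {14, 15}" "written_arrs (mask hi) = {1}"
  by (auto simp: mask_def)

lemma run_mask:
  assumes s: "adj_state n E s" and K: "holds s K" "set K \<subseteq> {..<n}"
    and hi: "\<And>s'. agree_off {14, 15} {1} s s' \<Longrightarrow> aval s' hi = length K" "acost hi \<le> 3"
    and W: "n \<le> W" "length K \<le> W" "1 \<le> W"
  shows "run W (mask hi) (100 + n * (100 + 100 * length K)) s (masked n E (set K))"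
proof -
  define val where "val v = (if \<exists>k \<in> set K. v = k \<or> E k v then 1 else (0::nat))" for v
  let ?b = "If (Disj (Equal (Read 3 (Reg 15)) (Reg 14)) (adj_test (Read 3 (Reg 15)) (Reg 14)))
        (Store 1 (Reg 14) (Const 1)) Skip"
  let ?c = "Seq (Store 1 (Reg 14) (Const 0)) (For 15 hi ?b)"
  have n: "regs s 0 = n" using s by (simp add: adj_state_def)
  have body: "run W ?c (20 + 100 * length K) s1 (\<lambda>s2. \<forall>v < Suc i. arrs (set_reg 14 (Suc i) s2) 1 v = val v)"
    if i: "i < n" and J: "\<forall>v < i. arrs s1 1 v = val v" and r: "regs s1 14 = i"
      and a: "agree_off {14, 15} {1} s s1" for i s1
  proof -
    let ?P = "\<lambda>s2 :: state. arrs s2 1 i = 0 \<and> (\<forall>v < i. arrs s2 1 v = val v) \<and> regs s2 14 = i \<and>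
        agree_off {14, 15} {1} s s2"
    have "run W (Store 1 (Reg 14) (Const 0)) 3 s1 ?P"
      by (rule run_wp) (use i J r a W in \<open>auto simp: agree_off_def\<close>)
    then show ?thesis
    proof (rule run_Seq)
      fix s2 assume s2: "?P s2"
      let ?J = "\<lambda>(k :: nat) (s3 :: state). arrs s3 1 i = (if \<exists>j < k. i = K ! j \<or> E (K ! j) i then 1 else 0) \<and>
        (\<forall>v < i. arrs s3 1 v = val v)"
      show "run W (For 15 hi ?b) (9 + length K * 61) s2
          (\<lambda>s3. \<forall>v < Suc i. arrs (set_reg 14 (Suc i) s3) 1 v = val v)"
      proof (rule run_For[where J = ?J and N = "length K" and T = 50])
        show "?J 0 (set_reg 15 0 s2)" using s2 by simp
        show "6 + acost hi + length K * (8 + acost hi + 50) \<le> 9 + length K * 61"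
          using hi(2) by (intro add_mono mult_le_mono2) auto
      next
        fix k s3 assume "agree_off (insert 15 (written_regs ?b)) (written_arrs ?b) s2 s3"
        then have "agree_off {14, 15} {1} s s3" using s2 by (auto simp: agree_off_def)
        then show "aval s3 hi = length K" by (rule hi(1))
      next
        fix k s3 assume k: "k < length K" and J3: "?J k s3" and r3: "regs s3 15 = k"
          and a3: "agree_off (insert 15 (written_regs ?b)) (written_arrs ?b) s2 s3"
        have a0: "agree_off {14, 15} {1} s s3" using s2 a3 by (auto simp: agree_off_def)
        have as: "adj_state n E s3" by (rule adj_state_agree[OF s a0]) auto
        have r14: "regs s3 14 = i" using s2 a3 by (auto simp: agree_off_def)
        have k3: "arrs s3 3 k = K ! k" using a0 K(1) k by (auto simp: agree_off_def holds_def)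
        have kn: "K ! k < n" using K(2) k by (meson lessThan_iff nth_mem subsetD)
        have b: "bval s3 (Disj (Equal (Read 3 (Reg 15)) (Reg 14)) (adj_test (Read 3 (Reg 15)) (Reg 14)))
          \<longleftrightarrow> K ! k = i \<or> E (K ! k) i"
          using bval_adj_test[OF as] r14 r3 k3 kn i by simp
        show "run W ?b 50 s3 (\<lambda>s4. ?J (Suc k) (set_reg 15 (Suc k) s4))"
          by (rule run_wp) (use J3 r14 i W in \<open>auto simp: b less_Suc_eq simp del: bval.simps bval_Disj\<close>)
      next
        fix s3 assume J3: "?J (length K) s3"
        have "(\<exists>j < length K. i = K ! j \<or> E (K ! j) i) \<longleftrightarrow> (\<exists>k \<in> set K. i = k \<or> E k i)"
          by (metis in_set_conv_nth)
        with J3 show "\<forall>v < Suc i. arrs (set_reg 14 (Suc i) s3) 1 v = val v"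
          by (simp add: val_def less_Suc_eq)
      qed (use W in auto)
    qed simp
  qed
  show ?thesis unfolding mask_def
  proof (rule run_For[where J = "\<lambda>i s'. \<forall>v < i. arrs s' 1 v = val v" and N = n
        and T = "20 + 100 * length K"], goal_cases)
    case (3 i s')
    then show ?case using n by (auto simp: agree_off_def)
  next
    case (4 i s')
    then have "agree_off {14, 15} {1} s s'" by (auto simp: agree_off_def)
    then show ?case by (rule body[OF 4(1-3)])
  qed (auto simp: masked_def val_def W algebra_simps)
qed

lemma pair_index_less:
  assumes "v < n" "u < n"
  shows "v * n + u < n * (n :: nat)"
proof -
  have "v * n + u < Suc v * n" using assms by simp
  also have "\<dots> \<le> n * n" using assms by (intro mult_le_mono1) simp
  finally show ?thesis .
qed

definition relax :: "nat \<Rightarrow> com" where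
  "relax a = If (Conj (Equal (Read 0 (Reg 15)) (Const 1))
     (Conj (Equal (Read 2 (Div (Reg 15) (Reg 0))) (Plus (Reg 14) (Const 1)))
     (Conj (Equal (Read 2 (Mod (Reg 15) (Reg 0))) (Const 0))
       (Disj (Equal (Read 1 (Mod (Reg 15) (Reg 0))) (Const 0)) (Equal (Mod (Reg 15) (Reg 0)) (Reg a))))))
     (Store 2 (Mod (Reg 15) (Reg 0)) (Plus (Reg 14) (Const 2))) Skip"

text \<open>The search runs backwards from the target in register \<open>b\<close>, so that labels
  fall along the way from register \<open>a\<close>. The target gets label 1 whether it is marked or
  not, and \<open>n\<close> rounds then cover walks of up to \<open>n + 1\<close> vertices.\<close>

definition bfs :: "nat \<Rightarrow> nat \<Rightarrow> com" where
  "bfs a b = Seq (For 14 (Reg 0) (Store 2 (Reg 14) (Const 0))) (Seq (Store 2 (Reg b) (Const 1))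
     (For 14 (Reg 0) (For 15 (Times (Reg 0) (Reg 0)) (relax a))))"

lemma written_bfs: "written_regs (bfs a b) = {14, 15}" "written_arrs (bfs a b) = {2}"
  by (auto simp: bfs_def relax_def)

lemma run_relax:
  assumes s: "adj_state n E s" and E: "\<And>u v. E u v \<Longrightarrow> E v u" "\<And>u v. E u v \<Longrightarrow> u < n"
    and A: "\<And>u. u < n \<Longrightarrow> A u \<longleftrightarrow> arrs s 1 u = 0 \<or> u = regs s a" and a: "a \<notin> {14, 15}"
    and W: "n * n \<le> W" "n + 2 \<le> W" and r: "r < n" "regs s 14 = r"
    and d: "\<And>u. u < n \<Longrightarrow> arrs s 2 u = bfs_label E A t (Suc r) u"
  shows "run W (For 15 (Times (Reg 0) (Reg 0)) (relax a)) (20 + n * n * 80) s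
    (\<lambda>s'. \<forall>u < n. arrs s' 2 u = bfs_label E A t (Suc (Suc r)) u)"
proof -
  define l where "l = bfs_label E A t (Suc r)"
  define hit where "hit q u \<longleftrightarrow> A u \<and> (\<exists>q' < q. q' mod n = u \<and> E (q' div n) u \<and> l (q' div n) = Suc r)" for q u
  define val where "val q u = (if l u \<noteq> 0 then l u else if hit q u then Suc (Suc r) else 0)" for q u
  have l_le: "l u \<le> Suc r" for u by (simp add: l_def label_le)
  have n: "regs s 0 = n" using s by (simp add: adj_state_def)
  have hit_Suc: "hit (Suc q) u \<longleftrightarrow> hit q u \<or> A u \<and> q mod n = u \<and> E (q div n) u \<and> l (q div n) = Suc r" for q u
    unfolding hit_def less_Suc_eq by blast
  show ?thesis
  proof (rule run_For[where J = "\<lambda>q s'. \<forall>u < n. arrs s' 2 u = val q u" and N = "n * n" and T = 69], goal_cases)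
    case 1
    then show ?case by (simp add: relax_def)
  next
    case 2
    have "\<not> hit 0 u" for u by (simp add: hit_def)
    then show ?case using d by (simp add: val_def l_def)
  next
    case (3 q s')
    then show ?case using n by (auto simp: agree_off_def relax_def)
  next
    case (4 q s')
    then have ag: "agree_off {15} {2} s s'" by (simp add: relax_def)
    define v w where "v = q div n" and "w = q mod n"
    have vw: "v < n" "w < n" "q = v * n + w"
      using 4(1) r by (auto simp: v_def w_def less_mult_imp_div_less)
    have n': "regs s' 0 = n" "regs s' 14 = r" "regs s' a = regs s a"
      and A': "arrs s' 1 = arrs s 1"
      using ag n r a by (auto simp: agree_off_def)
    have adj: "arrs s' 0 q = 1 \<longleftrightarrow> E v w"
      using s vw ag by (auto simp: agree_off_def adj_state_def)
    have J: "\<And>u. u < n \<Longrightarrow> arrs s' 2 u = val q u" using 4(2) by blast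
    \<comment> \<open>Labels written in this round equal \<open>r + 2\<close>, so updating in place
      does not enlarge the layer \<open>r + 1\<close> that is being expanded.\<close>
    have dv: "val q v = Suc r \<longleftrightarrow> l v = Suc r" using l_le[of v] by (auto simp: val_def)
    let ?b = "Conj (Equal (Read 0 (Reg 15)) (Const 1))
     (Conj (Equal (Read 2 (Div (Reg 15) (Reg 0))) (Plus (Reg 14) (Const 1)))
     (Conj (Equal (Read 2 (Mod (Reg 15) (Reg 0))) (Const 0))
       (Disj (Equal (Read 1 (Mod (Reg 15) (Reg 0))) (Const 0)) (Equal (Mod (Reg 15) (Reg 0)) (Reg a)))))"
    have b: "bval s' ?b \<longleftrightarrow> E v w \<and> l v = Suc r \<and> val q w = 0 \<and> A w"
      using adj J[OF vw(1)] J[OF vw(2)] dv A[OF vw(2)] n' A' 4(3)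
      by (simp add: v_def[symmetric] w_def[symmetric])
    have new: "val (Suc q) u = (if u = w \<and> E v w \<and> l v = Suc r \<and> val q w = 0 \<and> A w then Suc (Suc r) else val q u)"
      for u
      unfolding val_def hit_Suc v_def[symmetric] w_def[symmetric] by (auto simp: hit_def)
    show ?case unfolding relax_def
    proof (rule run_wp)
      show "wp W (If ?b (Store 2 (Mod (Reg 15) (Reg 0)) (Plus (Reg 14) (Const 2))) Skip) s'
        (\<lambda>s''. \<forall>u < n. arrs (set_reg 15 (Suc q) s'') 2 u = val (Suc q) u)"
        unfolding wp.simps b using J new n' 4(3) W vw r by (auto simp: w_def[symmetric])
    qed simp
  next
    case 5
    then show ?case using W by simp
  next
    case 6
    then show ?case by simp
  next
    case (7 s')
    have "hit (n * n) u \<longleftrightarrow> A u \<and> (\<exists>v. E u v \<and> l v = Suc r)" if u: "u < n" for u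
    proof
      assume "hit (n * n) u"
      then show "A u \<and> (\<exists>v. E u v \<and> l v = Suc r)" using E(1) unfolding hit_def by blast
    next
      assume "A u \<and> (\<exists>v. E u v \<and> l v = Suc r)"
      then obtain v where v: "A u" "E v u" "l v = Suc r" using E(1) by blast
      have "v < n" using E(2)[OF v(2)] .
      then have "v * n + u < n * n" using u by (rule pair_index_less)
      moreover have "(v * n + u) mod n = u" "(v * n + u) div n = v" using u by auto
      ultimately show "hit (n * n) u" unfolding hit_def using v by metis
    qed
    then show ?case using 7(1) label_step[of E A t r] unfolding val_def l_def by simp
  qed
qed

lemma run_bfs:
  assumes s: "adj_state n E s" and E: "\<And>u v. E u v \<Longrightarrow> E v u" "\<And>u v. E u v \<Longrightarrow> u < n"
    and A: "\<And>u. u < n \<Longrightarrow> A u \<longleftrightarrow> arrs s 1 u = 0 \<or> u = regs s a" and ab: "a \<notin> {14, 15}" "b \<notin> {14, 15}"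
    and W: "n * n \<le> W" "n + 2 \<le> W" and b: "regs s b < n"
  shows "run W (bfs a b) (100 + n * (100 + n * n * 80)) s
    (\<lambda>s'. \<forall>u < n. arrs s' 2 u = bfs_label E A (regs s b) (Suc n) u)"
proof -
  have n: "regs s 0 = n" using s by (simp add: adj_state_def)
  define t where "t = regs s b"
  have t: "t < n" using b t_def by simp
  let ?P = "\<lambda>s' :: state. (\<forall>u < n. arrs s' 2 u = 0) \<and> agree_off {14} {2} s s'"
  have 1: "run W (For 14 (Reg 0) (Store 2 (Reg 14) (Const 0))) (7 + n * 20) s ?P"
  proof (rule run_For[where J = "\<lambda>i s'. \<forall>u < i. arrs s' 2 u = 0" and N = n and T = 3], goal_cases)
    case (3 i s')
    then show ?case using n by (auto simp: agree_off_def)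
  next
    case (4 i s')
    then show ?case using W by (intro run_wp) (auto simp: less_Suc_eq)
  qed (use W in auto)
  show ?thesis unfolding bfs_def
  proof (rule run_Seq[OF 1])
    fix s1 assume s1: "?P s1"
    let ?P2 = "\<lambda>s' :: state. (\<forall>u < n. arrs s' 2 u = bfs_label E A t (Suc 0) u) \<and> agree_off {14} {2} s s'"
    have rb: "regs s1 b = t" using s1 ab by (auto simp: agree_off_def t_def)
    have 2: "run W (Store 2 (Reg b) (Const 1)) 3 s1 ?P2"
      by (rule run_wp) (use s1 t W rb label_1[of E A t] in \<open>auto simp: agree_off_def\<close>)
    show "run W (Seq (Store 2 (Reg b) (Const 1)) (For 14 (Reg 0) (For 15 (Times (Reg 0) (Reg 0)) (relax a))))
      (20 + n * (40 + n * n * 80)) s1 (\<lambda>s'. \<forall>u < n. arrs s' 2 u = bfs_label E A (regs s b) (Suc n) u)"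
    proof (rule run_Seq[OF 2])
      fix s2 assume s2: "?P2 s2"
      show "run W (For 14 (Reg 0) (For 15 (Times (Reg 0) (Reg 0)) (relax a)))
        (7 + n * (29 + n * n * 80)) s2 (\<lambda>s'. \<forall>u < n. arrs s' 2 u = bfs_label E A (regs s b) (Suc n) u)"
      proof (rule run_For[where J = "\<lambda>i s'. \<forall>u < n. arrs s' 2 u = bfs_label E A t (Suc i) u" and N = n
            and T = "20 + n * n * 80"], goal_cases)
        case (2)
        then show ?case using s2 by simp
      next
        case (3 i s')
        then show ?case using n s2 by (auto simp: agree_off_def relax_def)
      next
        case (4 i s')
        then have ag: "agree_off {14, 15} {2} s s'"
          using s2 by (auto simp: agree_off_def relax_def)
        have "run W (For 15 (Times (Reg 0) (Reg 0)) (relax a)) (20 + n * n * 80) s'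
          (\<lambda>s'. \<forall>u < n. arrs s' 2 u = bfs_label E A t (Suc (Suc i)) u)"
        proof (rule run_relax[OF _ E _ ab(1) W 4(1) 4(3)])
          show "adj_state n E s'" by (rule adj_state_agree[OF s ag]) auto
          show "A u \<longleftrightarrow> arrs s' 1 u = 0 \<or> u = regs s' a" if "u < n" for u
            using A[OF that] ag ab by (auto simp: agree_off_def)
          show "arrs s' 2 u = bfs_label E A t (Suc i) u" if "u < n" for u using 4(2) that by blast
        qed
        then show ?case by simp
      qed (use W t_def in \<open>auto simp: relax_def\<close>)
    qed (simp add: algebra_simps)
  qed (simp add: algebra_simps)
qed

section \<open>Reading off a shortest path from the labels\<close>

definition follow :: com where
  "follow = If (Conj (adj_test (Reg 16) (Reg 15)) (Conj (Less (Const 0) (Read 2 (Reg 15)))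
      (Equal (Plus (Read 2 (Reg 15)) (Const 1)) (Read 2 (Reg 16)))))
    (Seq (Store 3 (Reg 11) (Reg 16)) (Seq (Assign 11 (Plus (Reg 11) (Const 1))) (Assign 16 (Reg 15)))) Skip"

text \<open>Each of the \<open>n\<close> sweeps over all vertices lowers the label of the current
  vertex at least once, unless it is at most 1 already; a sweep may make several steps. The target
  is not written, so two searches can be chained without repeating the midpoint.\<close>

definition search :: "nat \<Rightarrow> nat \<Rightarrow> com" where
  "search a b = Seq (bfs a b) (Seq (Assign 16 (Reg a)) (For 14 (Reg 0) (For 15 (Reg 0) follow)))"

lemma written_search: "written_regs (search a b) = {11, 14, 15, 16}" "written_arrs (search a b) = {2, 3}"
  by (auto simp: search_def written_bfs follow_def)

lemma run_search:
  assumes s: "adj_state n E s"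
    and E: "\<And>u v. E u v \<Longrightarrow> E v u" "\<And>u v. E u v \<Longrightarrow> u < n"
    and M: "masked n E K s" and xs: "holds s xs" "regs s 11 = length xs"
    and ab: "a \<notin> {11, 14, 15, 16}" "b \<notin> {11, 14, 15, 16}"
    and gt: "regs s a = g" "g < n" "regs s b = t" "t < n"
    and W: "n * n \<le> W" "n + 2 \<le> W" "length xs + n + 2 \<le> W"
  shows "run W (search a b) (200 + n * (200 + n * 100 + n * n * 80)) s
    (\<lambda>s'. \<exists>R. regs s' 11 = length xs + length R \<and> holds s' (xs @ R) \<and> set R \<subseteq> {..<n} \<and> length R \<le> n \<and>
       ((\<exists>w. reachable_walk E K g t w) \<longrightarrow> shortest E K g t (R @ [t])))"
proof -
  let ?Q = "\<lambda>s'. \<exists>R. regs s' 11 = length xs + length R \<and> holds s' (xs @ R) \<and> set R \<subseteq> {..<n} \<and> length R \<le> n \<and>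
       ((\<exists>w. reachable_walk E K g t w) \<longrightarrow> shortest E K g t (R @ [t]))"
  define A where "A u \<longleftrightarrow> u = g \<or> (\<forall>k \<in> K. u \<noteq> k \<and> \<not> E k u)" for u
  define \<delta> where "\<delta> = bfs_label E A t (Suc n)"
  \<comment> \<open>If the target cannot be reached, \<open>\<delta> g = 0\<close> and the equation
    forces \<open>R\<close> to be empty, so its length is bounded in every case.\<close>
  define core where "core s' R \<longleftrightarrow> regs s' 11 = length xs + length R \<and> holds s' (xs @ R) \<and>
      successively E (R @ [regs s' 16]) \<and> hd (R @ [regs s' 16]) = g \<and> set (R @ [regs s' 16]) \<subseteq> {..<n} \<and>
      (\<forall>v \<in> set (R @ [regs s' 16]). v = g \<or> 0 < \<delta> v) \<and> \<delta> (regs s' 16) + length R = \<delta> g \<and>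
      (0 < \<delta> g \<longrightarrow> 0 < \<delta> (regs s' 16))" for s' :: state and R
  \<comment> \<open>After \<open>i\<close> sweeps the label is at most 1 or has dropped by
    \<open>i\<close>. Labels do not exceed \<open>n + 1\<close>, so \<open>n\<close> sweeps are
    enough.\<close>
  define near where "near i s' \<longleftrightarrow> \<delta> (regs s' 16) \<le> 1 \<or> \<delta> (regs s' 16) + i \<le> \<delta> g" for i and s' :: state
  have core_upd: "core (set_reg x i s') R \<longleftrightarrow> core s' R" "near k (set_reg x i s') \<longleftrightarrow> near k s'"
    if "x \<in> {14, 15}" for x i s' R k
    using that by (auto simp: core_def near_def holds_def)
  have dg: "\<delta> u \<le> Suc n" for u by (simp add: \<delta>_def label_le)
  have n: "regs s 0 = n" using s by (simp add: adj_state_def)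
  have Aeq: "A u \<longleftrightarrow> arrs s 1 u = 0 \<or> u = regs s a" if "u < n" for u
    using M that gt unfolding masked_def A_def by auto
  have B: "run W (bfs a b) (100 + n * (100 + n * n * 80)) s
      (\<lambda>s'. \<forall>u < n. arrs s' 2 u = bfs_label E A (regs s b) (Suc n) u)"
    by (rule run_bfs[OF s E Aeq _ _ W(1,2)]) (use ab gt in auto)
  let ?P = "\<lambda>s' :: state. (\<forall>u < n. arrs s' 2 u = \<delta> u) \<and> agree_off {14, 15} {2} s s'"
  have 1: "run W (bfs a b) (100 + n * (100 + n * n * 80)) s ?P"
    by (rule run_mono[OF run_frame[OF B] order.refl]) (use gt in \<open>auto simp: written_bfs \<delta>_def\<close>)
  show ?thesis unfolding search_def
  proof (rule run_Seq[OF 1])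
    fix s1 assume s1: "?P s1"
    let ?P2 = "\<lambda>s' :: state. core s' [] \<and> (\<forall>u < n. arrs s' 2 u = \<delta> u) \<and> agree_off {14, 15, 16} {2} s s'"
    have sa: "regs s1 a = g" using s1 ab gt by (auto simp: agree_off_def)
    have 2: "run W (Assign 16 (Reg a)) 2 s1 ?P2"
    proof (rule run_wp)
      show "wp W (Assign 16 (Reg a)) s1 ?P2"
        using s1 sa gt W xs by (auto simp: agree_off_def core_def holds_def)
    qed simp
    show "run W (Seq (Assign 16 (Reg a)) (For 14 (Reg 0) (For 15 (Reg 0) follow))) (20 + n * (30 + n * 59)) s1
      ?Q"
    proof (rule run_Seq[OF 2])
      fix s2 assume s2: "?P2 s2"
      show "run W (For 14 (Reg 0) (For 15 (Reg 0) follow)) (7 + n * (16 + n * 59)) s2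
      ?Q"
      proof (rule run_For[where J = "\<lambda>i s'. (\<exists>R. core s' R) \<and> near i s'" and N = n and T = "7 + n * 59"], goal_cases)
        case 1
        then show ?case by (simp add: follow_def)
      next
        case 2
        have "core s2 []" using s2 by blast
        moreover have "near 0 s2" using \<open>core s2 []\<close> by (simp add: near_def core_def)
        ultimately show ?case using core_upd by auto
      next
        case (3 i s')
        then show ?case using n s2 by (auto simp: agree_off_def follow_def)
      next
        case (4 i s3)
        then have ag3: "agree_off {11, 14, 15, 16} {3} s2 s3" by (auto simp: agree_off_def follow_def)
        define c where "c = regs s3 16"
        define qual where "qual u \<longleftrightarrow> E c u \<and> 0 < \<delta> u \<and> \<delta> u + 1 = \<delta> c" for u
        \<comment> \<open>During a sweep either the current vertex is still \<open>c\<close> and no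
          vertex so far qualifies as its successor, or the progress demanded of this sweep has been
          made.\<close>
        let ?J = "\<lambda>u s'. (\<exists>R. core s' R) \<and> (regs s' 16 = c \<and> (\<forall>u' < u. \<not> qual u') \<and> near i s' \<or> near (Suc i) s')"
        show ?case
        proof (rule run_For[where J = ?J and N = n and T = 50], goal_cases)
          case 1
          then show ?case by (simp add: follow_def)
        next
          case 2
          then show ?case using 4(2) core_upd by (auto simp: c_def)
        next
          case (3 u s')
          then show ?case using n s2 ag3 by (auto simp: agree_off_def follow_def)
        next
          case (4 u s4)
          have ag4: "agree_off {11, 14, 15, 16} {2, 3} s s4"
            using s2 ag3 4(4) by (auto simp: agree_off_def follow_def)
          have as: "adj_state n E s4" by (rule adj_state_agree[OF s ag4]) auto
          have d4: "\<And>v. v < n \<Longrightarrow> arrs s4 2 v = \<delta> v"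
            using s2 ag3 4(4) by (auto simp: agree_off_def follow_def)
          from 4(2) obtain R where R: "core s4 R" by blast
          define c' where "c' = regs s4 16"
          have c': "c' < n" using R by (simp add: core_def c'_def)
          have Rl: "length R \<le> Suc n" using R dg[of g] unfolding core_def by linarith
          have b: "bval s4 (Conj (adj_test (Reg 16) (Reg 15)) (Conj (Less (Const 0) (Read 2 (Reg 15)))
              (Equal (Plus (Read 2 (Reg 15)) (Const 1)) (Read 2 (Reg 16))))) \<longleftrightarrow>
              E c' u \<and> 0 < \<delta> u \<and> \<delta> u + 1 = \<delta> c'"
            using bval_adj_test[OF as, of "Reg 16" "Reg 15"] c' 4(1,3) d4 by (simp add: c'_def)
          show ?case unfolding follow_def
          proof (rule run_wp, subst wp.simps, subst b, split if_split, intro conjI impI)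
            assume q: "E c' u \<and> 0 < \<delta> u \<and> \<delta> u + 1 = \<delta> c'"
            have near': "\<delta> u \<le> 1 \<or> \<delta> u + Suc i \<le> \<delta> g"
              using 4(2) q unfolding near_def c'_def by auto
            define s5 where "s5 = set_reg 16 u (set_reg 11 (Suc (regs s4 11)) (set_arr 3 (regs s4 11) c' s4))"
            have eq: "wp W (Seq (Store 3 (Reg 11) (Reg 16)) (Seq (Assign 11 (Plus (Reg 11) (Const 1))) (Assign 16 (Reg 15)))) s4 P
              \<longleftrightarrow> regs s4 11 \<le> W \<and> c' \<le> W \<and> Suc (regs s4 11) \<le> W \<and> u \<le> W \<and> P s5" for P
              using 4(3) by (simp add: s5_def c'_def)
            have r: "regs s5 16 = u" "regs s5 11 = Suc (regs s4 11)" by (simp_all add: s5_def)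
            have Rn: "length R \<le> n" using R q dg[of g] unfolding core_def c'_def by linarith
            have R': "regs s4 11 = length xs + length R" "holds s4 (xs @ R)" "successively E (R @ [c'])"
              "hd (R @ [c']) = g" "set (R @ [c']) \<subseteq> {..<n}" "\<forall>v \<in> set (R @ [c']). v = g \<or> 0 < \<delta> v"
              "\<delta> c' + length R = \<delta> g"
              using R unfolding core_def c'_def by simp_all
            have "core s5 (R @ [c'])"
              unfolding core_def r
            proof (intro conjI)
              show "holds s5 (xs @ R @ [c'])"
                using R'(1,2) unfolding holds_def s5_def by (auto simp: nth_append less_Suc_eq)
              show "successively E ((R @ [c']) @ [u])"
                using R'(3) q successively_append_iff[of E "R @ [c']" "[u]"] by simp
              show "hd ((R @ [c']) @ [u]) = g" using R'(4) by (cases R) auto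
            qed (use R' q 4(1) in auto)
            moreover have "near (Suc i) s5" using near' unfolding near_def r .
            ultimately show "wp W (Seq (Store 3 (Reg 11) (Reg 16)) (Seq (Assign 11 (Plus (Reg 11) (Const 1))) (Assign 16 (Reg 15))))
              s4 (\<lambda>s''. ?J (Suc u) (set_reg 15 (Suc u) s''))"
              unfolding eq using R'(1) Rn W c' 4(1) core_upd by auto
          next
            assume q: "\<not> (E c' u \<and> 0 < \<delta> u \<and> \<delta> u + 1 = \<delta> c')"
            then have "\<not> qual u" if "regs s4 16 = c" using that by (simp add: qual_def c'_def)
            then show "wp W Skip s4 (\<lambda>s''. ?J (Suc u) (set_reg 15 (Suc u) s''))"
              using 4(2) core_upd by (auto simp: less_Suc_eq)
          qed (simp add: adj_test_def)
        next
          case (7 s')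
          have "near (Suc i) s'"
          proof (rule ccontr)
            assume nn: "\<not> near (Suc i) s'"
            then have c: "regs s' 16 = c" "\<forall>u < n. \<not> qual u" using 7(1) by auto
            then have "1 < \<delta> c" using nn by (auto simp: near_def)
            then obtain v where v: "E c v" "0 < \<delta> v" "\<delta> v + 1 = \<delta> c"
              using label_descent[of E A t "Suc n" c] unfolding \<delta>_def by blast
            then show False using c(2) E unfolding qual_def by blast
          qed
          then show ?case using 7(1) core_upd by auto
        qed (use W in auto)
      next
        case (7 s3)
        then obtain R where R: "core s3 R" by blast
        define c where "c = regs s3 16"
        have c1: "\<delta> c \<le> 1" using 7 dg[of g] by (auto simp: near_def c_def)
        have Rn: "length R \<le> n" using R dg[of g] unfolding core_def c_def[symmetric] by linarith
        have "shortest E K g t (R @ [t])" if ex: "\<exists>w. reachable_walk E K g t w"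
        proof -
          obtain w where w: "reachable_walk E K g t w" "\<And>w'. reachable_walk E K g t w' \<Longrightarrow> length w \<le> length w'"
            using ex_has_least_nat[of "reachable_walk E K g t" _ length] ex by blast
          then have sw: "shortest E K g t w" by (simp add: shortest_def)
          have ww: "successively E w" "w \<noteq> []" "hd w = g" "last w = t"
            "\<And>v. v \<in> set w \<Longrightarrow> v = t \<or> A v"
            using w(1) unfolding reachable_walk_def A_def by auto
          \<comment> \<open>A shortest walk is chordless, hence without repetition, so it has at
            most \<open>n\<close> vertices and the labels up to \<open>Suc n\<close> see it.\<close>
          have "set w \<subseteq> {..<n}"
          proof
            fix v assume v: "v \<in> set w"
            obtain x y where xy: "w = x @ v # y" using split_list[OF v] by blast
            show "v \<in> {..<n}"
            proof (cases y)
              case Nil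
              then show ?thesis using ww(4) xy gt(4) by simp
            next
              case (Cons z y')
              then have "E v z" using ww(1) xy by (simp add: successively_append_iff)
              then show ?thesis using E(2) by simp
            qed
          qed
          moreover have "distinct w" using chordless_distinct[OF shortest_chordless[OF sw]] .
          ultimately have "length w \<le> n"
            using card_mono[of "{..<n}" "set w"] distinct_card[of w] by simp
          moreover have re: "reaches E A t (length w) g"
            using reaches_walk[of E w t A] ww by simp
          ultimately have "reaches E A t (Suc n) g" by (rule reaches_mono[rotated, OF le_SucI])
          then have pos: "0 < \<delta> g" unfolding \<delta>_def label_pos_iff .
          have le: "\<delta> g \<le> length w" unfolding \<delta>_def by (rule label_le_walk[OF re])
          have "\<delta> c = Suc 0" using c1 R pos unfolding core_def c_def[symmetric] by simp
          then have ct: "c = t" using label_eq_1 unfolding \<delta>_def by metis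
          have R': "successively E (R @ [t])" "hd (R @ [t]) = g" "\<forall>v \<in> set (R @ [t]). v = g \<or> 0 < \<delta> v"
            using R ct unfolding core_def c_def by simp_all
          have "v = g \<or> v = t \<or> (\<forall>k \<in> K. v \<noteq> k \<and> \<not> E k v)" if "v \<in> set (R @ [t])" for v
          proof (cases "v = g")
            case False
            then have "0 < \<delta> v" using bspec[OF R'(3) that] by simp
            then have "v = t \<or> A v" unfolding \<delta>_def by (rule label_allowed)
            then show ?thesis unfolding A_def by blast
          qed simp
          then have "reachable_walk E K g t (R @ [t])"
            using R' unfolding reachable_walk_def by simp
          moreover have "length (R @ [t]) \<le> length w"
            using R le \<open>\<delta> c = Suc 0\<close> unfolding core_def c_def[symmetric] by simp
          ultimately show ?thesis using w(2) unfolding shortest_def by (meson le_trans)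
        qed
        then show ?case using R Rn unfolding core_def by auto
      qed (use W in auto)
    qed (simp add: algebra_simps)
  qed (simp add: algebra_simps)
qed

section \<open>The algorithm\<close>

text \<open>The pairs \<open>i < j\<close> of positions that are adjacent when the list of length \<open>m\<close> consists of the three
  paths of a prism, the second one starting at position \<open>k\<close> and the third one at \<open>l\<close>.\<close>

definition prism_pattern :: "nat \<Rightarrow> nat \<Rightarrow> nat \<Rightarrow> nat \<Rightarrow> nat \<Rightarrow> bool" where
  "prism_pattern k l m i j \<longleftrightarrow> j = Suc i \<and> j \<noteq> k \<and> j \<noteq> l \<or> (i = 0 \<or> i = k) \<and> (j = k \<or> j = l) \<or>
     (Suc i = k \<or> Suc i = l) \<and> (Suc j = l \<or> Suc j = m)"

text \<open>Strict inequalities between even numbers give each of the three paths an even number of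
  vertices, at least two.\<close>

definition odd_prism_list :: "('a \<Rightarrow> 'a \<Rightarrow> bool) \<Rightarrow> 'a list \<Rightarrow> nat \<Rightarrow> nat \<Rightarrow> bool" where
  "odd_prism_list E xs k l \<longleftrightarrow>
     1 < k \<and> even k \<and> k < l \<and> even l \<and> l < length xs \<and> even (length xs) \<and>
     (\<forall>i < length xs. \<forall>j < length xs. i < j \<longrightarrow>
        xs ! i \<noteq> xs ! j \<and> (E (xs ! i) (xs ! j) \<longleftrightarrow> prism_pattern k l (length xs) i j))"

section \<open>Recognising an odd prism in a list of vertices\<close>

lemma ladder_nth:
  assumes "distinct p" "distinct q" "p \<noteq> []" "q \<noteq> []"
  shows "ladder E p q \<longleftrightarrow> (\<forall>i < length p. \<forall>j < length q. p ! i \<noteq> q ! j \<and>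
    (E (p ! i) (q ! j) \<longleftrightarrow> i = 0 \<and> j = 0 \<or> Suc i = length p \<and> Suc j = length q))"
proof -
  have h: "p ! i = hd p \<longleftrightarrow> i = 0" "p ! i = last p \<longleftrightarrow> Suc i = length p"
    if "i < length p" "distinct p" "p \<noteq> []" for i and p :: "'a list"
    using that by (auto simp: hd_conv_nth last_conv_nth nth_eq_iff_index_eq)
  have "ladder E p q \<longleftrightarrow> (\<forall>i < length p. \<forall>j < length q. p ! i \<noteq> q ! j \<and>
    (E (p ! i) (q ! j) \<longleftrightarrow> p ! i = hd p \<and> q ! j = hd q \<or> p ! i = last p \<and> q ! j = last q))"
    unfolding ladder_def by (simp add: all_set_conv_all_nth)
  also have "\<dots> \<longleftrightarrow> (\<forall>i < length p. \<forall>j < length q. p ! i \<noteq> q ! j \<and>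
    (E (p ! i) (q ! j) \<longleftrightarrow> i = 0 \<and> j = 0 \<or> Suc i = length p \<and> Suc j = length q))"
    using h[OF _ assms(1,3)] h[OF _ assms(2,4)] by simp
  finally show ?thesis .
qed

text \<open>Two positions lie in the same block or in different ones. The six ranges match the three
  chordless paths and the three ladders of a prism.\<close>

lemma upper_triangle_blocks:
  fixes P Q R :: nat
  shows "(\<forall>i < P + Q + R. \<forall>j < P + Q + R. i < j \<longrightarrow> F i j) \<longleftrightarrow>
    (\<forall>j < P. \<forall>i < j. F i j) \<and> (\<forall>j < Q. \<forall>i < j. F (P + i) (P + j)) \<and>
    (\<forall>j < R. \<forall>i < j. F (P + Q + i) (P + Q + j)) \<and> (\<forall>i < P. \<forall>j < Q. F i (P + j)) \<and>
    (\<forall>i < P. \<forall>j < R. F i (P + Q + j)) \<and> (\<forall>i < Q. \<forall>j < R. F (P + i) (P + Q + j))"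
    (is "?L \<longleftrightarrow> ?R")
proof
  assume L: ?L
  show ?R by (intro conjI allI impI; rule L[rule_format]; simp)
next
  assume R: ?R
  show ?L
  proof (intro allI impI)
    fix i j assume i: "i < P + Q + R" and j: "j < P + Q + R" and ij: "i < j"
    have "i < P \<or> (\<exists>i' < Q. i = P + i') \<or> (\<exists>i' < R. i = P + Q + i')" using i by presburger
    moreover have "j < P \<or> (\<exists>j' < Q. j = P + j') \<or> (\<exists>j' < R. j = P + Q + j')" using j by presburger
    ultimately show "F i j" using R ij by (elim disjE exE) auto
  qed
qed

lemma prism_pattern_blocks:
  fixes P Q R i j :: nat
  assumes "2 \<le> P" "2 \<le> Q" "2 \<le> R"
  defines "F \<equiv> prism_pattern P (P + Q) (P + Q + R)"
  shows "i < j \<Longrightarrow> j < P \<Longrightarrow> F i j \<longleftrightarrow> j = Suc i"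
    and "i < j \<Longrightarrow> j < Q \<Longrightarrow> F (P + i) (P + j) \<longleftrightarrow> j = Suc i"
    and "i < j \<Longrightarrow> j < R \<Longrightarrow> F (P + Q + i) (P + Q + j) \<longleftrightarrow> j = Suc i"
    and "i < P \<Longrightarrow> j < Q \<Longrightarrow> F i (P + j) \<longleftrightarrow> i = 0 \<and> j = 0 \<or> Suc i = P \<and> Suc j = Q"
    and "i < P \<Longrightarrow> j < R \<Longrightarrow> F i (P + Q + j) \<longleftrightarrow> i = 0 \<and> j = 0 \<or> Suc i = P \<and> Suc j = R"
    and "i < Q \<Longrightarrow> j < R \<Longrightarrow> F (P + i) (P + Q + j) \<longleftrightarrow> i = 0 \<and> j = 0 \<or> Suc i = Q \<and> Suc j = R"
  using assms(1-3) unfolding F_def prism_pattern_def by auto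

text \<open>From left to right this makes a positive answer trustworthy whatever lists the searches
  returned; from right to left it makes the check accept the lists of a correct guess.\<close>

lemma odd_prism_list_iff:
  "odd_prism_list E (p @ q @ r) (length p) (length p + length q) \<longleftrightarrow>
    prism E p q r \<and> even (length p) \<and> even (length q) \<and> even (length r)"
proof (cases "2 \<le> length p \<and> 2 \<le> length q \<and> 2 \<le> length r \<and>
    even (length p) \<and> even (length q) \<and> even (length r)")
  case False
  have "2 \<le> length p \<and> 2 \<le> length q \<and> 2 \<le> length r \<and> even (length p) \<and> even (length q) \<and> even (length r)"
    if "odd_prism_list E (p @ q @ r) (length p) (length p + length q)"
  proof -
    have "1 < length p \<and> even (length p) \<and> length p < length p + length q \<and>
      even (length p + length q) \<and> length p + length q < length p + (length q + length r) \<and>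
      even (length p + (length q + length r))"
      using that unfolding odd_prism_list_def length_append by blast
    then show ?thesis by presburger
  qed
  then show ?thesis using False unfolding prism_def by blast
next
  case True
  define xs where "xs = p @ q @ r"
  define P Q R where "P = length p" and "Q = length q" and "R = length r"
  have N: "length xs = P + Q + R" by (simp add: xs_def P_def Q_def R_def)
  have two: "2 \<le> P" "2 \<le> Q" "2 \<le> R" using True P_def Q_def R_def by auto
  let ?e = "prism_pattern P (P + Q) (P + Q + R)"
  let ?ok = "\<lambda>i j. xs ! i \<noteq> xs ! j \<and> (E (xs ! i) (xs ! j) \<longleftrightarrow> ?e i j)"
  have nth: "i < P \<Longrightarrow> xs ! i = p ! i" "i < Q \<Longrightarrow> xs ! (P + i) = q ! i" "i < R \<Longrightarrow> xs ! (P + Q + i) = r ! i" for i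
    by (auto simp: xs_def P_def Q_def R_def nth_append)
  note e = prism_pattern_blocks[OF two]
  have c: "chordless E p \<longleftrightarrow> (\<forall>j < P. \<forall>i < j. ?ok i j)"
    "chordless E q \<longleftrightarrow> (\<forall>j < Q. \<forall>i < j. ?ok (P + i) (P + j))"
    "chordless E r \<longleftrightarrow> (\<forall>j < R. \<forall>i < j. ?ok (P + Q + i) (P + Q + j))"
    unfolding chordless_nth P_def[symmetric] Q_def[symmetric] R_def[symmetric] by (simp_all add: nth e)
  have l: "ladder E p q \<longleftrightarrow> (\<forall>i < P. \<forall>j < Q. ?ok i (P + j))"
    "ladder E p r \<longleftrightarrow> (\<forall>i < P. \<forall>j < R. ?ok i (P + Q + j))"
    "ladder E q r \<longleftrightarrow> (\<forall>i < Q. \<forall>j < R. ?ok (P + i) (P + Q + j))"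
    if "chordless E p" "chordless E q" "chordless E r"
  proof -
    have d: "distinct p" "distinct q" "distinct r" using that[THEN chordless_distinct] by auto
    have ne: "p \<noteq> []" "q \<noteq> []" "r \<noteq> []" using True by auto
    show "ladder E p q \<longleftrightarrow> (\<forall>i < P. \<forall>j < Q. ?ok i (P + j))"
      unfolding ladder_nth[OF d(1,2) ne(1,2)] P_def[symmetric] Q_def[symmetric] by (simp add: nth e)
    show "ladder E p r \<longleftrightarrow> (\<forall>i < P. \<forall>j < R. ?ok i (P + Q + j))"
      unfolding ladder_nth[OF d(1,3) ne(1,3)] P_def[symmetric] R_def[symmetric] by (simp add: nth e)
    show "ladder E q r \<longleftrightarrow> (\<forall>i < Q. \<forall>j < R. ?ok (P + i) (P + Q + j))"
      unfolding ladder_nth[OF d(2,3) ne(2,3)] Q_def[symmetric] R_def[symmetric] by (simp add: nth e)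
  qed
  have "odd_prism_list E xs P (P + Q) \<longleftrightarrow> (\<forall>i < P + Q + R. \<forall>j < P + Q + R. i < j \<longrightarrow> ?ok i j)"
  proof -
    have "1 < P \<and> even P \<and> P < P + Q \<and> even (P + Q) \<and> P + Q < P + Q + R \<and> even (P + Q + R)"
      using True[folded P_def Q_def R_def] two by auto
    then show ?thesis unfolding odd_prism_list_def N by blast
  qed
  also have "\<dots> \<longleftrightarrow> (\<forall>j < P. \<forall>i < j. ?ok i j) \<and> (\<forall>j < Q. \<forall>i < j. ?ok (P + i) (P + j)) \<and>
    (\<forall>j < R. \<forall>i < j. ?ok (P + Q + i) (P + Q + j)) \<and> (\<forall>i < P. \<forall>j < Q. ?ok i (P + j)) \<and>
    (\<forall>i < P. \<forall>j < R. ?ok i (P + Q + j)) \<and> (\<forall>i < Q. \<forall>j < R. ?ok (P + i) (P + Q + j))"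
    by (rule upper_triangle_blocks)
  also have "\<dots> \<longleftrightarrow> prism E p q r"
  proof (cases "chordless E p \<and> chordless E q \<and> chordless E r")
    case T: True
    then show ?thesis
      unfolding c[symmetric] l(1)[OF T[THEN conjunct1] T[THEN conjunct2, THEN conjunct1] T[THEN conjunct2, THEN conjunct2], symmetric]
        l(2)[OF T[THEN conjunct1] T[THEN conjunct2, THEN conjunct1] T[THEN conjunct2, THEN conjunct2], symmetric]
        l(3)[OF T[THEN conjunct1] T[THEN conjunct2, THEN conjunct1] T[THEN conjunct2, THEN conjunct2], symmetric]
        prism_def using True by blast
  next
    case False
    then show ?thesis unfolding c[symmetric] prism_def by blast
  qed
  finally show ?thesis using True unfolding xs_def P_def Q_def by simp
qed

text \<open>\<open>prism_pattern\<close> with \<open>i\<close>, \<open>j\<close> in registers 14 and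
  15 and \<open>k\<close>, \<open>l\<close>, \<open>m\<close> in registers 12, 13 and 11.\<close>

definition pattern_test :: bexp where
  "pattern_test =
     Disj (Conj (Equal (Reg 15) (Plus (Reg 14) (Const 1)))
          (Conj (Neg (Equal (Reg 15) (Reg 12))) (Neg (Equal (Reg 15) (Reg 13)))))
       (Disj (Conj (Disj (Equal (Reg 14) (Const 0)) (Equal (Reg 14) (Reg 12)))
             (Disj (Equal (Reg 15) (Reg 12)) (Equal (Reg 15) (Reg 13))))
         (Conj (Disj (Equal (Plus (Reg 14) (Const 1)) (Reg 12)) (Equal (Plus (Reg 14) (Const 1)) (Reg 13)))
           (Disj (Equal (Plus (Reg 15) (Const 1)) (Reg 13)) (Equal (Plus (Reg 15) (Const 1)) (Reg 11)))))"

definition bad_pair :: bexp where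
  "bad_pair = Conj (Less (Reg 14) (Reg 15))
     (Disj (Equal (Read 3 (Reg 14)) (Read 3 (Reg 15)))
       (Disj (Conj (adj_test (Read 3 (Reg 14)) (Read 3 (Reg 15))) (Neg pattern_test))
         (Conj (Neg (adj_test (Read 3 (Reg 14)) (Read 3 (Reg 15)))) pattern_test)))"

definition lengths_test :: bexp where
  "lengths_test = Conj (Less (Const 1) (Reg 12)) (Conj (Equal (Mod (Reg 12) (Const 2)) (Const 0))
     (Conj (Less (Reg 12) (Reg 13)) (Conj (Equal (Mod (Reg 13) (Const 2)) (Const 0))
     (Conj (Less (Reg 13) (Reg 11)) (Equal (Mod (Reg 11) (Const 2)) (Const 0))))))"

text \<open>Register 17 holds the verdict on the present guess. Register 1 is set to 1 but never
  back to 0, so the answer is the disjunction over all guesses.\<close>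

definition check :: com where
  "check = Seq (If lengths_test (Assign 17 (Const 1)) (Assign 17 (Const 0)))
     (Seq (For 14 (Reg 11) (For 15 (Reg 11) (If bad_pair (Assign 17 (Const 0)) Skip)))
       (If (Equal (Reg 17) (Const 1)) (Assign 1 (Const 1)) Skip))"

lemma run_check:
  assumes s: "adj_state n E s" and xs: "holds s xs" "regs s 11 = length xs" "set xs \<subseteq> {..<n}"
    and kl: "regs s 12 = k" "regs s 13 = l" and W: "length xs \<le> W" "1 \<le> W"
  shows "run W check (200 + length xs * (100 + length xs * 300)) s
    (\<lambda>s'. regs s' 1 = (if odd_prism_list E xs k l then 1 else regs s 1))"
proof -
  define L where "L = length xs"
  define ok where "ok i j \<longleftrightarrow> xs ! i \<noteq> xs ! j \<and> (E (xs ! i) (xs ! j) \<longleftrightarrow> prism_pattern k l L i j)" for i j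
  define lens where "lens \<longleftrightarrow> 1 < k \<and> even k \<and> k < l \<and> even l \<and> l < L \<and> even L"
  have good: "odd_prism_list E xs k l \<longleftrightarrow> lens \<and> (\<forall>i < L. \<forall>j < L. i < j \<longrightarrow> ok i j)"
    by (auto simp: odd_prism_list_def lens_def ok_def L_def)
  have bound: "xs ! i < n" if "i < L" for i
    using xs(3) that unfolding L_def by (meson lessThan_iff nth_mem subsetD)
  let ?P1 = "\<lambda>s' :: state. regs s' 17 = (if lens then 1 else 0) \<and> agree_off {17} {} s s'"
  let ?P2 = "\<lambda>s' :: state. regs s' 17 = (if odd_prism_list E xs k l then 1 else 0) \<and> regs s' 1 = regs s 1"
  have r1: "run W (If lengths_test (Assign 17 (Const 1)) (Assign 17 (Const 0))) 40 s ?P1"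
    by (rule run_wp) (use W kl xs in \<open>auto simp: lens_def L_def agree_off_def lengths_test_def even_iff_mod_2_eq_zero\<close>)
  have r2: "run W (For 14 (Reg 11) (For 15 (Reg 11) (If bad_pair (Assign 17 (Const 0)) Skip)))
      (7 + L * (16 + L * 209)) s1 ?P2" if s1: "?P1 s1" for s1
  proof (rule run_For[where J = "\<lambda>i s'. regs s' 17 = (if lens \<and> (\<forall>i' < i. \<forall>j < L. i' < j \<longrightarrow> ok i' j) then 1 else 0)"
        and N = L and T = "7 + L * 209"], goal_cases)
    case (3 i s')
    then show ?case using s1 xs by (auto simp: agree_off_def L_def)
  next
    case (4 i s2)
    have ag2: "agree_off {14, 15, 17} {} s s2" using s1 4(4) by (auto simp: agree_off_def)
    show ?case
    proof (rule run_For[where J = "\<lambda>j s'. regs s' 17 = (if lens \<and> (\<forall>i' < i. \<forall>j < L. i' < j \<longrightarrow> ok i' j) \<and>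
          (\<forall>j' < j. i < j' \<longrightarrow> ok i j') then 1 else 0)" and N = L and T = 200], goal_cases)
      case (2)
      then show ?case using 4(2) by simp
    next
      case (3 j s')
      then show ?case using ag2 xs by (auto simp: agree_off_def L_def)
    next
      case (4 j s3)
      have ag3: "agree_off {14, 15, 17} {} s s3" using ag2 4(4) by (auto simp: agree_off_def)
      have as: "adj_state n E s3" by (rule adj_state_agree[OF s ag3]) auto
      have regs: "regs s3 14 = i" "regs s3 15 = j" "regs s3 12 = k" "regs s3 13 = l" "regs s3 11 = L"
        using ag3 4(3,4) \<open>regs s2 14 = i\<close> kl xs by (auto simp: agree_off_def L_def)
      have arr: "arrs s3 3 i = xs ! i" "arrs s3 3 j = xs ! j" "xs ! i < n" "xs ! j < n"
        using ag3 xs(1) \<open>i < L\<close> 4(1) bound by (auto simp: agree_off_def holds_def L_def)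
      have e: "bval s3 pattern_test \<longleftrightarrow> prism_pattern k l L i j"
        unfolding pattern_test_def prism_pattern_def by (simp add: regs)
      have a: "bval s3 (adj_test (Read 3 (Reg 14)) (Read 3 (Reg 15))) \<longleftrightarrow> E (xs ! i) (xs ! j)"
        by (subst bval_adj_test[OF as]) (simp_all add: regs arr)
      have b: "bval s3 bad_pair \<longleftrightarrow> i < j \<and> \<not> ok i j"
        unfolding bad_pair_def by (simp add: e a regs arr ok_def) blast
      show ?case
      proof (rule run_wp)
        show "ccost (If bad_pair (Assign 17 (Const 0)) Skip) \<le> 200"
          by (simp add: bad_pair_def pattern_test_def)
      qed (use 4(2) in \<open>auto simp: b less_Suc_eq\<close>)
    qed (use W in \<open>auto simp: less_Suc_eq L_def\<close>)
  next
    case (7 s')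
    then show ?case using s1 good by (auto simp: agree_off_def)
  qed (use s1 W in \<open>auto simp: L_def algebra_simps\<close>)
  have r3: "run W (If (Equal (Reg 17) (Const 1)) (Assign 1 (Const 1)) Skip) 20 s2
      (\<lambda>s'. regs s' 1 = (if odd_prism_list E xs k l then 1 else regs s 1))" if "?P2 s2" for s2
    by (rule run_wp) (use that W in auto)
  show ?thesis unfolding check_def
    by (rule run_Seq[OF r1 run_Seq[OF r2 r3 order.refl]]) (auto simp: L_def algebra_simps)
qed

lemma written_check: "written_regs check = {1, 14, 15, 17}" "written_arrs check = {}"
  by (auto simp: check_def)

section \<open>Processing one guess\<close>

definition search_time :: "nat \<Rightarrow> nat" where
  "search_time n = 200 + n * (200 + n * 100 + n * n * 80)"

text \<open>\<open>R\<close> omits the end \<open>h\<close>, which is pushed separately or starts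
  the next search. With a wrong guess there may be no walk, and then nothing is said about
  \<open>R\<close>.\<close>

definition finds :: "(nat \<Rightarrow> nat \<Rightarrow> bool) \<Rightarrow> nat set \<Rightarrow> nat \<Rightarrow> nat \<Rightarrow> nat list \<Rightarrow> bool" where
  "finds E K g h R \<longleftrightarrow> ((\<exists>w. reachable_walk E K g h w) \<longrightarrow> shortest E K g h (R @ [h]))"

abbreviation "temp_regs \<equiv> {11, 12, 13, 14, 15, 16 :: nat}"
abbreviation "temp_arrs \<equiv> {1, 2, 3 :: nat}"

lemma search_step:
  assumes s: "adj_state n E s" "\<And>u v. E u v \<Longrightarrow> E v u" "\<And>u v. E u v \<Longrightarrow> u < n"
    and s1: "agree_off temp_regs temp_arrs s s1" "masked n E K s1" "holds s1 xs" "regs s1 11 = length xs"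
    and ab: "a \<in> {3..10}" "b \<in> {3..10}" "regs s a < n" "regs s b < n"
    and W: "n * n + n + 2 + length xs \<le> W"
  shows "run W (search a b) (search_time n) s1 (\<lambda>s2. \<exists>R. finds E K (regs s a) (regs s b) R \<and>
    length R \<le> n \<and> set R \<subseteq> {..<n} \<and> holds s2 (xs @ R) \<and> regs s2 11 = length (xs @ R) \<and> masked n E K s2 \<and>
    regs s2 12 = regs s1 12 \<and> regs s2 13 = regs s1 13 \<and> agree_off temp_regs temp_arrs s s2)"
proof -
  have as: "adj_state n E s1" by (rule adj_state_agree[OF s(1) s1(1)]) auto
  have ab1: "regs s1 a = regs s a" "regs s1 b = regs s b"
    using s1(1) ab by (auto simp: agree_off_def)
  have W': "n * n \<le> W" "n + 2 \<le> W" "length xs + n + 2 \<le> W" using W by (auto intro: order_trans[rotated])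
  have ni: "a \<notin> {11, 14, 15, 16}" "b \<notin> {11, 14, 15, 16}" using ab by auto
  note R = run_search[OF as s(2,3) s1(2-4) ni ab1(1) ab(3) ab1(2) ab(4) W']
  show ?thesis unfolding search_time_def
  proof (rule run_mono[OF run_frame[OF R] order.refl])
    fix s2 assume A: "(\<exists>R. regs s2 11 = length xs + length R \<and> holds s2 (xs @ R) \<and> set R \<subseteq> {..<n} \<and> length R \<le> n \<and>
       ((\<exists>w. reachable_walk E K (regs s a) (regs s b) w) \<longrightarrow>
         shortest E K (regs s a) (regs s b) (R @ [regs s b]))) \<and>
       agree_off (written_regs (search a b)) (written_arrs (search a b)) s1 s2"
    then have ag: "agree_off {11, 14, 15, 16} {2, 3} s1 s2" by (simp add: written_search)
    then have "masked n E K s2" "regs s2 12 = regs s1 12" "regs s2 13 = regs s1 13"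
      "agree_off temp_regs temp_arrs s s2"
      using s1 by (auto simp: masked_def agree_off_def)
    then show "\<exists>R. finds E K (regs s a) (regs s b) R \<and>
      length R \<le> n \<and> set R \<subseteq> {..<n} \<and> holds s2 (xs @ R) \<and> regs s2 11 = length (xs @ R) \<and> masked n E K s2 \<and>
      regs s2 12 = regs s1 12 \<and> regs s2 13 = regs s1 13 \<and> agree_off temp_regs temp_arrs s s2"
      using A unfolding finds_def by auto
  qed
qed

text \<open>\<open>5 * n + 10\<close> bounds the listed vertices: at most \<open>n\<close> from each
  of five searches, plus a few ends and corners.\<close>

definition mask_time :: "nat \<Rightarrow> nat" where
  "mask_time n = 100 + n * (100 + 100 * (5 * n + 10))"

lemma mask_step:
  assumes s: "adj_state n E s" and s1: "agree_off temp_regs temp_arrs s s1"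
    and xs: "holds s1 xs" "set xs \<subseteq> {..<n}" "length xs \<le> 5 * n + 10"
    and hi: "\<And>s'. agree_off {14, 15} {1} s1 s' \<Longrightarrow> aval s' hi = length xs" "acost hi \<le> 3"
    and W: "n + length xs + 1 \<le> W"
  shows "run W (mask hi) (mask_time n) s1 (\<lambda>s2. masked n E (set xs) s2 \<and>
    agree_off {14, 15} {1} s1 s2 \<and> agree_off temp_regs temp_arrs s s2)"
proof -
  have as: "adj_state n E s1" by (rule adj_state_agree[OF s s1]) auto
  have W': "n \<le> W" "length xs \<le> W" "1 \<le> W" using W by auto
  have t: "100 + n * (100 + 100 * length xs) \<le> mask_time n"
    unfolding mask_time_def using xs(3) by (intro add_mono mult_le_mono) auto
  show ?thesis
    by (rule run_mono[OF run_frame[OF run_mask[OF as xs(1,2) hi W']] t])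
      (use s1 in \<open>auto simp: written_mask agree_off_def\<close>)
qed

text \<open>A guess is stored in registers 3 to 10: the first ends of the three paths, their last ends, and
  the midpoints of the first two paths.\<close>

definition first_path :: "(nat \<Rightarrow> nat \<Rightarrow> bool) \<Rightarrow> state \<Rightarrow> nat list \<Rightarrow> bool" where
  "first_path E s p \<longleftrightarrow> (\<exists>A B. p = A @ B @ [regs s 6] \<and>
     finds E {regs s 4, regs s 5, regs s 7, regs s 8} (regs s 3) (regs s 9) A \<and>
     finds E {regs s 4, regs s 5, regs s 7, regs s 8} (regs s 9) (regs s 6) B)"

definition second_path :: "(nat \<Rightarrow> nat \<Rightarrow> bool) \<Rightarrow> state \<Rightarrow> nat list \<Rightarrow> nat list \<Rightarrow> bool" where
  "second_path E s p q \<longleftrightarrow> (\<exists>A B. q = A @ B @ [regs s 7] \<and>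
     finds E (set p \<union> {regs s 5, regs s 8}) (regs s 4) (regs s 10) A \<and>
     finds E (set p \<union> {regs s 5, regs s 8}) (regs s 10) (regs s 7) B)"

definition third_path :: "(nat \<Rightarrow> nat \<Rightarrow> bool) \<Rightarrow> state \<Rightarrow> nat list \<Rightarrow> nat list \<Rightarrow> nat list \<Rightarrow> bool" where
  "third_path E s p q r \<longleftrightarrow> (\<exists>A. r = A @ [regs s 8] \<and>
     finds E (set p \<union> set q) (regs s 5) (regs s 8) A)"

definition push :: "nat \<Rightarrow> com" where
  "push x = Seq (Store 3 (Reg 11) (Reg x)) (Assign 11 (Plus (Reg 11) (Const 1)))"

text \<open>Corners that only have to be blocked are written behind the end of the list, where the next
  search overwrites them. Registers 12 and 13 record where the second and the third path start.\<close>

definition block_corners :: com where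
  "block_corners = Seq (Store 3 (Const 0) (Reg 4)) (Seq (Store 3 (Const 1) (Reg 5))
     (Seq (Store 3 (Const 2) (Reg 7)) (Store 3 (Const 3) (Reg 8))))"

definition finish_first :: com where
  "finish_first = Seq (push 6) (Seq (Assign 12 (Reg 11))
     (Seq (Store 3 (Reg 11) (Reg 5)) (Store 3 (Plus (Reg 11) (Const 1)) (Reg 8))))"

definition finish_second :: com where
  "finish_second = Seq (push 7) (Assign 13 (Reg 11))"

text \<open>One mask serves both halves of a path: first the four corners of the other paths are
  blocked, then the first path with the corners of the third, and at last the first two
  paths.\<close>

definition body :: com where
  "body = Seq block_corners (Seq (mask (Const 4)) (Seq (Assign 11 (Const 0)) (Seq (search 3 9) (Seq (search 9 6)
     (Seq finish_first (Seq (mask (Plus (Reg 11) (Const 2))) (Seq (search 4 10) (Seq (search 10 7)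
     (Seq finish_second (Seq (mask (Reg 11)) (Seq (search 5 8) (Seq (push 8) check))))))))))))"

definition body_time :: "nat \<Rightarrow> nat" where
  "body_time n = 500 + 3 * mask_time n + 5 * search_time n + (200 + (5 * n + 3) * (100 + (5 * n + 3) * 300))"

lemma written_body: "written_regs body = {1, 11, 12, 13, 14, 15, 16, 17}" "written_arrs body = {1, 2, 3}"
  by (auto simp: body_def written_mask written_search written_check block_corners_def finish_first_def finish_second_def push_def)

text \<open>Holds for right and wrong guesses alike: some lists meet the three path specifications,
  and the answer changes only if they pass the check.\<close>

lemma run_body:
  assumes s: "adj_state n E s" "\<And>u v. E u v \<Longrightarrow> E v u" "\<And>u v. E u v \<Longrightarrow> u < n"
    and c: "\<And>x. x \<in> {3..10} \<Longrightarrow> regs s x < n"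
    and W: "n * n + 8 * n + 20 \<le> W"
  shows "run W body (body_time n) s (\<lambda>s'. \<exists>p q r. first_path E s p \<and> second_path E s p q \<and>
    third_path E s p q r \<and>
    regs s' 1 = (if odd_prism_list E (p @ q @ r) (length p) (length p + length q) then 1 else regs s 1))"
proof -
  let ?B = "agree_off temp_regs temp_arrs s"
  let ?K1 = "{regs s 4, regs s 5, regs s 7, regs s 8}"
  let ?K2 = "\<lambda>p. set p \<union> {regs s 5, regs s 8}"
  let ?fits = "\<lambda>k p. length p \<le> k \<and> set p \<subseteq> {..<n}"
  have cc: "regs s 3 < n" "regs s 4 < n" "regs s 5 < n" "regs s 6 < n" "regs s 7 < n" "regs s 8 < n"
    "regs s 9 < n" "regs s 10 < n" using c by auto
  have nW: "n < W" "8 * n + 20 \<le> W" "4 \<le> W" using W by (auto intro: order_trans[rotated])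
  \<comment> \<open>\<open>P1\<close> to \<open>P13\<close> are the assertions between the fourteen
    commands of \<open>body\<close>. A search adds at most \<open>n\<close> vertices, hence
    \<open>2 * n + 1\<close> for each of the first two paths and \<open>5 * n + 3\<close> for all
    three.\<close>
  define P1 where "P1 s' \<longleftrightarrow> holds s' [regs s 4, regs s 5, regs s 7, regs s 8] \<and> ?B s'" for s'
  define P2 where "P2 s' \<longleftrightarrow> masked n E ?K1 s' \<and> ?B s'" for s'
  define P3 where "P3 s' \<longleftrightarrow> masked n E ?K1 s' \<and> regs s' 11 = 0 \<and> ?B s'" for s'
  define P4 where "P4 s' \<longleftrightarrow> (\<exists>A. finds E ?K1 (regs s 3) (regs s 9) A \<and> ?fits n A \<and>
    holds s' A \<and> regs s' 11 = length A \<and> masked n E ?K1 s' \<and> ?B s')" for s'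
  define P5 where "P5 s' \<longleftrightarrow> (\<exists>A B. finds E ?K1 (regs s 3) (regs s 9) A \<and> finds E ?K1 (regs s 9) (regs s 6) B \<and>
    ?fits (2 * n) (A @ B) \<and> holds s' (A @ B) \<and> regs s' 11 = length (A @ B) \<and> ?B s')" for s'
  define P6 where "P6 s' \<longleftrightarrow> (\<exists>p. first_path E s p \<and> ?fits (2 * n + 1) p \<and> holds s' (p @ [regs s 5, regs s 8]) \<and>
    regs s' 11 = length p \<and> regs s' 12 = length p \<and> ?B s')" for s'
  define P7 where "P7 s' \<longleftrightarrow> (\<exists>p. first_path E s p \<and> ?fits (2 * n + 1) p \<and> holds s' p \<and>
    regs s' 11 = length p \<and> regs s' 12 = length p \<and> masked n E (?K2 p) s' \<and> ?B s')" for s'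
  define P8 where "P8 s' \<longleftrightarrow> (\<exists>p A. first_path E s p \<and> ?fits (2 * n + 1) p \<and>
    finds E (?K2 p) (regs s 4) (regs s 10) A \<and> ?fits n A \<and> holds s' (p @ A) \<and>
    regs s' 11 = length (p @ A) \<and> regs s' 12 = length p \<and> masked n E (?K2 p) s' \<and> ?B s')" for s'
  define P9 where "P9 s' \<longleftrightarrow> (\<exists>p A B. first_path E s p \<and> ?fits (2 * n + 1) p \<and>
    finds E (?K2 p) (regs s 4) (regs s 10) A \<and> finds E (?K2 p) (regs s 10) (regs s 7) B \<and>
    ?fits (2 * n) (A @ B) \<and> holds s' (p @ A @ B) \<and>
    regs s' 11 = length (p @ A @ B) \<and> regs s' 12 = length p \<and> ?B s')" for s'
  define P10 where "P10 s' \<longleftrightarrow> (\<exists>p q. first_path E s p \<and> ?fits (2 * n + 1) p \<and> second_path E s p q \<and>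
    ?fits (2 * n + 1) q \<and> holds s' (p @ q) \<and> regs s' 11 = length (p @ q) \<and> regs s' 12 = length p \<and>
    regs s' 13 = length (p @ q) \<and> ?B s')" for s'
  define P11 where "P11 s' \<longleftrightarrow> (\<exists>p q. first_path E s p \<and> ?fits (2 * n + 1) p \<and> second_path E s p q \<and>
    ?fits (2 * n + 1) q \<and> holds s' (p @ q) \<and> regs s' 11 = length (p @ q) \<and> regs s' 12 = length p \<and>
    regs s' 13 = length (p @ q) \<and> masked n E (set p \<union> set q) s' \<and> ?B s')" for s'
  define P12 where "P12 s' \<longleftrightarrow> (\<exists>p q A. first_path E s p \<and> ?fits (2 * n + 1) p \<and> second_path E s p q \<and>
    ?fits (2 * n + 1) q \<and> finds E (set p \<union> set q) (regs s 5) (regs s 8) A \<and> ?fits n A \<and>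
    holds s' (p @ q @ A) \<and> regs s' 11 = length (p @ q @ A) \<and> regs s' 12 = length p \<and>
    regs s' 13 = length (p @ q) \<and> ?B s')" for s'
  define P13 where "P13 s' \<longleftrightarrow> (\<exists>p q r. first_path E s p \<and> second_path E s p q \<and> third_path E s p q r \<and>
    ?fits (5 * n + 3) (p @ q @ r) \<and> holds s' (p @ q @ r) \<and> regs s' 11 = length (p @ q @ r) \<and>
    regs s' 12 = length p \<and> regs s' 13 = length (p @ q) \<and> ?B s')" for s'
  have r1: "run W block_corners 20 s P1"
    by (rule run_wp) (use cc nW in \<open>auto simp: block_corners_def P1_def holds_def agree_off_def less_Suc_eq numeral_eq_Suc\<close>)
  have r2: "run W (mask (Const 4)) (mask_time n) s1 P2" if P: "P1 s1" for s1
  proof (rule run_mono[OF mask_step[OF s(1), where ?s1.0 = s1 and xs = "[regs s 4, regs s 5, regs s 7, regs s 8]"] order.refl])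
    show "?B s1" "holds s1 [regs s 4, regs s 5, regs s 7, regs s 8]" using P by (auto simp: P1_def)
  qed (use cc nW W in \<open>auto simp: P2_def\<close>)
  have r3: "run W (Assign 11 (Const 0)) 2 s1 P3" if P: "P2 s1" for s1
    by (rule run_wp) (use P in \<open>auto simp: P2_def P3_def masked_def agree_off_def\<close>)
  have r4: "run W (search 3 9) (search_time n) s1 P4" if P: "P3 s1" for s1
  proof (rule run_mono[OF search_step[OF s, where ?s1.0 = s1 and K = ?K1 and xs = "[]" and a = 3 and b = 9] order.refl])
    show "?B s1" "masked n E ?K1 s1" "regs s1 11 = length []" using P by (auto simp: P3_def)
  qed (use cc nW W in \<open>auto simp: P4_def holds_def\<close>)
  have r5: "run W (search 9 6) (search_time n) s1 P5" if P: "P4 s1" for s1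
  proof -
    from P obtain A where A: "finds E ?K1 (regs s 3) (regs s 9) A" "?fits n A"
      "holds s1 A" "regs s1 11 = length A" "masked n E ?K1 s1" "?B s1" unfolding P4_def by blast
    show ?thesis
    proof (rule run_mono[OF search_step[OF s A(6,5,3,4), where a = 9 and b = 6] order.refl])
      show "n * n + n + 2 + length A \<le> W" using A(2) W by linarith
      fix s2 assume "\<exists>R. finds E ?K1 (regs s 9) (regs s 6) R \<and>
        length R \<le> n \<and> set R \<subseteq> {..<n} \<and> holds s2 (A @ R) \<and> regs s2 11 = length (A @ R) \<and> masked n E ?K1 s2 \<and>
        regs s2 12 = regs s1 12 \<and> regs s2 13 = regs s1 13 \<and> ?B s2"
      then obtain R where R: "finds E ?K1 (regs s 9) (regs s 6) R"
        "length R \<le> n" "set R \<subseteq> {..<n}" "holds s2 (A @ R)" "regs s2 11 = length (A @ R)" "?B s2" by blast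
      have "?fits (2 * n) (A @ R)" using A(2) R by auto
      then show "P5 s2" using A R unfolding P5_def by blast
    qed (use cc in auto)
  qed
  have r6: "run W finish_first 40 s1 P6" if P: "P5 s1" for s1
  proof -
    from P obtain A B where A: "finds E ?K1 (regs s 3) (regs s 9) A" "finds E ?K1 (regs s 9) (regs s 6) B"
      "?fits (2 * n) (A @ B)" "holds s1 (A @ B)" "regs s1 11 = length (A @ B)" "?B s1" unfolding P5_def by blast
    define p where "p = A @ B @ [regs s 6]"
    have f: "first_path E s p" "?fits (2 * n + 1) p" using A cc by (auto simp: first_path_def p_def)
    have rg: "regs s1 5 = regs s 5" "regs s1 6 = regs s 6" "regs s1 8 = regs s 8"
      using A(6) by (auto simp: agree_off_def)
    define s5 where "s5 = set_arr 3 (Suc (length p)) (regs s 8) (set_arr 3 (length p) (regs s 5)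
      (set_reg 12 (length p) (set_reg 11 (length p) (set_arr 3 (length (A @ B)) (regs s 6) s1))))"
    have lp: "length p = Suc (length (A @ B))" by (simp add: p_def)
    have "holds s5 (p @ [regs s 5, regs s 8])"
      using A(4) unfolding holds_def s5_def p_def by (auto simp: nth_append less_Suc_eq)
    moreover have "?B s5" using A(6) by (auto simp: agree_off_def s5_def set_arr_def)
    moreover have "regs s5 11 = length p" "regs s5 12 = length p" by (simp_all add: s5_def)
    ultimately have "P6 s5" using f unfolding P6_def by blast
    then have "wp W finish_first s1 P6"
      using A(5) rg cc nW f(2) lp by (simp add: finish_first_def push_def s5_def)
    then show ?thesis by (rule run_wp) (simp add: finish_first_def push_def)
  qed
  have r7: "run W (mask (Plus (Reg 11) (Const 2))) (mask_time n) s1 P7" if P: "P6 s1" for s1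
  proof -
    from P obtain p where p: "first_path E s p" "?fits (2 * n + 1) p" "holds s1 (p @ [regs s 5, regs s 8])"
      "regs s1 11 = length p" "regs s1 12 = length p" "?B s1" unfolding P6_def by blast
    show ?thesis
    proof (rule run_mono[OF mask_step[OF s(1) p(6,3)] order.refl])
      fix s2 assume a: "masked n E (set (p @ [regs s 5, regs s 8])) s2 \<and> agree_off {14, 15} {1} s1 s2 \<and> ?B s2"
      then have "holds s2 p" "regs s2 11 = length p" "regs s2 12 = length p"
        using p by (auto simp: agree_off_def holds_def nth_append)
      moreover have "masked n E (?K2 p) s2" using a by simp
      ultimately show "P7 s2" using p a unfolding P7_def by blast
    qed (use p cc W in \<open>auto simp: agree_off_def\<close>)
  qed
  have r8: "run W (search 4 10) (search_time n) s1 P8" if P: "P7 s1" for s1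
  proof -
    from P obtain p where p: "first_path E s p" "?fits (2 * n + 1) p" "holds s1 p"
      "regs s1 11 = length p" "regs s1 12 = length p" "masked n E (?K2 p) s1" "?B s1" unfolding P7_def by blast
    show ?thesis
    proof (rule run_mono[OF search_step[OF s p(7,6,3,4), where a = 4 and b = 10] order.refl])
      show "n * n + n + 2 + length p \<le> W" using p(2) W by linarith
      fix s2 assume "\<exists>R. finds E (?K2 p) (regs s 4) (regs s 10) R \<and>
        length R \<le> n \<and> set R \<subseteq> {..<n} \<and> holds s2 (p @ R) \<and> regs s2 11 = length (p @ R) \<and> masked n E (?K2 p) s2 \<and>
        regs s2 12 = regs s1 12 \<and> regs s2 13 = regs s1 13 \<and> ?B s2"
      then show "P8 s2" using p(1,2,5) unfolding P8_def by metis
    qed (use cc in auto)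
  qed
  have r9: "run W (search 10 7) (search_time n) s1 P9" if P: "P8 s1" for s1
  proof -
    from P obtain p A where p: "first_path E s p" "?fits (2 * n + 1) p"
      "finds E (?K2 p) (regs s 4) (regs s 10) A" "?fits n A" "holds s1 (p @ A)"
      "regs s1 11 = length (p @ A)" "regs s1 12 = length p" "masked n E (?K2 p) s1" "?B s1"
      unfolding P8_def by blast
    show ?thesis
    proof (rule run_mono[OF search_step[OF s p(9,8,5,6), where a = 10 and b = 7] order.refl])
      show "n * n + n + 2 + length (p @ A) \<le> W" using p(2,4) W by simp
      fix s2 assume "\<exists>R. finds E (?K2 p) (regs s 10) (regs s 7) R \<and>
        length R \<le> n \<and> set R \<subseteq> {..<n} \<and> holds s2 ((p @ A) @ R) \<and> regs s2 11 = length ((p @ A) @ R) \<and> masked n E (?K2 p) s2 \<and>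
        regs s2 12 = regs s1 12 \<and> regs s2 13 = regs s1 13 \<and> ?B s2"
      then obtain R where R: "finds E (?K2 p) (regs s 10) (regs s 7) R"
        "length R \<le> n" "set R \<subseteq> {..<n}" "holds s2 (p @ A @ R)" "regs s2 11 = length (p @ A @ R)"
        "regs s2 12 = length p" "?B s2" using p(7) unfolding append_assoc by auto
      have "?fits (2 * n) (A @ R)" using p(4) R by auto
      then show "P9 s2" using p(1-3) R unfolding P9_def by blast
    qed (use cc in auto)
  qed
  have r10: "run W finish_second 20 s1 P10" if P: "P9 s1" for s1
  proof -
    from P obtain p A B where A: "first_path E s p" "?fits (2 * n + 1) p"
      "finds E (?K2 p) (regs s 4) (regs s 10) A" "finds E (?K2 p) (regs s 10) (regs s 7) B"
      "?fits (2 * n) (A @ B)" "holds s1 (p @ A @ B)"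
      "regs s1 11 = length (p @ A @ B)" "regs s1 12 = length p" "?B s1" unfolding P9_def by blast
    define q where "q = A @ B @ [regs s 7]"
    have f: "second_path E s p q" "?fits (2 * n + 1) q" using A cc by (auto simp: second_path_def q_def)
    have rg: "regs s1 7 = regs s 7" using A(9) by (auto simp: agree_off_def)
    define s5 where "s5 = set_reg 13 (length (p @ q)) (set_reg 11 (length (p @ q))
      (set_arr 3 (length (p @ A @ B)) (regs s 7) s1))"
    have lp: "length (p @ q) = Suc (length (p @ A @ B))" by (simp add: q_def)
    have "holds s5 ((p @ A @ B) @ [regs s 7])"
      using A(6) unfolding holds_def s5_def by (auto simp: nth_append less_Suc_eq)
    then have "holds s5 (p @ q)" by (simp add: q_def)
    moreover have "?B s5" using A(9) by (auto simp: agree_off_def s5_def set_arr_def)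
    moreover have "regs s5 11 = length (p @ q)" "regs s5 12 = length p" "regs s5 13 = length (p @ q)"
      using A(8) by (simp_all add: s5_def)
    ultimately have "P10 s5" using A(1,2) f unfolding P10_def by blast
    then have "wp W finish_second s1 P10"
      using A(2,5,7) rg cc nW lp by (simp add: finish_second_def push_def s5_def)
    then show ?thesis by (rule run_wp) (simp add: finish_second_def push_def)
  qed
  have r11: "run W (mask (Reg 11)) (mask_time n) s1 P11" if P: "P10 s1" for s1
  proof -
    from P obtain p q where p: "first_path E s p" "?fits (2 * n + 1) p" "second_path E s p q"
      "?fits (2 * n + 1) q" "holds s1 (p @ q)" "regs s1 11 = length (p @ q)" "regs s1 12 = length p"
      "regs s1 13 = length (p @ q)" "?B s1" unfolding P10_def by blast
    show ?thesis
    proof (rule run_mono[OF mask_step[OF s(1) p(9,5)] order.refl])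
      fix s2 assume a: "masked n E (set (p @ q)) s2 \<and> agree_off {14, 15} {1} s1 s2 \<and> ?B s2"
      then have "holds s2 (p @ q)" "regs s2 11 = length (p @ q)" "regs s2 12 = length p" "regs s2 13 = length (p @ q)"
        using p by (auto simp: agree_off_def holds_def)
      moreover have "masked n E (set p \<union> set q) s2" using a by simp
      ultimately show "P11 s2" using p(1-4) a unfolding P11_def by blast
    qed (use p cc W in \<open>auto simp: agree_off_def\<close>)
  qed
  have r12: "run W (search 5 8) (search_time n) s1 P12" if P: "P11 s1" for s1
  proof -
    from P obtain p q where p: "first_path E s p" "?fits (2 * n + 1) p" "second_path E s p q"
      "?fits (2 * n + 1) q" "holds s1 (p @ q)" "regs s1 11 = length (p @ q)" "regs s1 12 = length p"
      "regs s1 13 = length (p @ q)" "masked n E (set p \<union> set q) s1" "?B s1" unfolding P11_def by blast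
    show ?thesis
    proof (rule run_mono[OF search_step[OF s p(10,9,5,6), where a = 5 and b = 8] order.refl])
      show "n * n + n + 2 + length (p @ q) \<le> W" using p(2,4) W by simp
      fix s2 assume "\<exists>R. finds E (set p \<union> set q) (regs s 5) (regs s 8) R \<and>
        length R \<le> n \<and> set R \<subseteq> {..<n} \<and> holds s2 ((p @ q) @ R) \<and> regs s2 11 = length ((p @ q) @ R) \<and>
        masked n E (set p \<union> set q) s2 \<and>
        regs s2 12 = regs s1 12 \<and> regs s2 13 = regs s1 13 \<and> ?B s2"
      then show "P12 s2" using p(1-4,7,8) unfolding P12_def append_assoc by metis
    qed (use cc in auto)
  qed
  have r13: "run W (push 8) 20 s1 P13" if P: "P12 s1" for s1
  proof -
    from P obtain p q A where A: "first_path E s p" "?fits (2 * n + 1) p" "second_path E s p q"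
      "?fits (2 * n + 1) q" "finds E (set p \<union> set q) (regs s 5) (regs s 8) A" "?fits n A"
      "holds s1 (p @ q @ A)" "regs s1 11 = length (p @ q @ A)" "regs s1 12 = length p"
      "regs s1 13 = length (p @ q)" "?B s1" unfolding P12_def by blast
    define r where "r = A @ [regs s 8]"
    have f: "third_path E s p q r" "?fits (5 * n + 3) (p @ q @ r)"
      using A(2,4,5,6) cc by (auto simp: third_path_def r_def)
    have rg: "regs s1 8 = regs s 8" using A(11) by (auto simp: agree_off_def)
    define s5 where "s5 = set_reg 11 (length (p @ q @ r)) (set_arr 3 (length (p @ q @ A)) (regs s 8) s1)"
    have lp: "length (p @ q @ r) = Suc (length (p @ q @ A))" by (simp add: r_def)
    have "holds s5 ((p @ q @ A) @ [regs s 8])"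
      using A(7) unfolding holds_def s5_def by (auto simp: nth_append less_Suc_eq)
    then have "holds s5 (p @ q @ r)" by (simp add: r_def)
    moreover have "?B s5" using A(11) by (auto simp: agree_off_def s5_def set_arr_def)
    moreover have "regs s5 11 = length (p @ q @ r)" "regs s5 12 = length p" "regs s5 13 = length (p @ q)"
      using A(9,10) by (simp_all add: s5_def)
    ultimately have "P13 s5" using A(1,3) f unfolding P13_def by blast
    then have "wp W (push 8) s1 P13"
      using A(2,4,6,8) rg cc nW lp by (simp add: push_def s5_def)
    then show ?thesis by (rule run_wp) (simp add: push_def)
  qed
  let ?Q = "\<lambda>s'. \<exists>p q r. first_path E s p \<and> second_path E s p q \<and> third_path E s p q r \<and>
    regs s' 1 = (if odd_prism_list E (p @ q @ r) (length p) (length p + length q) then 1 else regs s 1)"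
  have r14: "run W check (200 + (5 * n + 3) * (100 + (5 * n + 3) * 300)) s1 ?Q" if P: "P13 s1" for s1
  proof -
    from P obtain p q r where p: "first_path E s p" "second_path E s p q" "third_path E s p q r"
      "?fits (5 * n + 3) (p @ q @ r)" "holds s1 (p @ q @ r)" "regs s1 11 = length (p @ q @ r)"
      "regs s1 12 = length p" "regs s1 13 = length (p @ q)" "?B s1" unfolding P13_def by blast
    have as: "adj_state n E s1" by (rule adj_state_agree[OF s(1) p(9)]) auto
    have r1: "regs s1 1 = regs s 1" using p(9) by (auto simp: agree_off_def)
    have lW: "length (p @ q @ r) \<le> W" "1 \<le> W" using p(4) W by linarith+
    have t: "200 + length (p @ q @ r) * (100 + length (p @ q @ r) * 300)
        \<le> 200 + (5 * n + 3) * (100 + (5 * n + 3) * 300)"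
      using p(4) by (intro add_mono mult_le_mono) auto
    show ?thesis
      by (rule run_mono[OF run_check[OF as p(5,6) _ p(7,8) lW] t]) (use p r1 in auto)
  qed
  note q13 = run_Seq[OF r13 r14 order.refl]
  note q12 = run_Seq[OF r12 q13 order.refl]
  note q11 = run_Seq[OF r11 q12 order.refl]
  note q10 = run_Seq[OF r10 q11 order.refl]
  note q9 = run_Seq[OF r9 q10 order.refl]
  note q8 = run_Seq[OF r8 q9 order.refl]
  note q7 = run_Seq[OF r7 q8 order.refl]
  note q6 = run_Seq[OF r6 q7 order.refl]
  note q5 = run_Seq[OF r5 q6 order.refl]
  note q4 = run_Seq[OF r4 q5 order.refl]
  note q3 = run_Seq[OF r3 q4 order.refl]
  note q2 = run_Seq[OF r2 q3 order.refl]
  show ?thesis unfolding body_def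
    by (rule run_Seq[OF r1 q2]) (simp_all add: body_time_def)
qed

definition guessed :: "state \<Rightarrow> nat list \<Rightarrow> nat list \<Rightarrow> nat list \<Rightarrow> bool" where
  "guessed s p q r \<longleftrightarrow> regs s 3 = hd p \<and> regs s 4 = hd q \<and> regs s 5 = hd r \<and>
     regs s 6 = last p \<and> regs s 7 = last q \<and> regs s 8 = last r \<and>
     regs s 9 = p ! (length p div 2) \<and> regs s 10 = q ! (length q div 2)"

text \<open>The first step exchanges \<open>p\<close> only, so the guessed ends and the midpoint of
  \<open>q\<close> also fit the new minimal prism. The second step reads it as \<open>q\<close>,
  \<open>p'\<close>, \<open>r\<close>; there \<open>length q <= length r\<close> is the order
  required, and all of \<open>p'\<close> is blocked. The third step needs only that
  \<open>p'\<close>, \<open>q'\<close>, \<open>r\<close> form a prism.\<close>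

lemma guessed_finds_prism:
  assumes "no_odd_hole E"
    and M: "no_odd_hole.minimal_odd E p q r" and le: "length p \<le> length q" "length q \<le> length r"
    and g: "guessed s p q r"
    and paths: "first_path E s p'" "second_path E s p' q'" "third_path E s p' q' r'"
  shows "prism E p' q' r' \<and> even (length p') \<and> even (length q') \<and> even (length r')"
proof -
  interpret no_odd_hole E by fact
  have G: "regs s 3 = hd p" "regs s 4 = hd q" "regs s 5 = hd r" "regs s 6 = last p" "regs s 7 = last q"
    "regs s 8 = last r" "regs s 9 = p ! (length p div 2)" "regs s 10 = q ! (length q div 2)"
    using g by (simp_all add: guessed_def)
  have M1: "minimal_odd p q r" by (rule M)
  have le1: "length p \<le> length r" using le by simp
  let ?K1 = "{hd q, hd r, last q, last r}"
  have K1: "?K1 = {hd q, hd r, last q, last r} \<and> length p \<le> length q \<or> ?K1 = set q \<union> {hd r, last r}"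
    using le by simp
  note H1 = replace_halves[OF M1 le1 K1 refl]
  from paths(1) obtain A B where A: "p' = A @ B @ [last p]"
    "finds E ?K1 (hd p) (p ! (length p div 2)) A" "finds E ?K1 (p ! (length p div 2)) (last p) B"
    unfolding first_path_def G by blast
  have sA: "shortest E ?K1 (hd p) (p ! (length p div 2)) (A @ [p ! (length p div 2)])"
    using A(2) H1(1) unfolding finds_def by blast
  have sB: "shortest E ?K1 (p ! (length p div 2)) (last p) (B @ [last p])"
    using A(3) H1(2)[OF sA] unfolding finds_def by blast
  have M2: "minimal_odd p' q r" "length p' = length p"
    using H1(3)[OF sA sB] A(1) by simp_all
  let ?K2 = "set p' \<union> {hd r, last r}"
  have K2: "?K2 = {hd p', hd r, last p', last r} \<and> length q \<le> length p' \<or> ?K2 = set p' \<union> {hd r, last r}"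
    by simp
  note H2 = replace_halves[OF minimal_odd_sym(1)[OF M2(1)] le(2) K2 refl]
  from paths(2) obtain C D where C: "q' = C @ D @ [last q]"
    "finds E ?K2 (hd q) (q ! (length q div 2)) C" "finds E ?K2 (q ! (length q div 2)) (last q) D"
    unfolding second_path_def G by blast
  have sC: "shortest E ?K2 (hd q) (q ! (length q div 2)) (C @ [q ! (length q div 2)])"
    using C(2) H2(1) unfolding finds_def by blast
  have sD: "shortest E ?K2 (q ! (length q div 2)) (last q) (D @ [last q])"
    using C(3) H2(2)[OF sC] unfolding finds_def by blast
  have M3: "minimal_odd q' p' r"
    using H2(3)[OF sC sD] C(1) by simp
  then have M4: "minimal_odd p' q' r" by (rule minimal_odd_sym(1))
  note m4 = minimal_oddD[OF M4]
  from paths(3) obtain F where F: "r' = F @ [last r]" "finds E (set p' \<union> set q') (hd r) (last r) F"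
    unfolding third_path_def G by blast
  have "shortest E (set p' \<union> set q') (hd r) (last r) r'"
    using F replace_third(1)[OF m4(1) refl] unfolding finds_def by blast
  then have "prism E p' q' r'" by (rule replace_third(2)[OF m4(1) refl])
  then show ?thesis using m4(2) prism_parity by blast
qed

section \<open>Enumerating all guesses\<close>

fun shifted :: "nat \<Rightarrow> aexp" where
  "shifted 0 = Reg 2"
| "shifted (Suc k) = Div (shifted k) (Reg 0)"

lemma aval_shifted: "aval s (shifted k) = regs s 2 div regs s 0 ^ k"
  by (induction k) (simp_all add: mult.commute flip: div_mult2_eq)

lemma acost_shifted [simp]: "acost (shifted k) = 1 + 2 * k"
  by (induction k) auto

text \<open>Register \<open>3 + k\<close> receives the digit of weight \<open>n ^ k\<close> of the
  guess number in register 2.\<close>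

primrec decode :: "nat \<Rightarrow> com" where
  "decode 0 = Skip"
| "decode (Suc k) = Seq (decode k) (Assign (3 + k) (Mod (shifted k) (Reg 0)))"

lemma written_decode: "written_regs (decode k) = {3..<3 + k}" "written_arrs (decode k) = {}"
  by (induction k) auto

lemma run_decode:
  assumes "0 < n" "n \<le> W" "regs s 0 = n"
  shows "run W (decode k) (1 + k * (5 + 2 * k)) s (\<lambda>s'.
    (\<forall>j < k. regs s' (3 + j) = regs s 2 div n ^ j mod n) \<and> agree_off {3..<3 + k} {} s s')"
proof (induction k)
  case 0
  then show ?case by (intro run_wp) (auto simp: agree_off_def)
next
  case (Suc k)
  show ?case unfolding decode.simps
  proof (rule run_Seq[OF Suc.IH])
    fix s1 assume s1: "(\<forall>j < k. regs s1 (3 + j) = regs s 2 div n ^ j mod n) \<and> agree_off {3..<3 + k} {} s s1"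
    then have r: "regs s1 2 = regs s 2" "regs s1 0 = n" using assms by (auto simp: agree_off_def)
    have "regs s 2 div n ^ k mod n \<le> W" using assms(1,2) by (meson le_trans less_imp_le mod_less_divisor)
    then show "run W (Assign (3 + k) (Mod (shifted k) (Reg 0))) (4 + 2 * k) s1 (\<lambda>s'.
      (\<forall>j < Suc k. regs s' (3 + j) = regs s 2 div n ^ j mod n) \<and> agree_off {3..<3 + Suc k} {} s s')"
      using s1 by (intro run_wp) (auto simp: aval_shifted r less_Suc_eq agree_off_def)
  qed (simp add: algebra_simps)
qed

text \<open>Every choice of vertices is the base \<open>n\<close> expansion of some counter value,
  so the loop misses no guess.\<close>

lemma digits_exist:
  fixes f :: "nat \<Rightarrow> nat"
  assumes "\<And>k. k < m \<Longrightarrow> f k < n"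
  shows "\<exists>g < n ^ m. \<forall>k < m. g div n ^ k mod n = f k"
  using assms
proof (induction m arbitrary: f)
  case (Suc m)
  from Suc.IH[of "\<lambda>k. f (Suc k)"] Suc.prems obtain g
    where g: "g < n ^ m" "\<And>k. k < m \<Longrightarrow> g div n ^ k mod n = f (Suc k)" by auto
  have f0: "f 0 < n" using Suc.prems by simp
  let ?g = "f 0 + g * n"
  have "?g < n + g * n" using f0 by simp
  also have "\<dots> = Suc g * n" by simp
  also have "\<dots> \<le> n ^ m * n" using g(1) by (intro mult_le_mono1) simp
  finally have "?g < n ^ Suc m" by (simp add: mult.commute)
  moreover have "?g div n ^ k mod n = f k" if "k < Suc m" for k
  proof (cases k)
    case 0
    then show ?thesis using f0 by simp
  next
    case (Suc j)
    have "?g div n = g" using f0 by simp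
    then have "?g div n ^ k = g div n ^ j" using Suc by (simp add: div_mult2_eq)
    then show ?thesis using g(2)[of j] Suc that by simp
  qed
  ultimately show ?case by blast
qed simp

text \<open>Three squarings within one expression of 15 nodes, evaluated at each test of the outer
  loop.\<close>

definition power8 :: aexp where
  "power8 = (let s = Times (Reg 0) (Reg 0); q = Times s s in Times q q)"

definition odd_prism_program :: com where
  "odd_prism_program = For 2 power8 (Seq (decode 8) body)"

text \<open>\<open>21\<close> is the fixed cost of the outer loop with its bound of cost 15;
  \<open>200\<close> covers the cost per round and the decoding of a guess, which takes 169.\<close>

definition odd_prism_time :: "nat \<Rightarrow> nat" where
  "odd_prism_time n = 21 + n ^ 8 * (200 + body_time n)"

lemma odd_prism_time_bigo: "(\<lambda>n. real (odd_prism_time n)) \<in> O(\<lambda>n. real n ^ 20)"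
  unfolding odd_prism_time_def body_time_def mask_time_def search_time_def of_nat_add of_nat_mult of_nat_power of_nat_numeral
  by real_asymp

text \<open>The invariant has two halves: the answer is 1 only if an odd prism exists, and it is 1
  once a number has been passed that encodes the corners and midpoints of a sorted minimal odd
  prism. Such a number below \<open>n ^ 8\<close> exists as soon as there is an odd prism.\<close>

lemma run_odd_prism_program:
  assumes hole: "no_odd_hole E" and E: "\<And>u v. E u v \<Longrightarrow> u < n"
    and s: "adj_state n E s" "regs s 1 = 0"
    and W: "n * n + 8 * n + 20 \<le> W" "n ^ 8 \<le> W"
  shows "run W odd_prism_program (odd_prism_time n) s (\<lambda>s'.
    regs s' 1 = (if \<exists>p q r. prism E p q r \<and> even (length p) then 1 else 0))"
proof -
  interpret no_odd_hole E by fact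
  define yes where "yes \<longleftrightarrow> (\<exists>p q r. prism E p q r \<and> even (length p))"
  define hit where "hit g \<longleftrightarrow> (\<exists>p q r. minimal_odd p q r \<and> length p \<le> length q \<and> length q \<le> length r \<and>
    (\<forall>k < 8. g div n ^ k mod n = [hd p, hd q, hd r, last p, last q, last r,
      p ! (length p div 2), q ! (length q div 2)] ! k))" for g
  let ?J = "\<lambda>(i :: nat) (s' :: state). (regs s' 1 = 0 \<or> regs s' 1 = 1) \<and> (regs s' 1 = 1 \<longrightarrow> yes) \<and>
    (\<forall>g < i. hit g \<longrightarrow> regs s' 1 = 1)"
  have r0: "regs s 0 = n" using s by (simp add: adj_state_def)
  have wr: "written_regs (Seq (decode 8) body) = {3..<11} \<union> {1, 11, 12, 13, 14, 15, 16, 17}"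
    "written_arrs (Seq (decode 8) body) = {1, 2, 3}"
    by (auto simp: written_decode written_body)
  have p8: "aval s' power8 = regs s' 0 ^ 8" for s'
    by (simp add: power8_def Let_def eval_nat_numeral)
  have ac: "acost power8 = 15" by (simp add: power8_def Let_def)
  show ?thesis unfolding odd_prism_program_def
  proof (rule run_For[where J = ?J and N = "n ^ 8" and T = "170 + body_time n"], goal_cases)
    case 1
    then show ?case unfolding wr by auto
  next
    case 2
    then show ?case using s by simp
  next
    case (3 i s')
    then show ?case unfolding wr by (auto simp: p8 agree_off_def r0)
  next
    case (4 i s1)
    have n0: "0 < n" using 4(1) by (cases n) auto
    have ag: "agree_off (insert 2 ({3..<11} \<union> {1, 11, 12, 13, 14, 15, 16, 17})) {1, 2, 3} s s1"
      using 4(4) unfolding wr .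
    have as: "adj_state n E s1" by (rule adj_state_agree[OF s(1) ag]) auto
    have "n \<le> W" using W(1) by linarith
    moreover have "regs s1 0 = n" using as by (simp add: adj_state_def)
    ultimately have d: "run W (decode 8) 169 s1 (\<lambda>s'. (\<forall>j < 8. regs s' (3 + j) = regs s1 2 div n ^ j mod n) \<and>
      agree_off {3..<3 + 8} {} s1 s')" (is "run W _ _ _ ?D")
      using run_mono[OF run_decode[OF n0, of W s1 8], where t' = 169] by simp
    show ?case
    proof (rule run_Seq[OF d])
      fix s2 assume s2: "?D s2"
      have dig: "regs s2 (3 + j) = i div n ^ j mod n" if "j < 8" for j using s2 4(3) that by simp
      have as2: "adj_state n E s2" using adj_state_agree[OF as conjunct2[OF s2]] by simp
      have r1: "regs s2 1 = regs s1 1" using s2 by (simp add: agree_off_def)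
      have bd: "regs s2 x < n" if "x \<in> {3..10}" for x
      proof -
        have "regs s2 (3 + (x - 3)) < n" using dig[of "x - 3"] that n0 by auto
        then show ?thesis using that by simp
      qed
      show "run W body (body_time n) s2 (\<lambda>s''. ?J (Suc i) (set_reg 2 (Suc i) s''))"
      proof (rule run_mono[OF run_body[OF as2 E_sym E bd W(1)] order.refl])
        fix s3 :: state assume "\<exists>p q r. first_path E s2 p \<and> second_path E s2 p q \<and> third_path E s2 p q r \<and>
          regs s3 1 = (if odd_prism_list E (p @ q @ r) (length p) (length p + length q) then 1 else regs s2 1)"
        then obtain p' q' r' where P: "first_path E s2 p'" "second_path E s2 p' q'" "third_path E s2 p' q' r'"
          and a: "regs s3 1 = (if odd_prism_list E (p' @ q' @ r') (length p') (length p' + length q') then 1 else regs s1 1)"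
          using r1 by auto
        have 1: "odd_prism_list E (p' @ q' @ r') (length p') (length p' + length q') \<Longrightarrow> yes"
          unfolding odd_prism_list_iff yes_def by blast
        have 2: "odd_prism_list E (p' @ q' @ r') (length p') (length p' + length q')" if h: "hit i"
        proof -
          from h obtain p q r where M: "minimal_odd p q r" and le: "length p \<le> length q" "length q \<le> length r"
            and dg: "\<forall>k < 8. i div n ^ k mod n = [hd p, hd q, hd r, last p, last q, last r,
              p ! (length p div 2), q ! (length q div 2)] ! k" unfolding hit_def by blast
          have "regs s2 (3 + k) = [hd p, hd q, hd r, last p, last q, last r,
              p ! (length p div 2), q ! (length q div 2)] ! k" if "k < 8" for k
            using dig[OF that] dg that by simp
          from this[of 0] this[of 1] this[of 2] this[of 3] this[of 4] this[of 5] this[of 6] this[of 7]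
          have "guessed s2 p q r" by (simp add: guessed_def)
          from guessed_finds_prism[OF hole M le this P] show ?thesis unfolding odd_prism_list_iff .
        qed
        show "?J (Suc i) (set_reg 2 (Suc i) s3)"
          using a 1 2 4(2) by (auto simp: less_Suc_eq)
      qed
    qed simp
  next
    case 5
    then show ?case by (rule W(2))
  next
    case 6
    then show ?case unfolding ac odd_prism_time_def by (simp add: algebra_simps)
  next
    case (7 s')
    have "regs s' 1 = 1" if yes
    proof -
      from that obtain p0 q0 r0 where "prism E p0 q0 r0" "even (length p0)" unfolding yes_def by blast
      from minimal_odd_exists[OF this] obtain p q r
        where M: "minimal_odd p q r" and le: "length p \<le> length q" "length q \<le> length r" by metis
      note P = minimal_oddD(1)[OF M]
      \<comment> \<open>Every vertex of a prism has a neighbour, and \<open>E\<close> relates only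
        numbers below \<open>n\<close>.\<close>
      have inn: "x < n" if "x \<in> set k" "k = p \<or> k = q \<or> k = r" for x k
        using neighbour_in_path[of k x] P that E unfolding prism_def by blast
      have ne: "p \<noteq> []" "q \<noteq> []" "r \<noteq> []" using P unfolding prism_def by auto
      let ?f = "\<lambda>k. [hd p, hd q, hd r, last p, last q, last r, p ! (length p div 2), q ! (length q div 2)] ! k"
      have mem: "x < n" if "x \<in> set [hd p, hd q, hd r, last p, last q, last r, p ! (length p div 2), q ! (length q div 2)]" for x
      proof -
        have "p ! (length p div 2) \<in> set p" "q ! (length q div 2) \<in> set q" using ne by (auto intro!: nth_mem)
        then have "x \<in> set p \<union> set q \<union> set r" using that ne by auto
        then show ?thesis using inn by blast
      qed
      have "?f k < n" if "k < 8" for k by (rule mem, rule nth_mem) (use that in simp)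
      from digits_exist[of 8 ?f n, OF this] obtain g where g: "g < n ^ 8" "\<forall>k < 8. g div n ^ k mod n = ?f k"
        by blast
      then have "hit g" unfolding hit_def using M le by blast
      then show ?thesis using 7(1) g(1) by blast
    qed
    then show ?case using 7(1) unfolding yes_def[symmetric] by auto
  qed
qed

section \<open>Translation to induced subgraphs, holes and prisms of a graph\<close>

lemma simple_graph_no_odd_hole:
  assumes G: "simple_graph G" and h: "\<not> contains is_odd_hole G"
  shows "no_odd_hole (adj G)"
proof
  show "adj G u v \<Longrightarrow> adj G v u" for u v using G by (simp add: simple_graph_def)
  show "\<not> adj G u u" for u using G by (simp add: simple_graph_def)
  fix c assume c: "4 \<le> length c" "distinct c"
    "\<And>i j. i < length c \<Longrightarrow> j < length c \<Longrightarrow>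
      adj G (c ! i) (c ! j) \<longleftrightarrow> j = Suc i mod length c \<or> i = Suc j mod length c"
  have sub: "set c \<subseteq> verts G"
  proof
    fix x assume "x \<in> set c"
    then obtain i where i: "i < length c" "x = c ! i" by (auto simp: in_set_conv_nth)
    moreover have "Suc i mod length c < length c" using c(1) by (intro mod_less_divisor) linarith
    ultimately have "adj G (c ! i) (c ! (Suc i mod length c))" using c(3) by blast
    then show "x \<in> verts G" using G i(2) unfolding simple_graph_def by blast
  qed
  then have "is_hole (induced G (set c)) c"
    using c by (auto simp: is_hole_def induced_def)
  then show "even (length c)" using h sub unfolding contains_def is_odd_hole_def by blast
qed

text \<open>\<open>is_path\<close> tests all ordered pairs of positions and
  \<open>chordless_nth\<close> only increasing ones; symmetry and the absence of loops make up the
  difference.\<close>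

lemma is_path_induced:
  assumes G: "simple_graph G" and p: "set p \<subseteq> verts G"
  shows "is_path (induced G (set p)) p \<longleftrightarrow> p \<noteq> [] \<and> chordless (adj G) p"
proof -
  have sym: "adj G u v \<longleftrightarrow> adj G v u" and irr: "\<not> adj G u u" for u v
    using G unfolding simple_graph_def by blast+
  have 1: "is_path (induced G (set p)) p \<longleftrightarrow> p \<noteq> [] \<and> distinct p \<and>
     (\<forall>i < length p. \<forall>j < length p. adj G (p ! i) (p ! j) \<longleftrightarrow> j = Suc i \<or> i = Suc j)"
    using p unfolding is_path_def induced_def by auto
  have 2: "distinct p \<and> (\<forall>i < length p. \<forall>j < length p. adj G (p ! i) (p ! j) \<longleftrightarrow> j = Suc i \<or> i = Suc j)
    \<longleftrightarrow> chordless (adj G) p" (is "?L \<longleftrightarrow> _")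
  proof
    assume ?L
    then show "chordless (adj G) p" unfolding chordless_nth by (auto simp: nth_eq_iff_index_eq)
  next
    assume c: "chordless (adj G) p"
    have "adj G (p ! i) (p ! j) \<longleftrightarrow> j = Suc i \<or> i = Suc j" if ij: "i < length p" "j < length p" for i j
    proof -
      consider "i < j" | "i = j" | "j < i" by linarith
      then show ?thesis
      proof cases
        case 1
        then show ?thesis using c ij unfolding chordless_nth by auto
      next
        case 2
        then show ?thesis using irr by simp
      next
        case 3
        then have "adj G (p ! j) (p ! i) \<longleftrightarrow> i = Suc j" using c ij unfolding chordless_nth by blast
        then show ?thesis using 3 sym[of "p ! i" "p ! j"] by auto
      qed
    qed
    then show ?L using chordless_distinct[OF c] by blast
  qed
  show ?thesis using 1 2 by blast
qed

text \<open>A path inside \<open>induced G X\<close> is induced by its vertex set in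
  \<open>G\<close> directly, as inducing twice is inducing once. Conversely each vertex of a prism
  has a neighbour and so belongs to \<open>verts G\<close>, which makes the union of the paths an
  admissible \<open>X\<close>.\<close>

lemma contains_odd_prism_iff:
  assumes G: "simple_graph G"
  shows "contains is_odd_prism G \<longleftrightarrow>
    (\<exists>p q r. prism (adj G) p q r \<and> even (length p) \<and> even (length q) \<and> even (length r))"
proof
  assume "contains is_odd_prism G"
  then obtain X P where X: "X \<subseteq> verts G" and P: "is_prism (induced G X) P"
    and o: "\<forall>i<3. odd (path_length (P i))" unfolding contains_def is_odd_prism_def by blast
  have sub: "set (P i) \<subseteq> X" if "i < 3" for i
    using P that X unfolding is_prism_def induced_def by auto
  have path: "chordless (adj G) (P i) \<and> 2 \<le> length (P i) \<and> even (length (P i))" if i: "i < 3" for i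
  proof -
    have "induced (induced G X) (set (P i)) = induced G (set (P i))"
      using sub[OF i] X unfolding induced_def by auto
    moreover have "set (P i) \<subseteq> verts G" using sub[OF i] X by blast
    ultimately have "chordless (adj G) (P i)" "1 \<le> path_length (P i)"
      using P i is_path_induced[OF G] unfolding is_prism_def by auto
    moreover have "odd (path_length (P i))" using o i by blast
    ultimately show ?thesis unfolding path_length_def by (auto simp: even_diff_nat)
  qed
  have lad: "ladder (adj G) (P i) (P j)" if ij: "i < 3" "j < 3" "i \<noteq> j" for i j
  proof -
    have "set (P i) \<inter> set (P j) = {}" and
      e: "\<forall>u \<in> set (P i). \<forall>v \<in> set (P j). adj (induced G X) u v \<longleftrightarrow>
             u = hd (P i) \<and> v = hd (P j) \<or> u = last (P i) \<and> v = last (P j)"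
      using P ij unfolding is_prism_def by blast+
    moreover have "adj (induced G X) u v \<longleftrightarrow> adj G u v" if "u \<in> set (P i)" "v \<in> set (P j)" for u v
      using that sub ij unfolding induced_def by auto
    ultimately show ?thesis unfolding ladder_def by blast
  qed
  have "prism (adj G) (P 0) (P 1) (P 2)"
    unfolding prism_def using path[of 0] path[of 1] path[of 2] lad[of 0 1] lad[of 0 2] lad[of 1 2] by simp
  then show "\<exists>p q r. prism (adj G) p q r \<and> even (length p) \<and> even (length q) \<and> even (length r)"
    using path[of 0] path[of 1] path[of 2] by auto
next
  assume "\<exists>p q r. prism (adj G) p q r \<and> even (length p) \<and> even (length q) \<and> even (length r)"
  then obtain p q r where pr: "prism (adj G) p q r" and ev: "even (length p)" "even (length q)" "even (length r)"
    by blast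
  have sym: "adj G u v \<Longrightarrow> adj G v u" and irr: "\<not> adj G u u" and inn: "adj G u v \<Longrightarrow> u \<in> verts G" for u v
    using G unfolding simple_graph_def by blast+
  interpret graph "adj G" by unfold_locales (use sym irr in auto)
  define P where "P i = (if i = 0 then p else if i = 1 then q else r)" for i :: nat
  define X where "X = set p \<union> set q \<union> set r"
  have i3: "i < 3 \<longleftrightarrow> i = 0 \<or> i = 1 \<or> i = (2 :: nat)" for i by auto
  have ch: "chordless (adj G) (P i) \<and> 2 \<le> length (P i) \<and> even (length (P i))" if "i < 3" for i
    using pr ev that unfolding prism_def P_def by auto
  have nb: "x \<in> verts G" if "chordless (adj G) l" "2 \<le> length l" "x \<in> set l" for x l
    using neighbour_in_path[OF that] inn by blast
  have sub: "set (P i) \<subseteq> X" if "i < 3" for i unfolding P_def X_def by auto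
  have XG: "X \<subseteq> verts G" using nb pr unfolding X_def prism_def by blast
  have lad: "ladder (adj G) (P i) (P j)" if "i < 3" "j < 3" "i \<noteq> j" for i j
    using pr prism_perm[OF pr] that unfolding prism_def P_def i3 by auto
  have "is_prism (induced G X) P"
    unfolding is_prism_def
  proof (intro conjI allI impI)
    show "verts (induced G X) = (\<Union>i<3. set (P i))"
      using XG by (auto simp: induced_def X_def P_def i3 Bex_def split: if_splits)
  next
    fix i :: nat assume i: "i < 3"
    have "induced (induced G X) (set (P i)) = induced G (set (P i))"
      using sub[OF i] XG unfolding induced_def by auto
    moreover have "set (P i) \<subseteq> verts G" using sub[OF i] XG by blast
    ultimately show "is_path (induced (induced G X) (set (P i))) (P i)"
      using is_path_induced[OF G] ch[OF i] by auto
    show "1 \<le> path_length (P i)" using ch[OF i] unfolding path_length_def by linarith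
  next
    fix i j :: nat assume ij: "i < 3" "j < 3" "i \<noteq> j"
    show "set (P i) \<inter> set (P j) = {}" using lad[OF ij] unfolding ladder_def by blast
    show "\<forall>u \<in> set (P i). \<forall>v \<in> set (P j). adj (induced G X) u v \<longleftrightarrow>
             u = hd (P i) \<and> v = hd (P j) \<or> u = last (P i) \<and> v = last (P j)"
      using lad[OF ij] sub ij unfolding ladder_def induced_def by auto
  qed
  moreover have "odd (path_length (P i))" if "i < 3" for i
    using ch[OF that] by (auto simp: path_length_def even_diff_nat)
  ultimately show "contains is_odd_prism G" unfolding contains_def is_odd_prism_def using XG by blast
qed

lemma adj_state_input:
  assumes "verts G = {..<n}"
  shows "adj_state n (adj G) (input_state n G)"
  unfolding adj_state_def input_state_def by (auto simp: pair_index_less)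

theorem mainTheorem14:
  "\<exists>(prog :: com) (k :: nat) (T :: nat \<Rightarrow> nat).
     (\<lambda>n. real (T n)) \<in> O(\<lambda>n. real n ^ 20) \<and>
     (\<forall>(n :: nat) (G :: nat ugraph).
        simple_graph G \<and> verts G = {..<n} \<and> \<not> contains is_odd_hole G \<longrightarrow>
        (\<exists>t s. exec ((n + 2) ^ k) prog (input_state n G) t s \<and>
               t \<le> T n \<and>
               answer s = (if contains is_odd_prism G then 1 else 0)))"
proof (rule exI[of _ odd_prism_program], rule exI[of _ 20], rule exI[of _ odd_prism_time], intro conjI allI impI)
  show "(\<lambda>n. real (odd_prism_time n)) \<in> O(\<lambda>n. real n ^ 20)" by (rule odd_prism_time_bigo)
  fix n :: nat and G :: "nat ugraph"
  assume "simple_graph G \<and> verts G = {..<n} \<and> \<not> contains is_odd_hole G"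
  then have G: "simple_graph G" "verts G = {..<n}" "\<not> contains is_odd_hole G" by auto
  note hole = simple_graph_no_odd_hole[OF G(1,3)]
  interpret no_odd_hole "adj G" by (rule hole)
  have inn: "adj G u v \<Longrightarrow> u < n" for u v using G unfolding simple_graph_def by blast
  \<comment> \<open>The words must hold matrix indices and list positions as well as the counter up
    to \<open>n ^ 8\<close>. The base \<open>n + 2\<close> is at least 2, so the spare power
    \<open>(n + 2) ^ 18\<close> absorbs the factor 5 even for small \<open>n\<close>.\<close>
  have "n * n + 8 * n + 20 \<le> 5 * (n + 2) ^ 2" by (simp add: power2_eq_square algebra_simps)
  also have "\<dots> \<le> (n + 2) ^ 18 * (n + 2) ^ 2"
  proof (rule mult_le_mono1)
    have "(5 :: nat) \<le> 2 ^ 18" by simp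
    also have "\<dots> \<le> (n + 2) ^ 18" by (rule power_mono) auto
    finally show "5 \<le> (n + 2) ^ 18" .
  qed
  finally have W1: "n * n + 8 * n + 20 \<le> (n + 2) ^ 20" by (simp flip: power_add)
  have "n ^ 8 \<le> (n + 2) ^ 8" by (rule power_mono) auto
  also have "\<dots> \<le> (n + 2) ^ 20" by (rule power_increasing) auto
  finally have W2: "n ^ 8 \<le> (n + 2) ^ 20" .
  have init: "regs (input_state n G) 1 = 0" by (simp add: input_state_def)
  have "run ((n + 2) ^ 20) odd_prism_program (odd_prism_time n) (input_state n G) (\<lambda>s'.
      regs s' 1 = (if \<exists>p q r. prism (adj G) p q r \<and> even (length p) then 1 else 0))"
    by (rule run_odd_prism_program[OF hole _ adj_state_input[OF G(2)] init W1 W2]) (rule inn)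
  then obtain t s where t: "exec ((n + 2) ^ 20) odd_prism_program (input_state n G) t s" "t \<le> odd_prism_time n"
    "regs s 1 = (if \<exists>p q r. prism (adj G) p q r \<and> even (length p) then 1 else 0)"
    unfolding run_def by blast
  have "(\<exists>p q r. prism (adj G) p q r \<and> even (length p)) \<longleftrightarrow> contains is_odd_prism G"
    unfolding contains_odd_prism_iff[OF G(1)] using prism_parity by blast
  then have "answer s = (if contains is_odd_prism G then 1 else 0)"
    unfolding answer_def t(3) by simp
  then show "\<exists>t s. exec ((n + 2) ^ 20) odd_prism_program (input_state n G) t s \<and> t \<le> odd_prism_time n \<and>
    answer s = (if contains is_odd_prism G then 1 else 0)"
    using t(1,2) by blast
qed

end
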